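(* Assume $p>2$ and write $H^*(E,k)=k[\zeta_1,\dots,\zeta_n]\otimes\Lambda^*(\eta_1,\dots,\eta_n)$. Let $\zeta=\eta_1\cdots\eta_s\in H^s(E,k)$ for some $s$ with $1<s<n$. Then the $kE$-module $L_\zeta$ satisfies the following properties: \begin{enumerate} \item $L_\zeta$ has constant $r$-radical type for any $r$ with $r<s$. \item $L_\zeta$ has constant $s$-$\operatorname{Rad}$-rank, but not constant $s$-radical type. \item $L_\zeta$ does not have constant $r$-$\operatorname{Rad}$-rank for any $r$ such that $s<r<n$. \end{enumerate}
   Context: $k$ is an algebraically closed field of characteristic $p>0$, $E$ is an elementary abelian $p$-group of rank $n$, $\mathbb V\subset\operatorname{Rad}(kE)$ is a fixed linear subspace, with basis $x_1,\dots,x_n$, such that $\mathbb V\hookrightarrow\operatorname{Rad}(kE)\to\operatorname{Rad}(kE)/\operatorname{Rad}^2(kE)$ is an isomorphism; so $kE=S^*(\mathbb V)/\langle v^p,v\in\mathbb V\rangle=k[x_1,\dots,x_n]/(x_i^p)$. For $p>2$, $\deg\zeta_i=2$, $\deg\eta_i=1$, and $\eta_1,\dots,\eta_n$ is the basis of $H^1(E,k)\cong\mathbb V^\#$ (linear dual) dual to $x_1,\dots,x_n$. For a nonzero $\zeta\in H^m(E,k)$, $L_\zeta=\ker\{\zeta:\Omega^m(k)\to k\}$, where $\Omega^m(k)$ is the $m$-th Heller shift (syzygy in a minimal projective resolution) of the trivial $kE$-module $k$ and $\zeta:\Omega^m(k)\to k$ is the map representing the class $\zeta$. For a linear subspace $U\subset\mathbb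 V$, $\operatorname{Rad}^j_U(M)$ is the span of all $u_1\cdots u_j m$ with $u_i\in U$, $m\in M$. A finite dimensional $kE$-module $M$ has constant $r$-$\operatorname{Rad}^j$-rank if $\dim\operatorname{Rad}^j_U(M)$ is independent of the choice of the $r$-dimensional subspace $U\subset\mathbb V$; constant $r$-$\operatorname{Rad}$-rank means constant $r$-$\operatorname{Rad}^1$-rank; constant $r$-radical type means constant $r$-$\operatorname{Rad}^j$-rank for all $j$, $1\le j\le(p-1)r$. *)

theory Defs
  imports "HOL-Library.Poly_Mapping" "HOL-Computational_Algebra.Polynomial"
begin

section \<open>The group algebra and its modules\<close>

text \<open>
  The finite abelian group \<open>E\<close> is written additively and is (the universe of) a type
  \<open>'g :: {finite, ab_group_add}\<close>.  Its group algebra over \<open>k\<close> is the type \<open>'g \<Rightarrow>\<^sub>0 'k\<close> with the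
  convolution product; \<open>Poly_Mapping.single g 1\<close> is the group element \<open>g\<close> and
  \<open>Poly_Mapping.single 0 c\<close> is the scalar \<open>c\<close>.  An ambient \<open>kE\<close>-module is given by a scalar
  multiplication \<open>scale\<close> with \<open>module scale\<close>; the modules under consideration are submodules
  (\<open>module.subspace scale\<close>) of such an ambient module.
\<close>

definition elementary_abelian :: "'g::{finite, ab_group_add} itself \<Rightarrow> nat \<Rightarrow> nat \<Rightarrow> bool"
  where "elementary_abelian _ p n \<longleftrightarrow> card (UNIV :: 'g set) = p ^ n \<and> (\<forall>g::'g. (\<Sum>i<p. g) = 0)"

definition kscale :: "(('g::comm_monoid_add \<Rightarrow>\<^sub>0 'k::field) \<Rightarrow> 'm \<Rightarrow> 'm) \<Rightarrow> 'k \<Rightarrow> 'm \<Rightarrow> 'm"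
  where "kscale scale c v = scale (Poly_Mapping.single 0 c) v"

definition aug :: "('g::{finite, ab_group_add} \<Rightarrow>\<^sub>0 'k::field) \<Rightarrow> 'k"
  where "aug a = (\<Sum>g\<in>UNIV. Poly_Mapping.lookup a g)"

definition triv_scale :: "('g::{finite, ab_group_add} \<Rightarrow>\<^sub>0 'k::field) \<Rightarrow> 'k \<Rightarrow> 'k"
  where "triv_scale a c = aug a * c"

definition hom_on ::
  "('r \<Rightarrow> 'a::ab_group_add \<Rightarrow> 'a) \<Rightarrow> ('r \<Rightarrow> 'b::ab_group_add \<Rightarrow> 'b) \<Rightarrow> 'a set \<Rightarrow> ('a \<Rightarrow> 'b) \<Rightarrow> bool"
  where "hom_on s1 s2 M f \<longleftrightarrow>
    (\<forall>x\<in>M. \<forall>y\<in>M. f (x + y) = f x + f y) \<and> (\<forall>r. \<forall>x\<in>M. f (s1 r x) = s2 r (f x))"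

section \<open>Radicals\<close>

definition maximal_ideal :: "'r::comm_ring_1 set \<Rightarrow> bool"
  where "maximal_ideal I \<longleftrightarrow> module.subspace (*) I \<and> I \<noteq> UNIV \<and>
    (\<forall>J. module.subspace (*) J \<and> I \<subseteq> J \<longrightarrow> J = I \<or> J = UNIV)"

definition Rad :: "'r::comm_ring_1 set"
  where "Rad = \<Inter> {I. maximal_ideal I}"

text \<open>
  \<open>Rad_pow scale U j M\<close> is the \<open>k\<close>-span of all \<open>u\<^sub>1 \<cdots> u\<^sub>j m\<close> with \<open>u\<^sub>i \<in> U\<close> and \<open>m \<in> M\<close>.
  With \<open>U = Rad\<close> it is \<open>Rad\<^sup>j(M) = Rad(kE)\<^sup>j M\<close>.
\<close>

definition Rad_pow ::
  "(('g::comm_monoid_add \<Rightarrow>\<^sub>0 'k::field) \<Rightarrow> 'm::ab_group_add \<Rightarrow> 'm) \<Rightarrow>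
   ('g \<Rightarrow>\<^sub>0 'k) set \<Rightarrow> nat \<Rightarrow> 'm set \<Rightarrow> 'm set"
  where "Rad_pow scale U j M = module.span (kscale scale)
    {scale (prod_list us) m | us m. length us = j \<and> set us \<subseteq> U \<and> m \<in> M}"

text \<open>The composite \<open>V \<hookrightarrow> Rad(kE) \<rightarrow> Rad(kE)/Rad\<^sup>2(kE)\<close> is bijective.\<close>

definition lifts_rad_quotient :: "('g::comm_monoid_add \<Rightarrow>\<^sub>0 'k::field) set \<Rightarrow> bool"
  where "lifts_rad_quotient V \<longleftrightarrow> module.subspace (kscale (*)) V \<and> V \<subseteq> Rad \<and>
    (\<forall>a\<in>Rad. \<exists>!v. v \<in> V \<and> a - v \<in> Rad_pow (*) Rad 2 UNIV)"

text \<open>Bases \<open>x\<^sub>1, \<dots>, x\<^sub>n\<close> are functions on \<open>nat\<close> restricted to \<open>{1..n}\<close>.\<close>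

definition basis_of ::
  "('g::comm_monoid_add \<Rightarrow>\<^sub>0 'k::field) set \<Rightarrow> nat \<Rightarrow> (nat \<Rightarrow> 'g \<Rightarrow>\<^sub>0 'k) \<Rightarrow> bool"
  where "basis_of V n x \<longleftrightarrow> inj_on x {1..n} \<and>
    \<not> module.dependent (kscale (*)) (x ` {1..n}) \<and> module.span (kscale (*)) (x ` {1..n}) = V"

definition constant_Rad_rank ::
  "('g::comm_monoid_add \<Rightarrow>\<^sub>0 'k::field) set \<Rightarrow>
   (('g \<Rightarrow>\<^sub>0 'k) \<Rightarrow> 'm::ab_group_add \<Rightarrow> 'm) \<Rightarrow> 'm set \<Rightarrow> nat \<Rightarrow> nat \<Rightarrow> bool"
  where "constant_Rad_rank V scale M r j \<longleftrightarrow>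
    (\<forall>U U'. module.subspace (kscale (*)) U \<and> U \<subseteq> V \<and> vector_space.dim (kscale (*)) U = r \<and>
            module.subspace (kscale (*)) U' \<and> U' \<subseteq> V \<and> vector_space.dim (kscale (*)) U' = r \<longrightarrow>
       vector_space.dim (kscale scale) (Rad_pow scale U j M) =
       vector_space.dim (kscale scale) (Rad_pow scale U' j M))"

definition constant_radical_type ::
  "nat \<Rightarrow> ('g::comm_monoid_add \<Rightarrow>\<^sub>0 'k::field) set \<Rightarrow>
   (('g \<Rightarrow>\<^sub>0 'k) \<Rightarrow> 'm::ab_group_add \<Rightarrow> 'm) \<Rightarrow> 'm set \<Rightarrow> nat \<Rightarrow> bool"
  where "constant_radical_type p V scale M r \<longleftrightarrow>
    (\<forall>j. 1 \<le> j \<and> j \<le> (p - 1) * r \<longrightarrow> constant_Rad_rank V scale M r j)"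

section \<open>The cohomology ring \<open>H\<^sup>*(E,k)\<close>\<close>

text \<open>
  Cohomology is computed by inhomogeneous cochains.  A function \<open>\<phi>\<close> on lists restricts, on lists
  of length \<open>m\<close>, to an \<open>m\<close>-cochain \<open>E\<^sup>m \<rightarrow> M\<close>, i.e. to a homomorphism from the degree \<open>m\<close> part
  of the bar resolution (free on the symbols \<open>[g\<^sub>1|\<dots>|g\<^sub>m]\<close>) to \<open>M\<close>, and
  \<open>bar_diff act \<phi> [g\<^sub>1, \<dots>, g\<^sub>m]\<close> is its value at the boundary
  \<open>g\<^sub>1[g\<^sub>2|\<dots>|g\<^sub>m] + \<Sum> (-1)\<^sup>i [g\<^sub>1|\<dots>|g\<^sub>i + g\<^sub>i\<^sub>+\<^sub>1|\<dots>|g\<^sub>m] + (-1)\<^sup>m [g\<^sub>1|\<dots>|g\<^sub>m\<^sub>-\<^sub>1]\<close>,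
  where \<open>act\<close> is the action of \<open>E\<close> on \<open>M\<close>.  In \<open>bar_diff\<close> the index \<open>i\<close> starts at \<open>0\<close>.
\<close>

definition merge_at :: "nat \<Rightarrow> 'g::plus list \<Rightarrow> 'g list"
  where "merge_at i gs = take i gs @ [gs ! i + gs ! Suc i] @ drop (i + 2) gs"

definition bar_diff ::
  "('g::plus \<Rightarrow> 'm \<Rightarrow> 'm::ab_group_add) \<Rightarrow> ('g list \<Rightarrow> 'm) \<Rightarrow> 'g list \<Rightarrow> 'm"
  where "bar_diff act \<phi> gs =
    act (hd gs) (\<phi> (tl gs))
    + (\<Sum>i<length gs - 1. if even i then - \<phi> (merge_at i gs) else \<phi> (merge_at i gs))
    + (if even (length gs) then \<phi> (butlast gs) else - \<phi> (butlast gs))"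

definition cochains :: "nat \<Rightarrow> ('g list \<Rightarrow> 'k::field) set"
  where "cochains m = {c. \<forall>gs. length gs \<noteq> m \<longrightarrow> c gs = 0}"

definition cocycles :: "nat \<Rightarrow> ('g::plus list \<Rightarrow> 'k::field) set"
  where "cocycles m =
    {c \<in> cochains m. \<forall>gs. length gs = Suc m \<longrightarrow> bar_diff (\<lambda>_ a. a) c gs = 0}"

definition coboundaries :: "nat \<Rightarrow> ('g::plus list \<Rightarrow> 'k::field) set"
  where "coboundaries m = insert (\<lambda>_. 0)
    {(\<lambda>gs. if length gs = m then bar_diff (\<lambda>_ a. a) b gs else 0) | b l.
      m = Suc l \<and> b \<in> cochains l}"

definition coh_class :: "nat \<Rightarrow> ('g::plus list \<Rightarrow> 'k::field) \<Rightarrow> ('g list \<Rightarrow> 'k) set"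
  where "coh_class m c = {(\<lambda>gs. c gs + b gs) | b. b \<in> coboundaries m}"

definition cohomology :: "nat \<Rightarrow> ('g::plus list \<Rightarrow> 'k::field) set set"
  where "cohomology m = coh_class m ` cocycles m"

definition cup_cochain ::
  "nat \<Rightarrow> nat \<Rightarrow> ('g list \<Rightarrow> 'k::field) \<Rightarrow> ('g list \<Rightarrow> 'k) \<Rightarrow> 'g list \<Rightarrow> 'k"
  where "cup_cochain l m a b gs =
    (if length gs = l + m then a (take l gs) * b (drop l gs) else 0)"

definition cup ::
  "nat \<Rightarrow> nat \<Rightarrow> ('g::plus list \<Rightarrow> 'k::field) set \<Rightarrow> ('g list \<Rightarrow> 'k) set \<Rightarrow> ('g list \<Rightarrow> 'k) set"
  where "cup l m A B = (\<Union>a\<in>A. \<Union>b\<in>B. coh_class (l + m) (cup_cochain l m a b))"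

text \<open>The product \<open>\<eta>\<^sub>1 \<cdots> \<eta>\<^sub>s \<in> H\<^sup>s(E,k)\<close> of classes \<open>\<eta>\<^sub>i \<in> H\<^sup>1(E,k)\<close>.\<close>

primrec cup_prod ::
  "(nat \<Rightarrow> ('g::plus list \<Rightarrow> 'k::field) set) \<Rightarrow> nat \<Rightarrow> ('g list \<Rightarrow> 'k) set"
  where
    "cup_prod \<eta> 0 = coh_class 0 (\<lambda>gs. if gs = [] then 1 else 0)"
  | "cup_prod \<eta> (Suc s) = cup s 1 (cup_prod \<eta> s) (\<eta> (Suc s))"

text \<open>
  \<open>H\<^sup>1(E,k) = Hom(E,k)\<close>, and a homomorphism \<open>c\<close>, extended \<open>k\<close>-linearly to \<open>kE\<close>, vanishes on
  \<open>Rad\<^sup>2(kE)\<close> because \<open>c((g - 1)(h - 1)) = c(g + h) - c(g) - c(h) = 0\<close>.  Restricting the extension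
  to \<open>V\<close> is the isomorphism \<open>H\<^sup>1(E,k) \<cong> (Rad/Rad\<^sup>2)\<^sup># \<cong> V\<^sup>#\<close>.
\<close>

definition H1_pairing :: "('g::{finite, ab_group_add} list \<Rightarrow> 'k::field) \<Rightarrow> ('g \<Rightarrow>\<^sub>0 'k) \<Rightarrow> 'k"
  where "H1_pairing c a = (\<Sum>g\<in>UNIV. Poly_Mapping.lookup a g * c [g])"

definition H1_dual_basis ::
  "nat \<Rightarrow> (nat \<Rightarrow> 'g::{finite, ab_group_add} \<Rightarrow>\<^sub>0 'k::field) \<Rightarrow>
   (nat \<Rightarrow> ('g list \<Rightarrow> 'k) set) \<Rightarrow> bool"
  where "H1_dual_basis n x \<eta> \<longleftrightarrow>
    (\<forall>i\<in>{1..n}. \<eta> i \<in> cohomology 1 \<and>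
      (\<forall>c\<in>\<eta> i. \<forall>j\<in>{1..n}. H1_pairing c (x j) = (if i = j then 1 else 0)))"

section \<open>Minimal projective resolutions and the modules \<open>L\<^sub>\<zeta>\<close>\<close>

definition free_scale :: "'r::comm_ring_1 \<Rightarrow> ('i \<Rightarrow>\<^sub>0 'r) \<Rightarrow> ('i \<Rightarrow>\<^sub>0 'r)"
  where "free_scale r F = Poly_Mapping.map ((*) r) F"

text \<open>
  Projective means: a direct summand of a free module.  It suffices to consider the free module on
  the universe of the ambient module: every module is a quotient of the free module on
  its own elements, and onto a projective module this quotient map splits.
\<close>

definition projective_on ::
  "('r::comm_ring_1 \<Rightarrow> 'm::ab_group_add \<Rightarrow> 'm) \<Rightarrow> 'm set \<Rightarrow> bool"
  where "projective_on scale P \<longleftrightarrow> module.subspace scale P \<and>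
    (\<exists>(i :: 'm \<Rightarrow> ('m \<Rightarrow>\<^sub>0 'r)) q. hom_on scale free_scale P i \<and>
       hom_on free_scale scale UNIV q \<and> range q \<subseteq> P \<and> (\<forall>x\<in>P. q (i x) = x))"

text \<open>
  A resolution \<open>\<cdots> \<rightarrow> P\<^sub>2 \<rightarrow> P\<^sub>1 \<rightarrow> P\<^sub>0 \<rightarrow> k \<rightarrow> 0\<close> with differentials \<open>d (Suc i) : P (Suc i) \<rightarrow> P i\<close> and
  augmentation \<open>\<epsilon>\<close>; the value \<open>d 0\<close> is irrelevant.  All \<open>P i\<close> lie in one ambient module,
  which is no restriction (take the direct sum).
\<close>

definition minimal_projective_resolution ::
  "(('g::{finite, ab_group_add} \<Rightarrow>\<^sub>0 'k::field) \<Rightarrow> 'm::ab_group_add \<Rightarrow> 'm) \<Rightarrow>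
   (nat \<Rightarrow> 'm set) \<Rightarrow> (nat \<Rightarrow> 'm \<Rightarrow> 'm) \<Rightarrow> ('m \<Rightarrow> 'k) \<Rightarrow> bool"
  where "minimal_projective_resolution scale P d \<epsilon> \<longleftrightarrow>
    (\<forall>i. projective_on scale (P i)) \<and>
    hom_on scale triv_scale (P 0) \<epsilon> \<and> (\<forall>i. hom_on scale scale (P (Suc i)) (d (Suc i))) \<and>
    \<epsilon> ` P 0 = UNIV \<and>
    d 1 ` P 1 = {x \<in> P 0. \<epsilon> x = 0} \<and>
    (\<forall>i. d (i + 2) ` P (i + 2) = {x \<in> P (i + 1). d (i + 1) x = 0}) \<and>
    (\<forall>i. d (Suc i) ` P (Suc i) \<subseteq> Rad_pow scale Rad 1 (P i))"

text \<open>The Heller shift \<open>\<Omega>\<^sup>m(k)\<close>, for \<open>m \<ge> 1\<close>, as a submodule of \<open>P (m - 1)\<close>.\<close>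

definition Omega :: "(nat \<Rightarrow> 'm set) \<Rightarrow> (nat \<Rightarrow> 'm \<Rightarrow> 'm) \<Rightarrow> nat \<Rightarrow> 'm set"
  where "Omega P d m = d m ` P m"

text \<open>
  A chain map from the bar resolution to \<open>P\<close> over the identity of \<open>k\<close>, given by its values on
  the symbols \<open>[g\<^sub>1|\<dots>|g\<^sub>m]\<close>.
\<close>

definition bar_comparison ::
  "(('g::{finite, ab_group_add} \<Rightarrow>\<^sub>0 'k::field) \<Rightarrow> 'm::ab_group_add \<Rightarrow> 'm) \<Rightarrow>
   (nat \<Rightarrow> 'm set) \<Rightarrow> (nat \<Rightarrow> 'm \<Rightarrow> 'm) \<Rightarrow> ('m \<Rightarrow> 'k) \<Rightarrow> ('g list \<Rightarrow> 'm) \<Rightarrow> bool"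
  where "bar_comparison scale P d \<epsilon> \<phi> \<longleftrightarrow>
    (\<forall>gs. \<phi> gs \<in> P (length gs)) \<and> \<epsilon> (\<phi> []) = 1 \<and>
    (\<forall>gs. gs \<noteq> [] \<longrightarrow>
       d (length gs) (\<phi> gs) = bar_diff (\<lambda>g. scale (Poly_Mapping.single g 1)) \<phi> gs)"

text \<open>
  \<open>f : \<Omega>\<^sup>m(k) \<rightarrow> k\<close> represents \<open>\<zeta> \<in> H\<^sup>m(E,k)\<close> if the cocycle \<open>f \<circ> d : P m \<rightarrow> k\<close>, pulled back along
  a comparison map to the bar resolution, has class \<open>\<zeta>\<close>.  The class does not
  depend on the comparison map.
\<close>

definition represents ::
  "(('g::{finite, ab_group_add} \<Rightarrow>\<^sub>0 'k::field) \<Rightarrow> 'm::ab_group_add \<Rightarrow> 'm) \<Rightarrow>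
   (nat \<Rightarrow> 'm set) \<Rightarrow> (nat \<Rightarrow> 'm \<Rightarrow> 'm) \<Rightarrow> ('m \<Rightarrow> 'k) \<Rightarrow> nat \<Rightarrow> ('m \<Rightarrow> 'k) \<Rightarrow>
   ('g list \<Rightarrow> 'k) set \<Rightarrow> bool"
  where "represents scale P d \<epsilon> m f \<zeta> \<longleftrightarrow>
    hom_on scale triv_scale (Omega P d m) f \<and>
    (\<exists>\<phi>. bar_comparison scale P d \<epsilon> \<phi> \<and>
         coh_class m (\<lambda>gs. if length gs = m then f (d m (\<phi> gs)) else 0) = \<zeta>)"

definition is_L_zeta ::
  "(('g::{finite, ab_group_add} \<Rightarrow>\<^sub>0 'k::field) \<Rightarrow> 'm::ab_group_add \<Rightarrow> 'm) \<Rightarrow>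
   nat \<Rightarrow> ('g list \<Rightarrow> 'k) set \<Rightarrow> 'm set \<Rightarrow> bool"
  where "is_L_zeta scale m \<zeta> L \<longleftrightarrow>
    (\<exists>P d \<epsilon> f. minimal_projective_resolution scale P d \<epsilon> \<and> represents scale P d \<epsilon> m f \<zeta> \<and>
       L = {x \<in> Omega P d m. f x = 0})"

end

theory Submission
  imports Defs "HOL-Library.FuncSet"
begin

text \<open>
  Let \<open>\<Omega> = \<Omega>\<^sup>s(k)\<close>, let \<open>f : \<Omega> \<rightarrow> k\<close> represent \<open>\<zeta>\<close>, choose \<open>w \<in> \<Omega>\<close> with \<open>f(w) = 1\<close>, and write \<open>I\<close> for the
  augmentation ideal of \<open>kE\<close>.  For \<open>U \<subseteq> V\<close> of dimension \<open>r\<close> the map \<open>a \<mapsto> a w\<close> induces a surjection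
  from \<open>Rad\<^sub>U\<^sup>j(kE) / Rad\<^sub>U\<^sup>j(I)\<close> to \<open>Rad\<^sub>U\<^sup>j(\<Omega>) / Rad\<^sub>U\<^sup>j(L\<^sub>\<zeta>)\<close>.  All automorphisms of \<open>V\<close> extend to \<open>kE\<close>
  and, semilinearly, to the minimal resolution, so the dimensions of the source and of
  \<open>Rad\<^sub>U\<^sup>j(\<Omega>)\<close> depend only on \<open>r\<close>; everything reduces to whether this surjection is injective.

  If \<open>c\<close> is a one-dimensional class and \<open>a\<close> is represented by \<open>P\<^sub>m \<rightarrow> k\<close>, then lifting this map to
  \<open>P\<^sub>m \<rightarrow> kE\<close> and applying \<open>c : I \<rightarrow> k\<close> on \<open>\<Omega>\<^sup>m\<^sup>+\<^sup>1\<close> represents \<open>c a\<close>.  When \<open>\<eta>\<^sub>1, \<dots>, \<eta>\<^sub>s\<close> are linearly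
  dependent on \<open>U\<close>, one can write \<open>\<zeta> = c a\<close> with \<open>c\<close> vanishing on \<open>U\<close>, and then \<open>f\<close> factors through a
  \<open>k[U]\<close>-linear map \<open>\<Omega> \<rightarrow> kE\<close>; this forces injectivity for all \<open>j\<close>.  When they are independent on
  \<open>U\<close>, the Koszul complex of \<open>x\<^sub>1, \<dots>, x\<^sub>r\<close> maps to the resolution, and the value of \<open>f\<close> on the image
  of an exterior product is a determinant of values of the \<open>\<eta>\<^sub>i\<close>.  Its relations give elements
  in the kernel for \<open>r = s\<close>, \<open>j = (p - 1) s\<close> and for \<open>r > s\<close>, \<open>j = 1\<close>.  For \<open>r = s\<close> and \<open>j = 1\<close> there is
  no kernel because the product of \<open>\<zeta>\<close> with any one-dimensional class vanishes on \<open>U\<close>.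
\<close>

section \<open>Linear algebra\<close>

text \<open>Two features of the definitions shape the proof. A minimal resolution is not assumed to
  be finite-dimensional, while \<open>dim\<close> takes a default value on infinite-dimensional
  spaces; finiteness is therefore obtained by embedding each \<open>P i\<close> into the bar
  resolution. Moreover classes are sets of cochains, whereas the rank computations need functions on
  \<open>P m\<close>. Minimality makes the homomorphism representing a class unique, not merely
  unique up to homotopy, so relations between bar cochains become equalities of functions on
  \<open>P m\<close>.

  A k[U]-linear g with aug (g z) = f z gives injectivity as follows: g sends L into the radical and
  w to a unit, so a relation placing a w in Rad_U^j(L), with a a combination of products from U,
  places a g(w), hence a, in Rad_U^j(I). The derivation given by c takes scalar values and is not
  itself such a map; it has to be written as the augmentation of a k[U]-linear operator, built from
  shifts of monomials.

  For s <= r < n both behaviours occur: the span of x_1, ..., x_r has a kernel in a suitable degree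
  j, while some other r-dimensional U lies in the kernel of eta_1. This is the role of r <
  n.\<close>

lemma hom_on_linear_ext:
  assumes "vector_space s1" "vector_space s2" "module.subspace s1 M" "hom_on s1 s2 M f"
  shows "\<exists>g. Vector_Spaces.linear s1 s2 g \<and> (\<forall>x\<in>M. g x = f x)"
proof -
  interpret a: vector_space s1 by fact
  interpret b: vector_space s2 by fact
  interpret vector_space_pair s1 s2 ..
  obtain B where B: "B \<subseteq> M" "a.independent B" "M \<subseteq> a.span B"
    using a.basis_exists by metis
  have M: "M = a.span B" using B assms(3) by (simp add: a.span_subspace)
  define g where "g = construct B f"
  have g: "Vector_Spaces.linear s1 s2 g" unfolding g_def using B by (simp add: linear_construct)
  interpret g: Vector_Spaces.linear s1 s2 g by fact
  have add: "f (x + y) = f x + f y" if "x \<in> M" "y \<in> M" for x y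
    using assms(4) that by (auto simp: hom_on_def)
  have sc: "f (s1 c x) = s2 c (f x)" if "x \<in> M" for x c
    using assms(4) that by (auto simp: hom_on_def)
  have "x \<in> M \<and> g x = f x" if "x \<in> a.span B" for x
    using that
  proof (induction rule: a.span_induct_alt)
    case base
    have "f 0 + f 0 = f 0" using add[of 0 0] a.subspace_0[OF assms(3)] by simp
    then show ?case using a.subspace_0[OF assms(3)] by (simp add: g.zero)
  next
    case (step c x y)
    have "x \<in> M" using step B by auto
    moreover have "g x = f x" unfolding g_def using B step by (simp add: construct_basis)
    ultimately show ?case using step assms(3) add[of "s1 c x" y] sc[of x c]
      by (auto simp: g.add g.scale a.subspace_add a.subspace_scale)
  qed
  then show ?thesis using g M by blast
qed

text \<open>The spanning set \<open>W\<close> guards against the default value of \<open>dim\<close>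
  on infinite-dimensional spaces. Finiteness of \<open>M\<close> is part of the conclusion because
  the modules of a resolution obtain theirs from an embedding.\<close>

lemma dim_le_of_inj:
  assumes "vector_space s1" "vector_space s2" "module.subspace s1 M" "hom_on s1 s2 M f"
    and inj: "\<And>x. x \<in> M \<Longrightarrow> f x = 0 \<Longrightarrow> x = 0"
    and im: "f ` M \<subseteq> N" and N: "N \<subseteq> module.span s2 W" "finite W"
  shows "(\<exists>B. finite B \<and> M \<subseteq> module.span s1 B) \<and> vector_space.dim s1 M \<le> vector_space.dim s2 N"
proof -
  interpret a: vector_space s1 by fact
  interpret b: vector_space s2 by fact
  obtain g where g: "Vector_Spaces.linear s1 s2 g" "\<And>x. x \<in> M \<Longrightarrow> g x = f x"
    using hom_on_linear_ext[OF assms(1-4)] by blast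
  interpret g: Vector_Spaces.linear s1 s2 g by fact
  obtain B where B: "B \<subseteq> M" "a.independent B" "M \<subseteq> a.span B" "card B = a.dim M"
    using a.basis_exists by metis
  have M: "M = a.span B" using B assms(3) by (simp add: a.span_subspace)
  have "inj_on g M"
    using g inj assms(3) by (metis (no_types, lifting) M g.inj_on_iff_eq_0)
  then have ind: "b.independent (g ` B)"
    using B(2) M g.independent_injective_image by blast
  have sub: "g ` B \<subseteq> N" using B(1) g(2) im by force
  obtain C where C: "C \<subseteq> N" "b.independent C" "N \<subseteq> b.span C" "card C = b.dim N"
    using b.basis_exists by metis
  have "finite C" using b.independent_span_bound[OF N(2) C(2)] C(1) N(1) by auto
  then have *: "finite (g ` B)" "card (g ` B) \<le> card C"
    using b.independent_span_bound[OF _ ind] sub C(3) by auto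
  have inj: "inj_on g B" using \<open>inj_on g M\<close> B(1) inj_on_subset by blast
  have "finite B" using * inj finite_image_iff by blast
  then show ?thesis using B * C inj by (metis card_image)
qed

lemma dim_mono_fin:
  assumes "vector_space s" "M \<subseteq> N" "N \<subseteq> module.span s W" "finite W"
  shows "vector_space.dim s M \<le> vector_space.dim s N"
proof -
  interpret a: vector_space s by fact
  obtain C where C: "C \<subseteq> N" "a.independent C" "N \<subseteq> a.span C" "card C = a.dim N"
    using a.basis_exists by metis
  have "finite C" using a.independent_span_bound[OF assms(4) C(2)] C(1) assms by auto
  then show ?thesis using a.dim_le_card[of M C] assms(2) C by auto
qed

lemma dim_psubset_fin:
  assumes "vector_space s" "M \<subset> N" "module.subspace s M" "N \<subseteq> module.span s W" "finite W"
  shows "vector_space.dim s M < vector_space.dim s N"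
proof -
  interpret a: vector_space s by fact
  obtain B where B: "B \<subseteq> M" "a.independent B" "M \<subseteq> a.span B" "card B = a.dim M"
    using a.basis_exists by metis
  obtain x where x: "x \<in> N" "x \<notin> M" using assms(2) by blast
  have "x \<notin> a.span B" using x B assms(3) a.span_minimal by blast
  then have ind: "a.independent (insert x B)" using B(2) by (simp add: a.independent_insert)
  have fin: "finite (insert x B)"
    using a.independent_span_bound[OF assms(5) ind] B(1) x assms(2,4) by (meson insert_subset psubsetE subset_trans)
  have "a.dim (insert x B) = card (insert x B)" using ind by (rule a.dim_eq_card_independent)
  also have "\<dots> = Suc (card B)" using fin x B by (subst card_insert_disjoint) auto
  finally have "Suc (a.dim M) = a.dim (insert x B)" using B by simp
  also have "\<dots> \<le> a.dim N" by (rule dim_mono_fin[OF assms(1) _ assms(4,5)]) (use x B assms in auto)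
  finally show ?thesis by simp
qed

text \<open>This is rank-nullity for the map from \<open>X\<close> to (T X + Y) / Y induced by
  \<open>T\<close>, written without a quotient.\<close>

lemma dim_sum_preimage:
  assumes "vector_space s1" "vector_space s2" "Vector_Spaces.linear s1 s2 T"
    and X: "module.subspace s1 X" "X \<subseteq> module.span s1 W1" "finite W1"
    and Y: "module.subspace s2 Y" "Y \<subseteq> module.span s2 W2" "finite W2"
  shows "vector_space.dim s2 {T x + y |x y. x \<in> X \<and> y \<in> Y} + vector_space.dim s1 {x \<in> X. T x \<in> Y}
       = vector_space.dim s1 X + vector_space.dim s2 Y"
proof -
  interpret a: vector_space s1 by fact
  interpret b: vector_space s2 by fact
  interpret T: Vector_Spaces.linear s1 s2 T by fact
  define K where "K = {x \<in> X. T x \<in> Y}"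
  have K: "a.subspace K" unfolding K_def
    using X(1) Y(1) unfolding a.subspace_def b.subspace_def
    by (auto simp: T.add T.zero T.scale)
  obtain BK where BK: "BK \<subseteq> K" "a.independent BK" "K \<subseteq> a.span BK" "card BK = a.dim K"
    using a.basis_exists by metis
  have "BK \<subseteq> X" using BK K_def by auto
  then obtain BX where BX: "BK \<subseteq> BX" "BX \<subseteq> X" "a.independent BX" "X \<subseteq> a.span BX"
    using a.maximal_independent_subset_extend[OF _ BK(2)] by metis
  obtain BY where BY: "BY \<subseteq> Y" "b.independent BY" "Y \<subseteq> b.span BY" "card BY = b.dim Y"
    using b.basis_exists by metis
  have fin: "finite BX" using a.independent_span_bound[OF X(3) BX(3)] BX(2) X(2) by auto
  have finY: "finite BY" using b.independent_span_bound[OF Y(3) BY(2)] BY(1) Y(2) by auto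
  have sBX: "a.span BX = X" using BX X a.span_subspace by blast
  have sBY: "b.span BY = Y" using BY Y b.span_subspace by blast
  have sBK: "a.span BK = K" using BK K a.span_subspace by blast
  \<comment> \<open>Basis vectors of \<open>X\<close> outside the kernel basis have images that are
    independent modulo \<open>Y\<close>; they are added one at a time to the basis of
    \<open>Y\<close>.\<close>
  have main: "b.independent (BY \<union> T ` C) \<and> card (BY \<union> T ` C) = card BY + card C"
    if "finite C" "C \<subseteq> BX - BK" for C
    using that
  proof (induction C rule: finite_induct)
    case empty
    then show ?case using BY by simp
  next
    case (insert c C)
    have nin: "T c \<notin> b.span (BY \<union> T ` C)"
    proof
      assume "T c \<in> b.span (BY \<union> T ` C)"
      then obtain y z where yz: "T c = y + z" "y \<in> Y" "z \<in> b.span (T ` C)"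
        unfolding b.span_Un sBY by blast
      then obtain x where x: "z = T x" "x \<in> a.span C" using T.span_image by blast
      have "a.span C \<subseteq> X" using sBX insert.prems by (metis Diff_subset a.span_mono insert_subset order_trans)
      then have "c - x \<in> X" using x BX(2) insert.prems X(1) by (intro a.subspace_diff) auto
      then have "c - x \<in> K" unfolding K_def
        using x yz by (auto simp: T.diff)
      moreover have "c = (c - x) + x" by simp
      ultimately have "c \<in> a.span (BK \<union> C)"
        unfolding a.span_Un sBK using x(2) by blast
      then have "c \<in> a.span (BX - {c})"
        by (rule subsetD[OF a.span_mono, rotated]) (use insert.prems insert.hyps(2) BX(1) in blast)
      moreover have "c \<in> BX" using insert.prems by blast
      ultimately show False using BX(3) unfolding a.dependent_def by blast
    qed
    then have "T c \<notin> BY \<union> T ` C" using b.span_base[of "T c" "BY \<union> T ` C"] by blast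
    moreover have "b.independent (BY \<union> T ` C)" "card (BY \<union> T ` C) = card BY + card C"
      using insert by auto
    ultimately show ?case using nin insert.hyps finY by (simp add: b.independent_insert)
  qed
  let ?C = "BX - BK" let ?Z = "{T x + y |x y. x \<in> X \<and> y \<in> Y}"
  have m: "b.independent (BY \<union> T ` ?C)" "card (BY \<union> T ` ?C) = card BY + card ?C"
    using main[of ?C] fin by auto
  have sub: "BY \<union> T ` ?C \<subseteq> ?Z"
  proof
    fix z assume "z \<in> BY \<union> T ` ?C"
    then show "z \<in> ?Z"
    proof
      assume "z \<in> BY"
      then have "z = T 0 + z \<and> 0 \<in> X \<and> z \<in> Y" using BY(1) a.subspace_0[OF X(1)] by (auto simp: T.zero)
      then show ?thesis by blast
    next
      assume "z \<in> T ` ?C"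
      then obtain x where "z = T x + 0 \<and> x \<in> X \<and> 0 \<in> Y"
        using BX(2) b.subspace_0[OF Y(1)] by auto
      then show ?thesis by blast
    qed
  qed
  have sp: "?Z \<subseteq> b.span (BY \<union> T ` ?C)"
  proof
    fix z assume "z \<in> ?Z"
    then obtain x y where z: "z = T x + y" "x \<in> X" "y \<in> Y" by blast
    have "x \<in> a.span (BK \<union> ?C)" using sBX z(2) BX(1) by (metis Un_Diff_cancel Un_absorb1)
    then obtain u v where uv: "x = u + v" "u \<in> K" "v \<in> a.span ?C"
      unfolding a.span_Un sBK by blast
    have "z = (T u + y) + T v" using uv z by (simp add: T.add)
    moreover have "T u + y \<in> b.span BY" unfolding sBY using uv z Y(1) by (auto simp: K_def b.subspace_add)
    moreover have "T v \<in> b.span (T ` ?C)" using uv(3) T.span_image by blast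
    ultimately show "z \<in> b.span (BY \<union> T ` ?C)" unfolding b.span_Un by blast
  qed
  have "b.dim ?Z = card BY + card ?C"
    using b.basis_card_eq_dim[OF sub sp m(1)] m(2) by simp
  moreover have "card ?C + card BK = card BX" using fin BX(1)
    by (simp add: card_Diff_subset finite_subset card_mono)
  moreover have "card BX = a.dim X" using a.basis_card_eq_dim[OF BX(2,4,3)] .
  ultimately show ?thesis using BK(4) BY(4) unfolding K_def[symmetric] by simp
qed

section \<open>Homomorphisms and radicals\<close>

lemma kscale_vector_space:
  assumes "module scale"
  shows "vector_space (kscale (scale :: ('g::comm_monoid_add \<Rightarrow>\<^sub>0 'k::field) \<Rightarrow> 'm::ab_group_add \<Rightarrow> 'm))"
proof -
  interpret module scale by fact
  show ?thesis
    by unfold_locales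
      (simp_all add: kscale_def scale_right_distrib scale_left_distrib single_add mult_single)
qed

lemma subspace_kscale:
  assumes "module scale" "module.subspace scale M"
  shows "module.subspace (kscale scale) M"
proof -
  interpret module scale by fact
  interpret k: vector_space "kscale scale" by (rule kscale_vector_space) fact
  show ?thesis using assms(2) by (auto simp: subspace_def k.subspace_def kscale_def)
qed

lemma module_mult: "module ((*) :: 'r::comm_ring_1 \<Rightarrow> 'r \<Rightarrow> 'r)"
  by unfold_locales (simp_all add: algebra_simps)

lemma hom_onI:
  assumes "\<And>x y. x \<in> M \<Longrightarrow> y \<in> M \<Longrightarrow> f (x + y) = f x + f y"
    and "\<And>r x. x \<in> M \<Longrightarrow> f (s1 r x) = s2 r (f x)"
  shows "hom_on s1 s2 M f"
  using assms by (auto simp: hom_on_def)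

lemma hom_on_add: "hom_on s1 s2 M f \<Longrightarrow> x \<in> M \<Longrightarrow> y \<in> M \<Longrightarrow> f (x + y) = f x + f y"
  by (auto simp: hom_on_def)

lemma hom_on_scale: "hom_on s1 s2 M f \<Longrightarrow> x \<in> M \<Longrightarrow> f (s1 r x) = s2 r (f x)"
  by (auto simp: hom_on_def)

lemma hom_on_0:
  assumes "hom_on s1 s2 M f" "module s1" "module.subspace s1 M"
  shows "f 0 = 0"
proof -
  have "0 \<in> M" using assms module.subspace_0 by blast
  then have "f 0 + f 0 = f 0" using hom_on_add[OF assms(1), of 0 0] by simp
  then show ?thesis by simp
qed

lemma hom_on_diff:
  assumes "hom_on s1 s2 M f" "module s1" "module.subspace s1 M" "x \<in> M" "y \<in> M"
  shows "f (x - y) = f x - f y"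
proof -
  have "x - y \<in> M" using assms module.subspace_diff by blast
  then have "f (x - y) + f y = f x" using hom_on_add[OF assms(1), of "x - y" y] assms(5) by simp
  then show ?thesis by (simp add: algebra_simps)
qed

lemma hom_on_minus:
  assumes "hom_on s1 s2 M f" "module s1" "module.subspace s1 M" "y \<in> M"
  shows "f (- y) = - f y"
  using hom_on_diff[OF assms(1-3), of 0 y] hom_on_0[OF assms(1-3)] assms
  by (simp add: module.subspace_0)

lemma hom_on_sum:
  assumes "hom_on s1 s2 M f" "module s1" "module.subspace s1 M" "\<And>i. i \<in> A \<Longrightarrow> x i \<in> M"
  shows "f (\<Sum>i\<in>A. x i) = (\<Sum>i\<in>A. f (x i))"
proof (cases "finite A")
  case True
  then show ?thesis using assms(4)
  proof (induction A rule: finite_induct)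
    case empty
    then show ?case using hom_on_0[OF assms(1-3)] by simp
  next
    case (insert a A)
    then show ?case
      using hom_on_add[OF assms(1), of "x a" "sum x A"] module.subspace_sum[OF assms(2,3), of A x] by simp
  qed
qed (use hom_on_0[OF assms(1-3)] in simp)

lemma hom_on_subset: "hom_on s1 s2 M f \<Longrightarrow> N \<subseteq> M \<Longrightarrow> hom_on s1 s2 N f"
  by (auto simp: hom_on_def subset_iff)

lemma hom_on_comp:
  assumes "hom_on s1 s2 M f" "hom_on s2 s3 N g" "f ` M \<subseteq> N"
  shows "hom_on s1 s3 M (\<lambda>x. g (f x))"
  using assms by (auto simp: hom_on_def image_subset_iff)

lemma hom_on_minus_fun:
  assumes "hom_on s1 s2 M f" "hom_on s1 s2 M g" "module s2"
  shows "hom_on s1 s2 M (\<lambda>x. f x - g x)"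
  using assms by (auto simp: hom_on_def module.scale_right_diff_distrib algebra_simps)

lemma hom_on_kscale: "hom_on s1 s2 M f \<Longrightarrow> hom_on (kscale s1) (kscale s2) M f"
  by (auto simp: hom_on_def kscale_def)

lemma hom_on_id: "hom_on s s M (\<lambda>x. x)"
  by (auto simp: hom_on_def)

lemma subspace_image:
  assumes "hom_on s1 s2 M f" "module s1" "module.subspace s1 M" "module s2"
  shows "module.subspace s2 (f ` M)"
proof -
  interpret a: module s1 by fact
  interpret b: module s2 by fact
  show ?thesis
  proof (rule b.subspaceI)
    show "0 \<in> f ` M" using hom_on_0[OF assms(1-3)] a.subspace_0[OF assms(3)] by force
  next
    fix x y assume "x \<in> f ` M" "y \<in> f ` M"
    then show "x + y \<in> f ` M"
      using hom_on_add[OF assms(1)] a.subspace_add[OF assms(3)] by (metis (no_types, lifting) imageE imageI)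
  next
    fix c x assume "x \<in> f ` M"
    then show "s2 c x \<in> f ` M"
      using hom_on_scale[OF assms(1)] a.subspace_scale[OF assms(3)] by (metis (no_types, lifting) imageE imageI)
  qed
qed

lemma subspace_kernel:
  assumes "hom_on s1 s2 M f" "module s1" "module.subspace s1 M" "module s2"
  shows "module.subspace s1 {x \<in> M. f x = 0}"
proof -
  interpret a: module s1 by fact
  interpret b: module s2 by fact
  show ?thesis
    by (rule a.subspaceI)
      (use hom_on_0[OF assms(1-3)] hom_on_add[OF assms(1)] hom_on_scale[OF assms(1)] assms(3)
        in \<open>auto simp: a.subspace_0 a.subspace_add a.subspace_scale b.scale_zero_right\<close>)
qed

text \<open>The step carries no scalar: a coefficient can be absorbed into \<open>m\<close>, because
  \<open>M\<close> is a k-subspace.\<close>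

lemma Rad_pow_induct [consumes 3, case_names zero step]:
  assumes "x \<in> Rad_pow scale U j M" "module scale" "module.subspace (kscale scale) M"
    and "P 0"
    and "\<And>us m y. length us = j \<Longrightarrow> set us \<subseteq> U \<Longrightarrow> m \<in> M \<Longrightarrow> y \<in> Rad_pow scale U j M \<Longrightarrow> P y \<Longrightarrow>
           P (scale (prod_list us) m + y)"
  shows "P x"
proof -
  interpret module scale by fact
  interpret k: vector_space "kscale scale" by (rule kscale_vector_space) fact
  have "x \<in> Rad_pow scale U j M \<and> P x" using assms(1) unfolding Rad_pow_def
  proof (induction rule: k.span_induct_alt)
    case base
    then show ?case using assms(4) k.span_zero by simp
  next
    case (step c x y)
    then obtain us m where *: "x = scale (prod_list us) m" "length us = j" "set us \<subseteq> U" "m \<in> M" by blast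
    have eq: "kscale scale c x = scale (prod_list us) (kscale scale c m)"
      unfolding * by (simp add: kscale_def mult.commute)
    have m: "kscale scale c m \<in> M" using *(4) assms(3) k.subspace_scale by blast
    have "P (kscale scale c x + y)"
      unfolding eq by (rule assms(5)[OF *(2,3) m]) (use step.IH in \<open>simp_all add: Rad_pow_def\<close>)
    moreover have "kscale scale c x + y \<in> k.span {scale (prod_list us) m |us m. length us = j \<and> set us \<subseteq> U \<and> m \<in> M}"
      using step(2) by (intro k.span_add k.span_scale k.span_base[OF step(1)]) simp
    ultimately show ?case by simp
  qed
  then show ?thesis by blast
qed

context
  fixes scale :: "('g::comm_monoid_add \<Rightarrow>\<^sub>0 'k::field) \<Rightarrow> 'm::ab_group_add \<Rightarrow> 'm"
  assumes mod: "module scale"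
begin

interpretation module scale by (rule mod)
interpretation k: vector_space "kscale scale" by (rule kscale_vector_space[OF mod])

lemma subspace_Rad_pow_k: "module.subspace (kscale scale) (Rad_pow scale U j M)"
  unfolding Rad_pow_def by simp

lemma Rad_pow_gen: "length us = j \<Longrightarrow> set us \<subseteq> U \<Longrightarrow> m \<in> M \<Longrightarrow> scale (prod_list us) m \<in> Rad_pow scale U j M"
  unfolding Rad_pow_def by (intro k.span_base) blast

lemma Rad_pow_add: "x \<in> Rad_pow scale U j M \<Longrightarrow> y \<in> Rad_pow scale U j M \<Longrightarrow> x + y \<in> Rad_pow scale U j M"
  by (rule k.subspace_add[OF subspace_Rad_pow_k])

lemma Rad_pow_0: "0 \<in> Rad_pow scale U j M"
  by (rule k.subspace_0[OF subspace_Rad_pow_k])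

lemma Rad_pow_diff: "x \<in> Rad_pow scale U j M \<Longrightarrow> y \<in> Rad_pow scale U j M \<Longrightarrow> x - y \<in> Rad_pow scale U j M"
  by (rule k.subspace_diff[OF subspace_Rad_pow_k])

lemma Rad_pow_sum: "(\<And>i. i \<in> A \<Longrightarrow> x i \<in> Rad_pow scale U j M) \<Longrightarrow> (\<Sum>i\<in>A. x i) \<in> Rad_pow scale U j M"
  by (rule k.subspace_sum[OF subspace_Rad_pow_k])

lemma Rad_pow_mono: "U \<subseteq> U' \<Longrightarrow> M \<subseteq> M' \<Longrightarrow> Rad_pow scale U j M \<subseteq> Rad_pow scale U' j M'"
  unfolding Rad_pow_def by (intro k.span_mono) blast

lemma Rad_pow_subset: "module.subspace scale M \<Longrightarrow> Rad_pow scale U j M \<subseteq> M"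
  unfolding Rad_pow_def
  by (intro k.span_minimal subspace_kscale[OF mod]) (auto simp: subspace_scale)

lemma Rad_pow_scale:
  assumes "module.subspace scale M" "x \<in> Rad_pow scale U j M"
  shows "scale a x \<in> Rad_pow scale U j M"
  using assms(2) mod subspace_kscale[OF mod assms(1)]
proof (induction rule: Rad_pow_induct)
  case zero
  then show ?case by (simp add: Rad_pow_0)
next
  case (step us m y)
  have "scale a (scale (prod_list us) m) = scale (prod_list us) (scale a m)"
    by (simp add: mult.commute)
  then show ?case
    using step Rad_pow_gen[of us j U "scale a m" M] subspace_scale[OF assms(1)]
    by (simp add: scale_right_distrib Rad_pow_add)
qed

lemma subspace_Rad_pow: "module.subspace scale M \<Longrightarrow> module.subspace scale (Rad_pow scale U j M)"
  by (rule subspaceI) (auto intro: Rad_pow_scale Rad_pow_add Rad_pow_0)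

lemma Rad_pow_Rad_pow:
  assumes "module.subspace (kscale scale) M"
  shows "Rad_pow scale U j (Rad_pow scale U i M) \<subseteq> Rad_pow scale U (j + i) M"
proof
  fix x assume "x \<in> Rad_pow scale U j (Rad_pow scale U i M)"
  then show "x \<in> Rad_pow scale U (j + i) M" using mod subspace_Rad_pow_k
  proof (induction rule: Rad_pow_induct)
    case zero
    then show ?case by (simp add: Rad_pow_0)
  next
    case (step us m y)
    from step(3) mod assms have "scale (prod_list us) m \<in> Rad_pow scale U (j + i) M"
    proof (induction rule: Rad_pow_induct)
      case zero
      then show ?case by (simp add: Rad_pow_0)
    next
      case (step vs m y)
      have "scale (prod_list us) (scale (prod_list vs) m) = scale (prod_list (us @ vs)) m" by simp
      moreover have "scale (prod_list (us @ vs)) m \<in> Rad_pow scale U (j + i) M"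
        by (rule Rad_pow_gen) (use step \<open>length us = j\<close> \<open>set us \<subseteq> U\<close> in auto)
      ultimately show ?case using step by (simp add: scale_right_distrib Rad_pow_add)
    qed
    then show ?case using step by (simp add: Rad_pow_add)
  qed
qed

end

text \<open>Two kinds of maps that are not kE-linear are covered: maps linear over U only, with the
  identity as \<open>\<sigma>\<close>, and maps semilinear along an automorphism
  \<open>\<sigma>\<close> of kE.\<close>

lemma Rad_pow_map:
  assumes s: "module s1" "module s2" "module.subspace s1 M"
    and add: "\<And>x y. x \<in> M \<Longrightarrow> y \<in> M \<Longrightarrow> f (x + y) = f x + f y"
    and sc: "\<And>u x. u \<in> U \<Longrightarrow> x \<in> M \<Longrightarrow> f (s1 u x) = s2 (\<sigma> u) (f x)"
    and sub: "\<sigma> ` U \<subseteq> U'" "f ` M \<subseteq> N"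
    and x: "x \<in> Rad_pow s1 U j M"
  shows "f x \<in> Rad_pow s2 U' j N"
proof -
  interpret a: module s1 by (rule s)
  interpret b: module s2 by (rule s)
  have prod: "f (s1 (prod_list us) m) = s2 (prod_list (map \<sigma> us)) (f m)" if "set us \<subseteq> U" "m \<in> M" for us m
    using that
  proof (induction us)
    case (Cons u us)
    have "f (s1 (prod_list (u # us)) m) = f (s1 u (s1 (prod_list us) m))" by simp
    also have "\<dots> = s2 (\<sigma> u) (f (s1 (prod_list us) m))"
      using Cons a.subspace_scale[OF s(3)] by (intro sc) auto
    finally show ?case using Cons by simp
  qed simp
  have f0: "f 0 = 0" using add[of 0 0] a.subspace_0[OF s(3)] by simp
  from x s(1) subspace_kscale[OF s(1,3)] show ?thesis
  proof (induction rule: Rad_pow_induct)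
    case zero
    then show ?case using f0 by (simp add: Rad_pow_0[OF s(2)])
  next
    case (step us m y)
    have "y \<in> M" using step Rad_pow_subset[OF s(1,3)] by blast
    moreover have "s1 (prod_list us) m \<in> M" using step a.subspace_scale[OF s(3)] by simp
    moreover have "s2 (prod_list (map \<sigma> us)) (f m) \<in> Rad_pow s2 U' j N"
      by (rule Rad_pow_gen[OF s(2)]) (use step sub in auto)
    ultimately show ?case using step prod[of us m] by (simp add: add Rad_pow_add[OF s(2)])
  qed
qed

lemma Rad_pow_hom:
  assumes "module s1" "module s2" "module.subspace s1 M" "hom_on s1 s2 M f" "f ` M \<subseteq> N"
    and "x \<in> Rad_pow s1 U j M"
  shows "f x \<in> Rad_pow s2 U j N"
  by (rule Rad_pow_map[OF assms(1-3) _ _ _ assms(5,6), where \<sigma> = "\<lambda>x. x"])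
    (use assms(4) in \<open>auto simp: hom_on_def\<close>)

section \<open>Free and projective modules\<close>

text \<open>The homomorphism out of a free module with prescribed values on its basis.\<close>

definition ext :: "('r::comm_ring_1 \<Rightarrow> 'm::ab_group_add \<Rightarrow> 'm) \<Rightarrow> ('i \<Rightarrow> 'm) \<Rightarrow> ('i \<Rightarrow>\<^sub>0 'r) \<Rightarrow> 'm"
  where "ext s y F = (\<Sum>i\<in>Poly_Mapping.keys F. s (Poly_Mapping.lookup F i) (y i))"

lemma lookup_free_scale: "Poly_Mapping.lookup (free_scale r F) i = r * Poly_Mapping.lookup F i"
  unfolding free_scale_def by (simp add: Poly_Mapping.map.rep_eq when_def)

lemma module_free_scale: "module free_scale"
  by unfold_locales
    (auto intro!: poly_mapping_eqI simp: lookup_free_scale lookup_add algebra_simps)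

lemma free_scale_single: "free_scale r (Poly_Mapping.single i a) = Poly_Mapping.single i (r * a)"
  by (intro poly_mapping_eqI) (simp add: lookup_free_scale lookup_single when_def)

lemma ext_superset:
  assumes "module s" "finite K" "Poly_Mapping.keys F \<subseteq> K"
  shows "ext s y F = (\<Sum>i\<in>K. s (Poly_Mapping.lookup F i) (y i))"
  unfolding ext_def using assms
  by (intro sum.mono_neutral_left) (auto simp: in_keys_iff module.scale_zero_left)

lemma hom_on_ext:
  assumes "module s"
  shows "hom_on free_scale s UNIV (ext s y)"
proof (rule hom_onI)
  fix F G :: "'c \<Rightarrow>\<^sub>0 'a"
  let ?K = "Poly_Mapping.keys F \<union> Poly_Mapping.keys G"
  show "ext s y (F + G) = ext s y F + ext s y G"
    using Poly_Mapping.keys_add[of F G]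
    by (subst (1 2 3) ext_superset[OF assms, of ?K])
      (auto simp: lookup_add module.scale_left_distrib[OF assms] sum.distrib)
next
  fix r and F :: "'c \<Rightarrow>\<^sub>0 'a"
  have "Poly_Mapping.keys (free_scale r F) \<subseteq> Poly_Mapping.keys F"
    by (auto simp: in_keys_iff lookup_free_scale)
  then show "ext s y (free_scale r F) = s r (ext s y F)"
    by (subst (1 2) ext_superset[OF assms, of "Poly_Mapping.keys F"])
      (auto simp: lookup_free_scale module.scale_sum_right[OF assms] module.scale_scale[OF assms])
qed

lemma ext_single: "module s \<Longrightarrow> ext s y (Poly_Mapping.single i a) = s a (y i)"
  by (subst ext_superset[of _ "{i}"]) (auto simp: in_keys_iff lookup_single when_def split: if_splits)

lemma poly_mapping_sum_singles: "F = (\<Sum>i\<in>Poly_Mapping.keys F. Poly_Mapping.single i (Poly_Mapping.lookup F i))"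
proof (intro poly_mapping_eqI)
  fix k
  have "(\<Sum>i\<in>Poly_Mapping.keys F. Poly_Mapping.lookup (Poly_Mapping.single i (Poly_Mapping.lookup F i)) k)
      = (\<Sum>i\<in>Poly_Mapping.keys F. if i = k then Poly_Mapping.lookup F k else 0)"
    by (intro sum.cong) (auto simp: lookup_single when_def)
  then show "Poly_Mapping.lookup F k = Poly_Mapping.lookup (\<Sum>i\<in>Poly_Mapping.keys F. Poly_Mapping.single i (Poly_Mapping.lookup F i)) k"
    by (simp add: lookup_sum in_keys_iff)
qed

text \<open>Agreement is demanded on the support of \<open>F\<close> only, so that identities in the
  bar complex can be checked in one degree, away from the junk boundary of the empty list.\<close>

lemma hom_free_eqI:
  fixes f g :: "('i \<Rightarrow>\<^sub>0 'r::comm_ring_1) \<Rightarrow> 'm::ab_group_add"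
  assumes f: "hom_on free_scale s UNIV f" and g: "hom_on free_scale s UNIV g"
    and eq: "\<And>i. i \<in> Poly_Mapping.keys F \<Longrightarrow> f (Poly_Mapping.single i 1) = g (Poly_Mapping.single i 1)"
  shows "f F = g F"
proof -
  have U: "module.subspace free_scale UNIV" by (simp add: module.subspace_UNIV module_free_scale)
  have "f (Poly_Mapping.single i a) = g (Poly_Mapping.single i a)" if "i \<in> Poly_Mapping.keys F" for i a
    using hom_on_scale[OF f, of "Poly_Mapping.single i 1" a] hom_on_scale[OF g, of "Poly_Mapping.single i 1" a] eq[OF that]
    by (simp add: free_scale_single)
  then have "f (\<Sum>i\<in>Poly_Mapping.keys F. Poly_Mapping.single i (Poly_Mapping.lookup F i))
      = g (\<Sum>i\<in>Poly_Mapping.keys F. Poly_Mapping.single i (Poly_Mapping.lookup F i))"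
    by (subst hom_on_sum[OF f module_free_scale U], simp, subst hom_on_sum[OF g module_free_scale U], simp)
      (intro sum.cong, auto)
  then show ?thesis by (simp flip: poly_mapping_sum_singles)
qed

text \<open>The free module of which \<open>P\<close> is a summand is mapped to \<open>Y\<close> by
  choosing preimages for the images of its basis vectors under h q. Restriction along
  \<open>i\<close> then gives the lift, since q (i x) = x.\<close>

lemma projective_lift:
  assumes P: "projective_on scale P"
    and m: "module s2" and Y: "module.subspace s2 Y"
    and \<pi>: "hom_on s2 s3 Y \<pi>" and h: "hom_on scale s3 P h" and im: "h ` P \<subseteq> \<pi> ` Y"
  shows "\<exists>h'. hom_on scale s2 P h' \<and> h' ` P \<subseteq> Y \<and> (\<forall>x\<in>P. \<pi> (h' x) = h x)"
proof -
  obtain i :: "'b \<Rightarrow> ('b \<Rightarrow>\<^sub>0 'a)" and q where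
    "hom_on scale free_scale P i \<and> hom_on free_scale scale UNIV q \<and> range q \<subseteq> P \<and> (\<forall>x\<in>P. q (i x) = x)"
    using P[unfolded projective_on_def, THEN conjunct2] by (elim exE) (rule that)
  then have iq: "hom_on scale free_scale P i" "hom_on free_scale scale UNIV q"
    "range q \<subseteq> P" "\<forall>x\<in>P. q (i x) = x"
    by simp_all
  have "\<forall>a. \<exists>y. y \<in> Y \<and> \<pi> y = h (q (Poly_Mapping.single a 1))"
  proof
    fix a
    have "q (Poly_Mapping.single a 1) \<in> P" using iq(3) by blast
    then have "h (q (Poly_Mapping.single a 1)) \<in> \<pi> ` Y" using im by blast
    then show "\<exists>y. y \<in> Y \<and> \<pi> y = h (q (Poly_Mapping.single a 1))" by force
  qed
  then obtain y where y: "\<And>a. y a \<in> Y" "\<And>a. \<pi> (y a) = h (q (Poly_Mapping.single a 1))" by metis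
  have e: "hom_on free_scale s2 UNIV (ext s2 y)" by (rule hom_on_ext[OF m])
  have eY: "ext s2 y F \<in> Y" for F
    unfolding ext_def by (intro module.subspace_sum[OF m Y] module.subspace_scale[OF m Y] y)
  have eq: "\<pi> (ext s2 y F) = h (q F)" for F
  proof (rule hom_free_eqI[where s = s3])
    show "hom_on free_scale s3 UNIV (\<lambda>F. \<pi> (ext s2 y F))"
      by (rule hom_on_comp[OF e \<pi>]) (use eY in auto)
    show "hom_on free_scale s3 UNIV (\<lambda>F. h (q F))"
      by (rule hom_on_comp[OF iq(2) h]) (use iq in auto)
    show "\<pi> (ext s2 y (Poly_Mapping.single i 1)) = h (q (Poly_Mapping.single i 1))" for i
      using y by (simp add: ext_single[OF m] module.scale_one[OF m])
  qed
  have "hom_on scale s2 P (\<lambda>x. ext s2 y (i x))"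
    by (rule hom_on_comp[OF iq(1) e]) simp
  moreover have "(\<lambda>x. ext s2 y (i x)) ` P \<subseteq> Y" using eY by blast
  moreover have "\<forall>x\<in>P. \<pi> (ext s2 y (i x)) = h x" using eq iq(4) by metis
  ultimately show ?thesis by (intro exI[of _ "\<lambda>x. ext s2 y (i x)"] conjI)
qed

section \<open>The augmentation\<close>

lemma aug_add: "aug (a + b) = aug a + aug b"
  by (simp add: aug_def lookup_add sum.distrib)

lemma aug_0 [simp]: "aug 0 = 0"
  by (simp add: aug_def)

lemma aug_diff: "aug (a - b) = aug a - aug b"
  by (simp add: aug_def lookup_minus sum_subtractf)

lemma aug_sum: "aug (sum f A) = (\<Sum>i\<in>A. aug (f i))"
  by (induction A rule: infinite_finite_induct) (auto simp: aug_add)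

lemma aug_single [simp]: "aug (Poly_Mapping.single g c) = c"
  by (simp add: aug_def lookup_single when_def)

lemma sum_singles:
  fixes a :: "'g::finite \<Rightarrow>\<^sub>0 'k::comm_monoid_add"
  shows "a = (\<Sum>g\<in>UNIV. Poly_Mapping.single g (Poly_Mapping.lookup a g))"
  by (intro poly_mapping_eqI) (simp add: lookup_sum lookup_single when_def)

lemma aug_mult [simp]: "aug (a * b) = aug a * aug b"
proof -
  have "a * b = (\<Sum>g\<in>UNIV. Poly_Mapping.single g (Poly_Mapping.lookup a g)) *
      (\<Sum>h\<in>UNIV. Poly_Mapping.single h (Poly_Mapping.lookup b h))"
    using sum_singles[of a] sum_singles[of b] by simp
  also have "aug \<dots> = (\<Sum>g\<in>UNIV. \<Sum>h\<in>UNIV. Poly_Mapping.lookup a g * Poly_Mapping.lookup b h)"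
    by (simp add: sum_product aug_sum mult_single)
  finally show ?thesis by (simp add: aug_def sum_product)
qed

lemma aug_1 [simp]: "aug 1 = 1"
  using aug_single[of 0 1] by simp

lemma module_triv_scale: "module triv_scale"
  by unfold_locales (simp_all add: triv_scale_def algebra_simps aug_add)

lemma hom_on_aug: "hom_on (*) triv_scale UNIV aug"
  by (auto intro!: hom_onI simp: triv_scale_def aug_add)

section \<open>Comparison of resolutions\<close>

text \<open>Exactness appears as inclusions of kernels in images, the form in which inductive
  lifting consumes it.\<close>

definition acyclic_complex ::
  "('r::comm_ring_1 \<Rightarrow> 'm::ab_group_add \<Rightarrow> 'm) \<Rightarrow> ('r \<Rightarrow> 'c::ab_group_add \<Rightarrow> 'c) \<Rightarrow>
    (nat \<Rightarrow> 'm set) \<Rightarrow> (nat \<Rightarrow> 'm \<Rightarrow> 'm) \<Rightarrow> ('m \<Rightarrow> 'c) \<Rightarrow> bool"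
  where "acyclic_complex scale s0 C e \<epsilon> \<longleftrightarrow>
    (\<forall>i. module.subspace scale (C i)) \<and> hom_on scale s0 (C 0) \<epsilon> \<and>
    (\<forall>i. hom_on scale scale (C (Suc i)) (e (Suc i)) \<and> e (Suc i) ` C (Suc i) \<subseteq> C i) \<and>
    \<epsilon> ` C 0 = UNIV \<and> {x \<in> C 0. \<epsilon> x = 0} \<subseteq> e (Suc 0) ` C (Suc 0) \<and>
    (\<forall>i. {x \<in> C (Suc i). e (Suc i) x = 0} \<subseteq> e (Suc (Suc i)) ` C (Suc (Suc i)))"

locale min_res =
  fixes scale :: "('g::{finite, ab_group_add} \<Rightarrow>\<^sub>0 'k::field) \<Rightarrow> 'm::ab_group_add \<Rightarrow> 'm"
    and P :: "nat \<Rightarrow> 'm set" and d :: "nat \<Rightarrow> 'm \<Rightarrow> 'm" and \<epsilon> :: "'m \<Rightarrow> 'k"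
  assumes mod: "module scale"
    and res: "minimal_projective_resolution scale P d \<epsilon>"
begin

sublocale module scale by (rule mod)

sublocale k: vector_space "kscale scale" by (rule kscale_vector_space[OF mod])

lemma proj: "projective_on scale (P i)"
  using res unfolding minimal_projective_resolution_def by (elim conjE) (erule allE, assumption)

lemma Psub: "subspace (P i)"
  using proj unfolding projective_on_def by (rule conjunct1)

lemma dhom: "hom_on scale scale (P (Suc i)) (d (Suc i))"
  using res unfolding minimal_projective_resolution_def by (elim conjE) (erule allE, assumption)

lemma \<epsilon>hom: "hom_on scale triv_scale (P 0) \<epsilon>"
  using res unfolding minimal_projective_resolution_def by (elim conjE)

lemma \<epsilon>surj: "\<epsilon> ` P 0 = UNIV"
  using res unfolding minimal_projective_resolution_def by (elim conjE)

lemma ex0: "d (Suc 0) ` P (Suc 0) = {x \<in> P 0. \<epsilon> x = 0}"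
  using res unfolding minimal_projective_resolution_def by simp

lemma exS: "d (Suc (Suc i)) ` P (Suc (Suc i)) = {x \<in> P (Suc i). d (Suc i) x = 0}"
  using res unfolding minimal_projective_resolution_def by simp

lemma dRad: "y \<in> P (Suc i) \<Longrightarrow> d (Suc i) y \<in> Rad_pow scale Rad 1 (P i)"
  using res unfolding minimal_projective_resolution_def by (elim conjE) (erule allE[of _ i], erule subsetD, erule imageI)

lemma dP: "y \<in> P (Suc i) \<Longrightarrow> d (Suc i) y \<in> P i"
  using ex0 exS[of "i - 1"] by (cases i) auto

lemma \<epsilon>d: "y \<in> P (Suc 0) \<Longrightarrow> \<epsilon> (d (Suc 0) y) = 0"
  using ex0 by auto

lemma dd: "y \<in> P (Suc (Suc i)) \<Longrightarrow> d (Suc i) (d (Suc (Suc i)) y) = 0"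
  using exS by auto

lemmas P_closed = subspace_0[OF Psub] subspace_add[OF Psub] subspace_scale[OF Psub]
  subspace_diff[OF Psub] subspace_neg[OF Psub] subspace_sum[OF Psub]

definition comparison_map where
  "comparison_map s2 C e \<epsilon>2 \<Theta> \<longleftrightarrow> (\<forall>i. hom_on scale s2 (P i) (\<Theta> i) \<and> \<Theta> i ` P i \<subseteq> C i) \<and>
    (\<forall>y\<in>P 0. \<epsilon>2 (\<Theta> 0 y) = \<epsilon> y) \<and>
    (\<forall>i. \<forall>y\<in>P (Suc i). e (Suc i) (\<Theta> (Suc i) y) = \<Theta> i (d (Suc i) y))"

lemma comparison_mapD:
  assumes "comparison_map s2 C e \<epsilon>2 \<Theta>"
  shows "hom_on scale s2 (P i) (\<Theta> i)" "y \<in> P i \<Longrightarrow> \<Theta> i y \<in> C i" "y \<in> P 0 \<Longrightarrow> \<epsilon>2 (\<Theta> 0 y) = \<epsilon> y"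
    "y \<in> P (Suc i) \<Longrightarrow> e (Suc i) (\<Theta> (Suc i) y) = \<Theta> i (d (Suc i) y)"
  using assms unfolding comparison_map_def by auto

lemma comparison:
  assumes m2: "module s2" and C: "acyclic_complex s2 triv_scale C e \<epsilon>2"
  shows "\<exists>\<Theta>. comparison_map s2 C e \<epsilon>2 \<Theta>"
proof -
  have C: "\<And>i. module.subspace s2 (C i)" "hom_on s2 triv_scale (C 0) \<epsilon>2"
    "\<And>i. hom_on s2 s2 (C (Suc i)) (e (Suc i))" "\<And>i. e (Suc i) ` C (Suc i) \<subseteq> C i"
    "\<epsilon>2 ` C 0 = UNIV" "{x \<in> C 0. \<epsilon>2 x = 0} \<subseteq> e (Suc 0) ` C (Suc 0)"
    "\<And>i. {x \<in> C (Suc i). e (Suc i) x = 0} \<subseteq> e (Suc (Suc i)) ` C (Suc (Suc i))"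
    using C unfolding acyclic_complex_def by auto
  \<comment> \<open>The last clause says that the next lifting problem is solvable. It involves
    \<open>\<theta>\<close> alone, so dependent choice applies.\<close>
  define R where "R n \<theta> \<longleftrightarrow> hom_on scale s2 (P n) \<theta> \<and> \<theta> ` P n \<subseteq> C n \<and>
      (n = 0 \<longrightarrow> (\<forall>y\<in>P 0. \<epsilon>2 (\<theta> y) = \<epsilon> y)) \<and>
      (\<forall>y\<in>P (Suc n). \<theta> (d (Suc n) y) \<in> e (Suc n) ` C (Suc n))" for n \<theta>
  have "\<exists>f. \<forall>n. R n (f n) \<and> (\<forall>y\<in>P (Suc n). e (Suc n) (f (Suc n) y) = f n (d (Suc n) y))"
  proof (rule dependent_nat_choice)
    obtain h where h: "hom_on scale s2 (P 0) h" "h ` P 0 \<subseteq> C 0" "\<forall>x\<in>P 0. \<epsilon>2 (h x) = \<epsilon> x"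
      using projective_lift[OF proj m2 C(1,2) \<epsilon>hom] C(5) by auto
    have "h (d (Suc 0) y) \<in> e (Suc 0) ` C (Suc 0)" if "y \<in> P (Suc 0)" for y
    proof -
      have "d (Suc 0) y \<in> P 0" using that by (rule dP)
      then have "h (d (Suc 0) y) \<in> {x \<in> C 0. \<epsilon>2 x = 0}" using h that \<epsilon>d by auto
      then show ?thesis using C(6) by blast
    qed
    then show "\<exists>x. R 0 x" unfolding R_def using h by blast
  next
    fix \<theta> n assume "R n \<theta>"
    then have \<theta>: "hom_on scale s2 (P n) \<theta>" "\<theta> ` P n \<subseteq> C n"
      "\<forall>y\<in>P (Suc n). \<theta> (d (Suc n) y) \<in> e (Suc n) ` C (Suc n)" unfolding R_def by auto
    have "hom_on scale s2 (P (Suc n)) (\<lambda>y. \<theta> (d (Suc n) y))"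
      by (rule hom_on_comp[OF dhom \<theta>(1)]) (use dP in blast)
    then obtain h where h: "hom_on scale s2 (P (Suc n)) h" "h ` P (Suc n) \<subseteq> C (Suc n)"
      "\<forall>y\<in>P (Suc n). e (Suc n) (h y) = \<theta> (d (Suc n) y)"
      using projective_lift[OF proj m2 C(1,3), of "Suc n" "\<lambda>y. \<theta> (d (Suc n) y)" n] \<theta>(3) by blast
    have "h (d (Suc (Suc n)) y) \<in> e (Suc (Suc n)) ` C (Suc (Suc n))" if "y \<in> P (Suc (Suc n))" for y
    proof -
      have "d (Suc (Suc n)) y \<in> P (Suc n)" using that by (rule dP)
      moreover have "\<theta> 0 = 0" by (rule hom_on_0[OF \<theta>(1) mod Psub])
      ultimately have "h (d (Suc (Suc n)) y) \<in> {x \<in> C (Suc n). e (Suc n) x = 0}"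
        using h that dd by auto
      then show ?thesis using C(7) by blast
    qed
    then show "\<exists>y. R (Suc n) y \<and> (\<forall>ya\<in>P (Suc n). e (Suc n) (y ya) = \<theta> (d (Suc n) ya))"
      unfolding R_def using h by blast
  qed
  then obtain f where f: "\<And>n. R n (f n)" "\<And>n. \<forall>y\<in>P (Suc n). e (Suc n) (f (Suc n) y) = f n (d (Suc n) y)"
    by blast
  show ?thesis
    by (rule exI[of _ f]) (use f in \<open>simp add: R_def comparison_map_def\<close>)
qed

definition chain_endo :: "(nat \<Rightarrow> 'm \<Rightarrow> 'm) \<Rightarrow> bool"
  where "chain_endo g \<longleftrightarrow> (\<forall>i. hom_on scale scale (P i) (g i) \<and> g i ` P i \<subseteq> P i \<and>
    (\<forall>y\<in>P (Suc i). d (Suc i) (g (Suc i) y) = g i (d (Suc i) y)))"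

definition homotopy :: "(nat \<Rightarrow> 'm \<Rightarrow> 'm) \<Rightarrow> (nat \<Rightarrow> 'm \<Rightarrow> 'm) \<Rightarrow> bool"
  where "homotopy g h \<longleftrightarrow> (\<forall>i. hom_on scale scale (P i) (h i) \<and> h i ` P i \<subseteq> P (Suc i)) \<and>
    (\<forall>y\<in>P 0. g 0 y = d (Suc 0) (h 0 y)) \<and>
    (\<forall>i. \<forall>y\<in>P (Suc i). g (Suc i) y = d (Suc (Suc i)) (h (Suc i) y) + h i (d (Suc i) y))"

lemma homotopyD:
  assumes "homotopy g h"
  shows "hom_on scale scale (P i) (h i)" "h i ` P i \<subseteq> P (Suc i)" "y \<in> P i \<Longrightarrow> h i y \<in> P (Suc i)"
    "y \<in> P 0 \<Longrightarrow> g 0 y = d (Suc 0) (h 0 y)"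
    "y \<in> P (Suc i) \<Longrightarrow> g (Suc i) y = d (Suc (Suc i)) (h (Suc i) y) + h i (d (Suc i) y)"
  using assms unfolding homotopy_def by auto

text \<open>The same dependent choice as in \<open>comparison\<close>; the invariant now makes g
  minus the previous homotopy after d take values in cycles, which are boundaries by
  exactness.\<close>

lemma null_homotopy:
  assumes "chain_endo g" and g0: "\<And>y. y \<in> P 0 \<Longrightarrow> \<epsilon> (g 0 y) = 0"
  shows "\<exists>h. homotopy g h"
proof -
  have g: "\<And>i. hom_on scale scale (P i) (g i)" "\<And>i y. y \<in> P i \<Longrightarrow> g i y \<in> P i"
    "\<And>i y. y \<in> P (Suc i) \<Longrightarrow> d (Suc i) (g (Suc i) y) = g i (d (Suc i) y)"
    using assms(1) unfolding chain_endo_def by blast+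
  define R where "R n \<theta> \<longleftrightarrow> hom_on scale scale (P n) \<theta> \<and> \<theta> ` P n \<subseteq> P (Suc n) \<and>
      (n = 0 \<longrightarrow> (\<forall>y\<in>P 0. g 0 y = d (Suc 0) (\<theta> y))) \<and>
      (\<forall>y\<in>P (Suc n). d (Suc n) (\<theta> (d (Suc n) y)) = g n (d (Suc n) y))" for n \<theta>
  have "\<exists>f. \<forall>n. R n (f n) \<and> (\<forall>y\<in>P (Suc n). g (Suc n) y = d (Suc (Suc n)) (f (Suc n) y) + f n (d (Suc n) y))"
  proof (rule dependent_nat_choice)
    have "g 0 ` P 0 \<subseteq> d (Suc 0) ` P (Suc 0)" unfolding ex0 using g g0 by auto
    then obtain h where h: "hom_on scale scale (P 0) h" "h ` P 0 \<subseteq> P (Suc 0)"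
      "\<forall>x\<in>P 0. d (Suc 0) (h x) = g 0 x"
      using projective_lift[OF proj mod Psub dhom g(1)[of 0]] by blast
    show "\<exists>x. R 0 x" unfolding R_def using h dP by (intro exI[of _ h]) auto
  next
    fix \<theta> n assume "R n \<theta>"
    then have \<theta>: "hom_on scale scale (P n) \<theta>" "\<And>y. y \<in> P n \<Longrightarrow> \<theta> y \<in> P (Suc n)"
      "\<And>y. y \<in> P (Suc n) \<Longrightarrow> d (Suc n) (\<theta> (d (Suc n) y)) = g n (d (Suc n) y)"
      unfolding R_def by auto
    have td: "hom_on scale scale (P (Suc n)) (\<lambda>y. \<theta> (d (Suc n) y))"
      by (rule hom_on_comp[OF dhom \<theta>(1)]) (use dP in blast)
    have "d (Suc n) (g (Suc n) y - \<theta> (d (Suc n) y)) = 0" if "y \<in> P (Suc n)" for y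
      using hom_on_diff[OF dhom mod Psub, of "g (Suc n) y" n "\<theta> (d (Suc n) y)"] that g \<theta> dP by simp
    then have "(\<lambda>y. g (Suc n) y - \<theta> (d (Suc n) y)) ` P (Suc n) \<subseteq> d (Suc (Suc n)) ` P (Suc (Suc n))"
      unfolding exS using g \<theta> dP P_closed by auto
    then obtain h where h: "hom_on scale scale (P (Suc n)) h" "h ` P (Suc n) \<subseteq> P (Suc (Suc n))"
      "\<forall>x\<in>P (Suc n). d (Suc (Suc n)) (h x) = g (Suc n) x - \<theta> (d (Suc n) x)"
      using projective_lift[OF proj mod Psub dhom hom_on_minus_fun[OF g(1) td mod]] by blast
    have "\<theta> 0 = 0" by (rule hom_on_0[OF \<theta>(1) mod Psub])
    then have "d (Suc (Suc n)) (h (d (Suc (Suc n)) y)) = g (Suc n) (d (Suc (Suc n)) y)"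
      if "y \<in> P (Suc (Suc n))" for y
      using h(3) that dP[OF that] dd[OF that] by simp
    then show "\<exists>y. R (Suc n) y \<and> (\<forall>ya\<in>P (Suc n). g (Suc n) ya = d (Suc (Suc n)) (y ya) + \<theta> (d (Suc n) ya))"
      unfolding R_def using h by (intro exI[of _ h]) auto
  qed
  then obtain f where f: "\<And>n. R n (f n)"
    "\<And>n. \<forall>y\<in>P (Suc n). g (Suc n) y = d (Suc (Suc n)) (f (Suc n) y) + f n (d (Suc n) y)"
    by blast
  show ?thesis
    by (rule exI[of _ f]) (use f in \<open>simp add: R_def homotopy_def\<close>)
qed

text \<open>Minimality turns the homotopy between \<open>T\<close> and the identity into a congruence modulo the radical.\<close>

lemma chain_endo_id_mod_Rad:
  assumes T: "chain_endo T" and T0: "\<And>y. y \<in> P 0 \<Longrightarrow> \<epsilon> (T 0 y) = \<epsilon> y" and y: "y \<in> P i"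
  shows "T i y - y \<in> Rad_pow scale Rad 1 (P i)"
proof -
  let ?g = "\<lambda>i y. T i y - y"
  have t: "\<And>i. hom_on scale scale (P i) (T i)" "\<And>i y. y \<in> P i \<Longrightarrow> T i y \<in> P i"
    "\<And>i y. y \<in> P (Suc i) \<Longrightarrow> d (Suc i) (T (Suc i) y) = T i (d (Suc i) y)"
    using T unfolding chain_endo_def by blast+
  have "chain_endo ?g"
    unfolding chain_endo_def
  proof (intro allI conjI ballI)
    fix i show "hom_on scale scale (P i) (?g i)" by (rule hom_on_minus_fun[OF t(1) hom_on_id mod])
    show "?g i ` P i \<subseteq> P i" using t P_closed by auto
    fix y assume "y \<in> P (Suc i)"
    then show "d (Suc i) (?g (Suc i) y) = ?g i (d (Suc i) y)"
      using hom_on_diff[OF dhom mod Psub, of "T (Suc i) y" i y] t by simp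
  qed
  moreover have "\<epsilon> (?g 0 y) = 0" if "y \<in> P 0" for y
    using hom_on_diff[OF \<epsilon>hom mod Psub, of "T 0 y" y] t(2)[OF that] T0[OF that] that by simp
  ultimately obtain h where "homotopy ?g h" using null_homotopy[of ?g] by blast
  note h = homotopyD[OF this]
  show ?thesis
  proof (cases i)
    case 0
    have "h 0 y \<in> P (Suc 0)" using h(3) y 0 by blast
    then show ?thesis using h(4) y 0 dRad[of "h 0 y" 0] by simp
  next
    case (Suc j)
    have "h (Suc j) y \<in> P (Suc (Suc j))" using h(3) y Suc by blast
    then have 1: "d (Suc (Suc j)) (h (Suc j) y) \<in> Rad_pow scale Rad 1 (P i)"
      unfolding Suc by (rule dRad)
    have "d (Suc j) y \<in> Rad_pow scale Rad 1 (P j)" using y Suc by (intro dRad) simp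
    then have 2: "h j (d (Suc j) y) \<in> Rad_pow scale Rad 1 (P i)"
      unfolding Suc by (rule Rad_pow_hom[OF mod mod Psub h(1,2)])
    show ?thesis using h(5) y Suc Rad_pow_add[OF mod 1 2] by auto
  qed
qed

text \<open>If T y = 0 then y = - (T y - y). Since T minus the identity raises the radical
  filtration by one, such a y lies in every power of the radical.\<close>

lemma chain_endo_inj:
  assumes nil: "\<And>i. Rad_pow scale Rad N (P i) = {0}"
    and T: "chain_endo T" and T0: "\<And>y. y \<in> P 0 \<Longrightarrow> \<epsilon> (T 0 y) = \<epsilon> y" and y: "y \<in> P i" "T i y = 0"
  shows "y = 0"
proof -
  have hom: "hom_on scale scale (P i) (\<lambda>y. T i y - y)"
    using T unfolding chain_endo_def by (intro hom_on_minus_fun[OF _ hom_on_id mod]) blast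
  have "y \<in> Rad_pow scale Rad k (P i)" for k
  proof (induction k)
    case 0
    show ?case using Rad_pow_gen[OF mod, of "[]" 0 Rad y "P i"] y by simp
  next
    case (Suc k)
    have "T i y - y \<in> Rad_pow scale Rad k (Rad_pow scale Rad 1 (P i))"
      by (rule Rad_pow_hom[OF mod mod Psub hom _ Suc])
        (use chain_endo_id_mod_Rad[OF T T0] in blast)
    then have "- y \<in> Rad_pow scale Rad (Suc k) (P i)"
      using Rad_pow_Rad_pow[OF mod subspace_kscale[OF mod Psub], of Rad k 1 i] y(2) by auto
    then have "0 - (- y) \<in> Rad_pow scale Rad (Suc k) (P i)"
      by (intro Rad_pow_diff[OF mod] Rad_pow_0[OF mod])
    then show ?case by simp
  qed
  then show ?thesis using nil by blast
qed

end

section \<open>The group algebra of an elementary abelian group\<close>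

interpretation A: finite_dimensional_vector_space
  "kscale ((*) :: ('g::{finite, ab_group_add} \<Rightarrow>\<^sub>0 'k::field) \<Rightarrow> _)"
  "range (\<lambda>g. Poly_Mapping.single g 1)"
proof -
  interpret vector_space "kscale ((*) :: ('g::{finite, ab_group_add} \<Rightarrow>\<^sub>0 'k::field) \<Rightarrow> _)"
    by (rule kscale_vector_space[OF module_mult])
  let ?B = "range (\<lambda>g::'g. Poly_Mapping.single g (1::'k))"
  have eq: "kscale (*) (Poly_Mapping.lookup a g) (Poly_Mapping.single g 1) = Poly_Mapping.single g (Poly_Mapping.lookup a g)"
    for a :: "'g \<Rightarrow>\<^sub>0 'k" and g by (simp add: kscale_def mult_single)
  show "finite_dimensional_vector_space (kscale ((*) :: ('g \<Rightarrow>\<^sub>0 'k) \<Rightarrow> _)) ?B"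
  proof
    show "finite ?B" by simp
    show "span ?B = UNIV"
    proof (intro set_eqI iffI UNIV_I)
      fix a :: "'g \<Rightarrow>\<^sub>0 'k"
      have "a = (\<Sum>g\<in>UNIV. kscale (*) (Poly_Mapping.lookup a g) (Poly_Mapping.single g 1))"
        unfolding eq by (rule sum_singles)
      also have "\<dots> \<in> span ?B" by (intro span_sum span_scale span_base) simp
      finally show "a \<in> span ?B" .
    qed
    have inj: "inj (\<lambda>g::'g. Poly_Mapping.single g (1::'k))"
      by (auto intro!: injI simp: poly_mapping_eq_iff fun_eq_iff lookup_single when_def split: if_splits)
    show "independent ?B"
    proof (rule independent_if_scalars_zero)
      fix f x
      assume s: "(\<Sum>x\<in>?B. kscale (*) (f x) x) = 0" and x: "x \<in> ?B"
      then obtain g where g: "x = Poly_Mapping.single g 1" by blast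
      have "(\<Sum>h\<in>UNIV. kscale (*) (f (Poly_Mapping.single h 1)) (Poly_Mapping.single h 1)) = 0"
        using s by (subst (asm) sum.reindex[OF inj]) simp
      then have "Poly_Mapping.lookup (\<Sum>h\<in>UNIV. Poly_Mapping.single h (f (Poly_Mapping.single h 1))) g = 0"
        by (simp add: kscale_def mult_single)
      then show "f x = 0" unfolding g by (simp add: lookup_sum lookup_single when_def)
    qed simp
  qed
qed

lemma dim_group_algebra:
  "A.dim (UNIV :: ('g::{finite, ab_group_add} \<Rightarrow>\<^sub>0 'k::field) set) = card (UNIV :: 'g set)"
proof -
  have "inj (\<lambda>g::'g. Poly_Mapping.single g (1::'k))"
    by (auto intro!: injI simp: poly_mapping_eq_iff fun_eq_iff lookup_single when_def split: if_splits)
  then show ?thesis by (simp add: A.dim_UNIV card_image)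
qed

lemma A_span_mult:
  fixes x y :: "'g::{finite, ab_group_add} \<Rightarrow>\<^sub>0 'k::field"
  assumes "x \<in> A.span S" "y \<in> A.span T" and sub: "\<And>s t. s \<in> S \<Longrightarrow> t \<in> T \<Longrightarrow> s * t \<in> A.span R"
  shows "x * y \<in> A.span R"
  using assms(1)
proof (induction rule: A.span_induct_alt)
  case base
  then show ?case by (simp add: A.span_zero)
next
  case (step c s z)
  have "s * y \<in> A.span R" using assms(2)
  proof (induction rule: A.span_induct_alt)
    case base
    then show ?case by (simp add: A.span_zero)
  next
    case (step c t w)
    have "s * (kscale (*) c t + w) = kscale (*) c (s * t) + s * w"
      by (simp add: kscale_def algebra_simps)
    then show ?case using sub[OF \<open>s \<in> S\<close>] step by (simp add: A.span_add A.span_scale)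
  qed
  moreover have "(kscale (*) c s + z) * y = kscale (*) c (s * y) + z * y"
    by (simp add: kscale_def algebra_simps)
  ultimately show ?case using step by (simp add: A.span_add A.span_scale)
qed

section \<open>Monomials in elements of the group algebra\<close>

definition mon :: "nat \<Rightarrow> (nat \<Rightarrow> 'r::comm_ring_1) \<Rightarrow> (nat \<Rightarrow> nat) \<Rightarrow> 'r"
  where "mon N y b = (\<Prod>i\<in>{1..N}. y i ^ b i)"

lemma mon_mult: "mon N y b * mon N y b' = mon N y (\<lambda>i. b i + b' i)"
  by (simp add: mon_def power_add prod.distrib)

lemma mon_unit: "i \<in> {1..N} \<Longrightarrow> mon N y (\<lambda>j. if j = i then 1 else 0) = y i"
proof -
  assume i: "i \<in> {1..N}"
  have "mon N y (\<lambda>j. if j = i then 1 else 0) = (\<Prod>j\<in>{1..N}. if j = i then y i else 1)"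
    unfolding mon_def by (intro prod.cong) auto
  then show ?thesis using i by simp
qed

lemma mon_cong: "(\<And>i. i \<in> {1..N} \<Longrightarrow> b i = b' i) \<Longrightarrow> mon N y b = mon N y b'"
  unfolding mon_def by (intro prod.cong) auto

lemma prod_list_span_mon:
  fixes y :: "nat \<Rightarrow> ('g::{finite, ab_group_add} \<Rightarrow>\<^sub>0 'k::field)"
  assumes "set us \<subseteq> A.span (y ` {1..r})"
  shows "prod_list us \<in> A.span {mon r y b | b. sum b {1..r} = length us}"
  using assms
proof (induction us)
  case Nil
  have "mon r y (\<lambda>_. 0) = 1" by (simp add: mon_def)
  then have "1 \<in> {mon r y b | b. sum b {1..r} = 0}" by (auto intro!: exI[of _ "\<lambda>_. 0"])
  then show ?case by (simp add: A.span_base)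
next
  case (Cons u us)
  have "u * prod_list us \<in> A.span {mon r y b | b. sum b {1..r} = length (u # us)}"
  proof (rule A_span_mult)
    show "u \<in> A.span (y ` {1..r})" "prod_list us \<in> A.span {mon r y b | b. sum b {1..r} = length us}"
      using Cons by auto
    fix s t assume "s \<in> y ` {1..r}" "t \<in> {mon r y b | b. sum b {1..r} = length us}"
    then obtain i b where *: "i \<in> {1..r}" "s = y i" "t = mon r y b" "sum b {1..r} = length us" by blast
    have "s * t = mon r y (\<lambda>j. (if j = i then 1 else 0) + b j)"
      using * mon_unit[of i r y] mon_mult[of r y _ b] by metis
    moreover have "(\<Sum>j\<in>{1..r}. (if j = i then 1 else 0) + b j) = length (u # us)"
      using * by (simp add: sum.distrib)
    ultimately show "s * t \<in> A.span {mon r y b | b. sum b {1..r} = length (u # us)}"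
      by (intro A.span_base) blast
  qed
  then show ?case by simp
qed

section \<open>Linear extensions of functions on E to kE\<close>

definition lin :: "('g::finite \<Rightarrow> 'k::field) \<Rightarrow> ('g \<Rightarrow>\<^sub>0 'k) \<Rightarrow> 'k"
  where "lin c a = (\<Sum>g\<in>UNIV. Poly_Mapping.lookup a g * c g)"

lemma lin_add: "lin c (a + b) = lin c a + lin c b"
  by (simp add: lin_def lookup_add algebra_simps sum.distrib)

lemma lin_0 [simp]: "lin c 0 = 0"
  by (simp add: lin_def)

lemma lin_minus: "lin c (- a) = - lin c a"
  by (simp add: lin_def sum_negf)

lemma lin_diff: "lin c (a - b) = lin c a - lin c b"
  by (simp add: lin_def lookup_minus algebra_simps sum_subtractf)

lemma lin_sum: "lin c (sum f S) = (\<Sum>i\<in>S. lin c (f i))"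
  by (induction S rule: infinite_finite_induct) (auto simp: lin_add)

lemma lin_single [simp]: "lin c (Poly_Mapping.single g k) = k * c g"
proof -
  have "lin c (Poly_Mapping.single g k) = (\<Sum>h\<in>UNIV. if h = g then k * c g else 0)"
    unfolding lin_def by (intro sum.cong) (auto simp: lookup_single when_def)
  then show ?thesis by simp
qed

text \<open>For additive \<open>c\<close> the extension is a derivation along the augmentation; in
  particular it kills products of two elements of the augmentation ideal.\<close>

lemma lin_mult:
  fixes c :: "'g::{finite, ab_group_add} \<Rightarrow> 'k::field"
  assumes "\<And>g h. c (g + h) = c g + c h"
  shows "lin c (a * b) = lin c a * aug b + aug a * lin c b"
proof -
  let ?l = "Poly_Mapping.lookup"
  have "a * b = (\<Sum>g\<in>UNIV. Poly_Mapping.single g (?l a g)) * (\<Sum>h\<in>UNIV. Poly_Mapping.single h (?l b h))"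
    using sum_singles[of a] sum_singles[of b] by simp
  also have "lin c \<dots> = (\<Sum>g\<in>UNIV. \<Sum>h\<in>UNIV. ?l a g * ?l b h * (c g + c h))"
    by (simp add: sum_product lin_sum mult_single assms)
  also have "\<dots> = (\<Sum>g\<in>UNIV. \<Sum>h\<in>UNIV. (?l a g * c g) * ?l b h) + (\<Sum>g\<in>UNIV. \<Sum>h\<in>UNIV. ?l a g * (?l b h * c h))"
    by (simp add: algebra_simps sum.distrib)
  finally show ?thesis by (simp add: lin_def aug_def sum_product)
qed

lemma lin_kscale: "lin c (kscale (*) k a) = k * lin c (a :: 'g::{finite, ab_group_add} \<Rightarrow>\<^sub>0 'k::field)"
proof -
  have "Poly_Mapping.lookup (kscale (*) k a) g = k * Poly_Mapping.lookup a g" for g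
    by (simp add: kscale_def flip: mult_map_scale_conv_mult) (simp add: Poly_Mapping.map.rep_eq when_def)
  then show ?thesis by (simp add: lin_def sum_distrib_left algebra_simps)
qed

lemma aug_kscale: "aug (kscale (*) k a) = k * aug a"
  by (simp add: kscale_def)

lemma CHAR_group_algebra: "CHAR('g::comm_monoid_add \<Rightarrow>\<^sub>0 'k::field) = CHAR('k)"
proof (rule CHAR_eqI)
  show "of_nat CHAR('k) = (0 :: 'g \<Rightarrow>\<^sub>0 'k)" by (simp add: of_nat_single[symmetric] flip: single_of_nat)
  fix m assume "of_nat m = (0 :: 'g \<Rightarrow>\<^sub>0 'k)"
  then have "Poly_Mapping.lookup (of_nat m :: 'g \<Rightarrow>\<^sub>0 'k) 0 = 0" by simp
  then show "CHAR('k) dvd m" by (simp add: lookup_of_nat of_nat_eq_0_iff_char_dvd)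
qed

section \<open>Locality of kE and nilpotence of its radical\<close>

locale elem_ab_algebra =
  fixes p n :: nat and V :: "('g::{finite, ab_group_add} \<Rightarrow>\<^sub>0 'k::field) set" and x :: "nat \<Rightarrow> 'g \<Rightarrow>\<^sub>0 'k"
  assumes char: "CHAR('k) = p" and p2: "p > 2"
    and ea: "elementary_abelian TYPE('g) p n"
    and lift: "lifts_rad_quotient V" and bas: "basis_of V n x"
begin

lemma prime_p: "prime p"
  using prime_CHAR_semidom[where ?'a = 'k] char p2 by auto

text \<open>Freshman's dream, together with the fact that every group element has order dividing
  \<open>p\<close>. Both halves of locality follow: augmentation zero forces nilpotence, nonzero
  augmentation forces invertibility.\<close>

lemma frobenius: "(a :: 'g \<Rightarrow>\<^sub>0 'k) ^ p = Poly_Mapping.single 0 (aug a ^ p)"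
proof -
  have pw: "Poly_Mapping.single g c ^ m = Poly_Mapping.single (\<Sum>i<m. g) (c ^ m)" for g :: 'g and c :: 'k and m
    by (induction m) (simp_all add: mult_single add.commute)
  have z: "(\<Sum>i<p. g) = 0" for g :: 'g using ea unfolding elementary_abelian_def by blast
  have "a ^ p = (\<Sum>g\<in>UNIV. Poly_Mapping.single g (Poly_Mapping.lookup a g)) ^ p" using sum_singles[of a] by simp
  also have "\<dots> = (\<Sum>g\<in>UNIV. Poly_Mapping.single g (Poly_Mapping.lookup a g) ^ p)"
    using prime_p by (intro freshmans_dream_sum) (simp_all add: CHAR_group_algebra char)
  also have "\<dots> = (\<Sum>g\<in>(UNIV::'g set). Poly_Mapping.single 0 (Poly_Mapping.lookup a g ^ p))"
    by (simp only: pw z)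
  also have "\<dots> = Poly_Mapping.single 0 (\<Sum>g\<in>UNIV. Poly_Mapping.lookup a g ^ p)"
    by (intro poly_mapping_eqI) (simp add: lookup_sum lookup_single when_def)
  also have "(\<Sum>g\<in>UNIV. Poly_Mapping.lookup a g ^ p) = aug a ^ p"
    unfolding aug_def using prime_p by (intro freshmans_dream_sum[symmetric]) (simp_all add: char)
  finally show ?thesis .
qed

lemma pow_p_0: "aug (a :: 'g \<Rightarrow>\<^sub>0 'k) = 0 \<Longrightarrow> a ^ p = 0"
  using frobenius[of a] p2 by (simp add: power_0_left)

lemma unit: "aug (a :: 'g \<Rightarrow>\<^sub>0 'k) \<noteq> 0 \<Longrightarrow> \<exists>b. a * b = 1"
proof -
  assume a: "aug a \<noteq> 0"
  have "a * (a ^ (p - 1) * Poly_Mapping.single 0 (inverse (aug a ^ p))) = a ^ p * Poly_Mapping.single 0 (inverse (aug a ^ p))"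
    using p2 by (cases p) (simp_all add: mult.assoc)
  also have "\<dots> = 1" unfolding frobenius using a by (simp add: mult_single)
  finally show ?thesis by blast
qed

text \<open>Everything outside the augmentation ideal is a unit, so this ideal is the only maximal
  one and the intersection defining \<open>Rad\<close> has a single member.\<close>

lemma Rad_eq: "(Rad :: ('g \<Rightarrow>\<^sub>0 'k) set) = {a. aug a = 0}"
proof -
  interpret M: module "(*) :: ('g \<Rightarrow>\<^sub>0 'k) \<Rightarrow> _" by (rule module_mult)
  let ?I = "{a :: 'g \<Rightarrow>\<^sub>0 'k. aug a = 0}"
  have sI: "M.subspace ?I" by (rule M.subspaceI) (auto simp: aug_add)
  have full: "J = UNIV" if J: "M.subspace J" "a \<in> J" "aug a \<noteq> 0" for J and a :: "'g \<Rightarrow>\<^sub>0 'k"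
  proof -
    obtain b where "a * b = 1" using unit[OF J(3)] by blast
    then have "z = (z * b) * a" for z by (metis mult.assoc mult.commute mult.right_neutral)
    moreover have "(z * b) * a \<in> J" for z using J M.subspace_scale by blast
    ultimately show ?thesis by (metis UNIV_eq_I)
  qed
  have "aug (1 :: 'g \<Rightarrow>\<^sub>0 'k) \<noteq> 0" by simp
  then have nI: "?I \<noteq> UNIV" by blast
  have "J = ?I \<or> J = UNIV" if J: "M.subspace J" "?I \<subseteq> J" for J
  proof (rule disjCI)
    assume "J \<noteq> UNIV"
    then have "J \<subseteq> ?I" using full[OF J(1)] by blast
    then show "J = ?I" using J(2) by blast
  qed
  then have "maximal_ideal ?I" unfolding maximal_ideal_def using sI nI by simp
  moreover have "I = ?I" if "maximal_ideal I" for I :: "('g \<Rightarrow>\<^sub>0 'k) set"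
  proof -
    have I: "M.subspace I" "I \<noteq> UNIV" using that unfolding maximal_ideal_def by auto
    then have "I \<subseteq> ?I" using full[OF I(1)] by blast
    moreover have "\<forall>J. M.subspace J \<and> I \<subseteq> J \<longrightarrow> J = I \<or> J = UNIV"
      using that unfolding maximal_ideal_def by (elim conjE)
    ultimately have "?I = I \<or> ?I = UNIV" using sI by simp
    then show ?thesis using nI by simp
  qed
  ultimately have "{I :: ('g \<Rightarrow>\<^sub>0 'k) set. maximal_ideal I} = {?I}" by blast
  then show ?thesis unfolding Rad_def by simp
qed

lemma mon_eq_0: "i \<in> {1..N} \<Longrightarrow> aug (y i :: 'g \<Rightarrow>\<^sub>0 'k) = 0 \<Longrightarrow> b i \<ge> p \<Longrightarrow> mon N y b = 0"
proof -
  assume i: "i \<in> {1..N}" "aug (y i) = 0" "b i \<ge> p"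
  have "y i ^ b i = y i ^ p * y i ^ (b i - p)" using i(3) by (simp flip: power_add)
  then have "y i ^ b i = 0" using pow_p_0[OF i(2)] by simp
  then show ?thesis using i(1) unfolding mon_def by (intro prod_zero) auto
qed

text \<open>Pigeonhole: a monomial in \<open>r\<close> variables of degree above (p - 1) r has an
  exponent at least \<open>p\<close>.\<close>

lemma prod_list_eq_0:
  fixes y :: "nat \<Rightarrow> ('g \<Rightarrow>\<^sub>0 'k)"
  assumes "set us \<subseteq> A.span (y ` {1..r})" "\<And>i. i \<in> {1..r} \<Longrightarrow> aug (y i) = 0" "length us > (p - 1) * r"
  shows "prod_list us = 0"
proof -
  have "mon r y b = 0" if "sum b {1..r} = length us" for b
  proof -
    have "\<exists>i\<in>{1..r}. b i \<ge> p"
    proof (rule ccontr)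
      assume "\<not> ?thesis"
      then have "sum b {1..r} \<le> (\<Sum>i\<in>{1..r}. p - 1)" by (intro sum_mono) force
      then show False using that assms(3) by (simp add: mult.commute)
    qed
    then show ?thesis using mon_eq_0 assms(2) by blast
  qed
  then have "{mon r y b | b. sum b {1..r} = length us} \<subseteq> {0}" by blast
  then have "A.span {mon r y b | b. sum b {1..r} = length us} \<subseteq> {0}"
    by (rule A.span_minimal) (rule A.subspace_single_0)
  then show ?thesis using prod_list_span_mon[OF assms(1)] by blast
qed

text \<open>The bound comes from pigeonhole applied to a k-basis of the radical. It is far from
  sharp, but it serves only to end arguments along the radical filtration.\<close>

lemma Rad_nilpotent: "\<exists>N. \<forall>us :: ('g \<Rightarrow>\<^sub>0 'k) list. set us \<subseteq> Rad \<and> length us = N \<longrightarrow> prod_list us = 0"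
proof -
  obtain B where B: "B \<subseteq> (Rad :: ('g \<Rightarrow>\<^sub>0 'k) set)" "A.independent B" "Rad \<subseteq> A.span B"
    using A.basis_exists[of Rad] by metis
  have "finite B" using B(2) by (rule A.finiteI_independent)
  then obtain h where h: "bij_betw h {1..card B} B" using ex_bij_betw_nat_finite_1 by blast
  have "prod_list us = 0" if "set us \<subseteq> Rad" "length us = Suc ((p - 1) * card B)" for us :: "('g \<Rightarrow>\<^sub>0 'k) list"
  proof (rule prod_list_eq_0[of us h "card B"])
    show "set us \<subseteq> A.span (h ` {1..card B})" using h B(3) that(1) by (auto simp: bij_betw_def)
    show "aug (h i) = 0" if "i \<in> {1..card B}" for i
      using bij_betw_apply[OF h that] B(1) Rad_eq by auto
    show "length us > (p - 1) * card B" using that by simp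
  qed
  then show ?thesis by blast
qed

lemma Rad_pow_nilpotent:
  "\<exists>N. \<forall>(scale :: ('g \<Rightarrow>\<^sub>0 'k) \<Rightarrow> 'm::ab_group_add \<Rightarrow> 'm) M. module scale \<longrightarrow> Rad_pow scale Rad N M = {0}"
proof -
  obtain N where N: "\<And>us :: ('g \<Rightarrow>\<^sub>0 'k) list. set us \<subseteq> Rad \<Longrightarrow> length us = N \<Longrightarrow> prod_list us = 0"
    using Rad_nilpotent by blast
  have "Rad_pow scale Rad N M = {0}" if m: "module scale"
    for scale :: "('g \<Rightarrow>\<^sub>0 'k) \<Rightarrow> 'm::ab_group_add \<Rightarrow> 'm" and M
  proof -
    interpret module scale by fact
    interpret k: vector_space "kscale scale" by (rule kscale_vector_space[OF m])
    have "{scale (prod_list us) m | us m. length us = N \<and> set us \<subseteq> Rad \<and> m \<in> M} \<subseteq> {0}"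
      using N by auto
    then have "Rad_pow scale Rad N M \<subseteq> {0}"
      unfolding Rad_pow_def by (rule k.span_minimal) (rule k.subspace_single_0)
    then show ?thesis using Rad_pow_0[OF m] by blast
  qed
  then show ?thesis by blast
qed

lemma basis_of_aug:
  assumes "basis_of V n y" "i \<in> {1..n}"
  shows "aug (y i) = 0"
proof -
  have "y i \<in> V" using assms A.span_base[of "y i" "y ` {1..n}"] unfolding basis_of_def by auto
  then show ?thesis using lift Rad_eq unfolding lifts_rad_quotient_def by blast
qed

lemma V_aug: "v \<in> V \<Longrightarrow> aug v = 0"
  using lift Rad_eq unfolding lifts_rad_quotient_def by blast

lemma V_sub: "A.subspace V"
  using lift unfolding lifts_rad_quotient_def by blast

lemma dim_V: "A.dim V = n"
proof -
  have "A.dim V = card (x ` {1..n})"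
    using bas A.dim_span_eq_card_independent unfolding basis_of_def by metis
  then show ?thesis using bas unfolding basis_of_def by (simp add: card_image)
qed

section \<open>Powers of the radical and the monomial basis\<close>

definition J :: "nat \<Rightarrow> ('g \<Rightarrow>\<^sub>0 'k) set" where "J k = Rad_pow (*) Rad k UNIV"

lemma J_sub: "module.subspace ((*) :: ('g \<Rightarrow>\<^sub>0 'k) \<Rightarrow> _) (J k)"
  unfolding J_def by (intro subspace_Rad_pow module_mult module.subspace_UNIV)

lemma J_mult:
  assumes "a \<in> J i" "b \<in> J j" shows "a * b \<in> J (i + j)"
proof -
  have U: "module.subspace (kscale (*)) (UNIV :: ('g \<Rightarrow>\<^sub>0 'k) set)" by simp
  have "a * b \<in> Rad_pow (*) Rad i (J j)"
    using assms(1) unfolding J_def[of i] using module_mult U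
  proof (induction rule: Rad_pow_induct)
    case zero
    then show ?case by (simp add: Rad_pow_0[OF module_mult])
  next
    case (step us m y)
    have "m * b \<in> J j" using module.subspace_scale[OF module_mult J_sub assms(2)] .
    then have "prod_list us * (m * b) \<in> Rad_pow (*) Rad i (J j)"
      using Rad_pow_gen[OF module_mult, of us i Rad "m * b" "J j"] step by blast
    then show ?case using step by (simp add: distrib_right mult.assoc Rad_pow_add[OF module_mult])
  qed
  then show ?thesis using Rad_pow_Rad_pow[OF module_mult U] unfolding J_def by blast
qed

lemma J_0: "a \<in> J 0"
  using Rad_pow_gen[OF module_mult, of "[]" 0 Rad a UNIV] by (simp add: J_def)

lemma J_1: "aug (a :: 'g \<Rightarrow>\<^sub>0 'k) = 0 \<Longrightarrow> a \<in> J 1"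
proof -
  assume "aug a = 0"
  then have "a \<in> Rad" unfolding Rad_eq by simp
  then show ?thesis using Rad_pow_gen[OF module_mult, of "[a]" 1 Rad 1 UNIV] by (simp add: J_def)
qed

lemma J_add: "a \<in> J k \<Longrightarrow> b \<in> J k \<Longrightarrow> a + b \<in> J k"
  using module.subspace_add[OF module_mult J_sub] .

text \<open>Modulo the square of the radical each factor can be replaced by an element of
  \<open>V\<close>, so products from \<open>V\<close> span every power of the radical modulo the
  next one. Nilpotence ends the successive approximation.\<close>

lemma span_mon:
  assumes y: "basis_of V n y"
  shows "A.span (range (mon n y)) = UNIV"
proof -
  let ?S = "A.span (range (mon n y))"
  have mult: "a * b \<in> ?S" if "a \<in> ?S" "b \<in> ?S" for a b
    by (rule A_span_mult[OF that]) (auto simp: mon_mult intro: A.span_base)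
  have "y i \<in> ?S" if "i \<in> {1..n}" for i
    using mon_unit[OF that, of y] A.span_base[of "y i" "range (mon n y)"] by (metis rangeI)
  then have "A.span (y ` {1..n}) \<subseteq> ?S" by (intro A.span_minimal) auto
  then have VS: "V \<subseteq> ?S" using y unfolding basis_of_def by simp
  have "mon n y (\<lambda>_. 0) = 1" by (simp add: mon_def)
  then have 1: "1 \<in> ?S" using A.span_base[of 1 "range (mon n y)"] by (metis rangeI)
  have C: "\<exists>s\<in>?S. prod_list us * m - s \<in> J (Suc (length us))" if "set us \<subseteq> Rad" for us m
    using that
  proof (induction us)
    case Nil
    have "kscale (*) (aug m) 1 \<in> ?S" using A.span_scale[OF 1] .
    moreover have "aug (m - kscale (*) (aug m) 1) = 0" by (simp add: aug_diff aug_kscale)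
    ultimately show ?case using J_1 by auto
  next
    case (Cons u us)
    then obtain s where s: "s \<in> ?S" "prod_list us * m - s \<in> J (Suc (length us))" by auto
    have "u \<in> Rad" using Cons by simp
    \<comment> \<open>\<open>v\<close> is the element of \<open>V\<close> congruent to
      \<open>u\<close> modulo the square of the radical. Both errors, from u - v and from the
      induction hypothesis, land in the same next power.\<close>
    then obtain v where v: "v \<in> V" "u - v \<in> J 2"
      using lift unfolding lifts_rad_quotient_def J_def by blast
    have "prod_list us * m \<in> J (length us)"
      unfolding J_def using Rad_pow_gen[OF module_mult, of us _ Rad m UNIV] Cons by simp
    then have "(u - v) * (prod_list us * m) \<in> J (2 + length us)" using J_mult[OF v(2)] by blast
    moreover have "v * (prod_list us * m - s) \<in> J (1 + Suc (length us))"
      using J_mult[OF J_1[OF V_aug[OF v(1)]] s(2)] .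
    ultimately have "(u - v) * (prod_list us * m) + v * (prod_list us * m - s) \<in> J (Suc (length (u # us)))"
      by (intro J_add) simp_all
    moreover have "(u - v) * (prod_list us * m) + v * (prod_list us * m - s) = prod_list (u # us) * m - v * s"
      by (simp add: algebra_simps)
    moreover have "v * s \<in> ?S" using mult VS v s by blast
    ultimately show ?case by (intro bexI[of _ "v * s"]) simp_all
  qed
  have C': "\<exists>s\<in>?S. a - s \<in> J (Suc k)" if "a \<in> J k" for a k
    using that unfolding J_def[of k] using module_mult A.subspace_UNIV
  proof (induction rule: Rad_pow_induct)
    case zero
    then show ?case using A.span_zero module.subspace_0[OF module_mult J_sub] by (intro bexI[of _ 0]) auto
  next
    case (step us m z)
    obtain s where s: "s \<in> ?S" "prod_list us * m - s \<in> J (Suc k)" using C[OF step(2), of m] step(1) by auto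
    obtain t where t: "t \<in> ?S" "z - t \<in> J (Suc k)" using step by auto
    have eq: "prod_list us * m + z - (s + t) = (prod_list us * m - s) + (z - t)" by simp
    show ?case
      by (rule bexI[of _ "s + t"]) (use J_add[OF s(2) t(2)] A.span_add[OF s(1) t(1)] in \<open>simp_all only: eq\<close>)
  qed
  have C'': "\<exists>s\<in>?S. a - s \<in> J k" for a k
  proof (induction k)
    case 0
    then show ?case using A.span_zero J_0 by (intro bexI[of _ 0]) auto
  next
    case (Suc k)
    then obtain s where s: "s \<in> ?S" "a - s \<in> J k" by blast
    obtain t where t: "t \<in> ?S" "a - s - t \<in> J (Suc k)" using C'[OF s(2)] by blast
    then show ?case using A.span_add[OF s(1) t(1)] by (intro bexI[of _ "s + t"]) (simp_all add: algebra_simps)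
  qed
  obtain N where N: "Rad_pow (*) Rad N (UNIV :: ('g \<Rightarrow>\<^sub>0 'k) set) = {0}"
    using Rad_pow_nilpotent[where ?'m = "'g \<Rightarrow>\<^sub>0 'k"] module_mult by blast
  have "a \<in> ?S" for a using C''[of a N] N unfolding J_def by auto
  then show ?thesis by blast
qed

text \<open>Extensional functions are used because \<open>mon\<close> does not see values outside
  {1..n}; fixing those values is what makes injectivity of \<open>mon\<close> on this set
  possible.\<close>

definition expos :: "(nat \<Rightarrow> nat) set" where "expos = PiE {1..n} (\<lambda>_. {..<p})"

lemma mon_expos:
  assumes "basis_of V n y"
  shows "mon n y b = 0 \<and> (\<exists>i\<in>{1..n}. b i \<ge> p) \<or> (restrict b {1..n} \<in> expos \<and> mon n y b = mon n y (restrict b {1..n}))"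
proof (cases "\<exists>i\<in>{1..n}. b i \<ge> p")
  case True
  then show ?thesis using mon_eq_0 basis_of_aug[OF assms] by blast
next
  case False
  then have "restrict b {1..n} \<in> expos" unfolding expos_def by (intro restrict_PiE_iff[THEN iffD2]) auto
  moreover have "mon n y b = mon n y (restrict b {1..n})" by (rule mon_cong) simp
  ultimately show ?thesis by blast
qed

text \<open>A count: there are \<open>p ^ n\<close> exponents, and kE has dimension card E =
  \<open>p ^ n\<close>, so a spanning family of this size is injective and independent. This
  replaces an explicit isomorphism with the truncated polynomial ring.\<close>

lemma mon_basis:
  assumes y: "basis_of V n y"
  shows "A.span (mon n y ` expos) = UNIV" "A.independent (mon n y ` expos)" "inj_on (mon n y) expos"
proof -
  have "range (mon n y) \<subseteq> A.span (mon n y ` expos)"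
  proof (rule image_subsetI)
    fix b show "mon n y b \<in> A.span (mon n y ` expos)"
      using mon_expos[OF y, of b] by (auto intro: A.span_base simp: A.span_zero)
  qed
  then show sp: "A.span (mon n y ` expos) = UNIV"
    using span_mon[OF y] A.span_minimal[of "range (mon n y)"] A.subspace_span by blast
  have fin: "finite expos" unfolding expos_def by (intro finite_PiE) auto
  have card: "card expos = p ^ n" unfolding expos_def by (simp add: card_PiE)
  have dim: "A.dim (UNIV :: ('g \<Rightarrow>\<^sub>0 'k) set) = p ^ n"
    using dim_group_algebra[where ?'g = 'g and ?'k = 'k] ea unfolding elementary_abelian_def by simp
  have "p ^ n \<le> card (mon n y ` expos)"
    using A.dim_le_card[of UNIV "mon n y ` expos"] sp fin dim by simp
  then have eq: "card (mon n y ` expos) = card expos" using card card_image_le[OF fin, of "mon n y"] by simp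
  then show "inj_on (mon n y) expos" using eq_card_imp_inj_on[OF fin] by blast
  show "A.independent (mon n y ` expos)"
    by (rule A.card_le_dim_spanning[of _ UNIV]) (use sp fin dim card eq in auto)
qed

lemma linear_on_monomials:
  assumes y: "basis_of V n y"
  shows "\<exists>T. Vector_Spaces.linear (kscale (*)) (kscale (*)) T \<and> (\<forall>b\<in>expos. T (mon n y b) = (G b :: 'g \<Rightarrow>\<^sub>0 'k))"
proof -
  interpret vector_space_pair "kscale ((*) :: ('g \<Rightarrow>\<^sub>0 'k) \<Rightarrow> _)" "kscale ((*) :: ('g \<Rightarrow>\<^sub>0 'k) \<Rightarrow> _)" ..
  obtain T where "Vector_Spaces.linear (kscale (*)) (kscale (*)) T"
    "\<forall>z\<in>mon n y ` expos. T z = G (inv_into expos (mon n y) z)"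
    using linear_independent_extend[OF mon_basis(2)[OF y], of "\<lambda>z. G (inv_into expos (mon n y) z)"] by blast
  then show ?thesis using mon_basis(3)[OF y] by (intro exI[of _ T]) auto
qed

lemma A_induct_mon:
  assumes y: "basis_of V n y"
    and "P 0" "\<And>b c a. b \<in> expos \<Longrightarrow> P a \<Longrightarrow> P (kscale (*) c (mon n y b) + a)"
  shows "P (a :: 'g \<Rightarrow>\<^sub>0 'k)"
proof -
  have "a \<in> A.span (mon n y ` expos)" using mon_basis(1)[OF y] by simp
  then show ?thesis
    by (induction rule: A.span_induct_alt) (use assms(2,3) in auto)
qed

lemma aug_mon:
  assumes y: "basis_of V n y"
  shows "aug (mon n y b) = (if \<forall>j\<in>{1..n}. b j = 0 then 1 else 0)"
proof -
  have pw: "aug (z ^ k) = aug z ^ k" for z :: "'g \<Rightarrow>\<^sub>0 'k" and k by (induction k) auto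
  have pr: "aug (\<Prod>i\<in>S. f i) = (\<Prod>i\<in>S. aug (f i))" if "finite S" for S and f :: "nat \<Rightarrow> 'g \<Rightarrow>\<^sub>0 'k"
    using that by (induction S rule: finite_induct) auto
  have "aug (mon n y b) = (\<Prod>j\<in>{1..n}. 0 ^ b j)"
    unfolding mon_def using basis_of_aug[OF y] by (simp add: pr pw)
  then show ?thesis by (auto simp: power_0_left intro!: prod_zero)
qed

section \<open>Algebra automorphisms from linear ones, and shift operators\<close>

definition basis_change :: "(nat \<Rightarrow> 'g \<Rightarrow>\<^sub>0 'k) \<Rightarrow> (nat \<Rightarrow> 'g \<Rightarrow>\<^sub>0 'k) \<Rightarrow> (('g \<Rightarrow>\<^sub>0 'k) \<Rightarrow> ('g \<Rightarrow>\<^sub>0 'k)) \<Rightarrow> bool"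
  where "basis_change y y' \<sigma> \<longleftrightarrow> Vector_Spaces.linear (kscale (*)) (kscale (*)) \<sigma> \<and>
    (\<forall>a b. \<sigma> (a * b) = \<sigma> a * \<sigma> b) \<and> \<sigma> 1 = 1 \<and> (\<forall>a. aug (\<sigma> a) = aug a) \<and>
    (\<forall>b. \<sigma> (mon n y b) = mon n y' b) \<and> (\<forall>i\<in>{1..n}. \<sigma> (y i) = y' i)"

lemma basis_changeD:
  assumes "basis_change y y' \<sigma>"
  shows "Vector_Spaces.linear (kscale (*)) (kscale (*)) \<sigma>" "\<sigma> (a * b) = \<sigma> a * \<sigma> b" "\<sigma> 1 = 1"
    "aug (\<sigma> a) = aug a" "\<sigma> (mon n y e) = mon n y' e" "i \<in> {1..n} \<Longrightarrow> \<sigma> (y i) = y' i"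
  using assms unfolding basis_change_def by auto

text \<open>A map prescribed on the monomial basis is multiplicative here because monomials with an
  exponent at least \<open>p\<close> vanish for both bases, so its formula extends to all
  exponents.\<close>

lemma basis_change_exists:
  assumes y: "basis_of V n y" and y': "basis_of V n y'"
  shows "\<exists>\<sigma>. basis_change y y' \<sigma>"
proof -
  obtain \<sigma> where \<sigma>: "Vector_Spaces.linear (kscale (*)) (kscale (*)) \<sigma>"
    "\<forall>b\<in>expos. \<sigma> (mon n y b) = (mon n y' b :: 'g \<Rightarrow>\<^sub>0 'k)"
    using linear_on_monomials[OF y] by blast
  interpret L: Vector_Spaces.linear "kscale (*)" "kscale (*)" \<sigma> by (rule \<sigma>(1))
  have m: "\<sigma> (mon n y b) = mon n y' b" for b
  proof (cases "\<exists>i\<in>{1..n}. b i \<ge> p")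
    case True
    then have "mon n y b = 0" "mon n y' b = 0"
      using mon_eq_0 basis_of_aug[OF y] basis_of_aug[OF y'] by blast+
    then show ?thesis by (simp add: L.zero)
  next
    case False
    then show ?thesis using \<sigma>(2) mon_expos[OF y, of b] mon_expos[OF y', of b] by metis
  qed
  have "\<sigma> (mon n y b * a) = mon n y' b * \<sigma> a" for a b
  proof (induction a rule: A_induct_mon[OF y])
    case 1
    then show ?case by (simp add: L.zero)
  next
    case (2 b' c a)
    have "mon n y b * (kscale (*) c (mon n y b') + a) = kscale (*) c (mon n y (\<lambda>i. b i + b' i)) + mon n y b * a"
      by (simp add: kscale_def distrib_left mult.left_commute mon_mult)
    then show ?case using 2
      by (simp add: L.add L.scale m) (simp add: kscale_def distrib_left mult.left_commute mon_mult)
  qed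
  then have mult: "\<sigma> (a * b) = \<sigma> a * \<sigma> b" for a b
  proof (induction a rule: A_induct_mon[OF y])
    case 1
    then show ?case by (simp add: L.zero)
  next
    case (2 b' c a)
    have "(kscale (*) c (mon n y b') + a) * b = kscale (*) c (mon n y b' * b) + a * b"
      by (simp add: kscale_def distrib_right mult.assoc)
    then show ?case using 2
      by (simp add: L.add L.scale m) (simp add: kscale_def distrib_right mult.assoc)
  qed
  have one: "\<sigma> 1 = 1" using m[of "\<lambda>_. 0"] by (simp add: mon_def)
  have au: "aug (\<sigma> a) = aug a" for a
  proof (induction a rule: A_induct_mon[OF y])
    case 1
    then show ?case by (simp add: L.zero)
  next
    case (2 b' c a)
    have "aug (mon n y' b') = aug (mon n y b')" by (simp add: aug_mon[OF y] aug_mon[OF y'])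
    then show ?case using 2 by (simp add: L.add L.scale m aug_add aug_kscale)
  qed
  have "\<sigma> (y i) = y' i" if "i \<in> {1..n}" for i
    using m[of "\<lambda>j. if j = i then 1 else 0"] mon_unit[OF that, of y] mon_unit[OF that, of y'] by simp
  then have "basis_change y y' \<sigma>" unfolding basis_change_def using \<sigma>(1) mult one au m by simp
  then show ?thesis by blast
qed

text \<open>Every U is the span of the first \<open>r\<close> members of some basis of
  \<open>V\<close>, so comparing subspaces reduces to comparing bases.\<close>

lemma adapted_basis:
  assumes U: "A.subspace U" "U \<subseteq> V" "A.dim U = r"
  obtains y where "basis_of V n y" "A.span (y ` {1..r}) = U" "r \<le> n"
proof -
  obtain B where B: "B \<subseteq> U" "A.independent B" "U \<subseteq> A.span B" "card B = r"
    using A.basis_exists[of U] U(3) by metis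
  have "B \<subseteq> V" using B U by blast
  then obtain C where C: "B \<subseteq> C" "C \<subseteq> V" "A.independent C" "V \<subseteq> A.span C"
    using A.maximal_independent_subset_extend[OF _ B(2)] by metis
  have fin: "finite C" using C(3) by (rule A.finiteI_independent)
  have cn: "card C = n" using A.basis_card_eq_dim[OF C(2,4,3)] dim_V by simp
  obtain h1 where h1: "bij_betw h1 {1..r} B"
    using ex_bij_betw_nat_finite_1[of B] fin C(1) B(4) finite_subset by metis
  have rn: "r \<le> n" using card_mono[OF fin C(1)] B(4) cn by simp
  have "card (C - B) = card {Suc r..n}" using fin C(1) B(4) cn by (simp add: card_Diff_subset finite_subset)
  then obtain h2 where h2: "bij_betw h2 {Suc r..n} (C - B)"
    using finite_same_card_bij[of "{Suc r..n}" "C - B"] fin by auto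
  define y where "y i = (if i \<in> {1..r} then h1 i else h2 i)" for i
  have "bij_betw y ({1..r} \<union> {Suc r..n}) (B \<union> (C - B))"
    unfolding y_def by (rule bij_betw_disjoint_Un[OF h1 h2]) auto
  moreover have "{1..r} \<union> {Suc r..n} = {1..n}" using rn by auto
  ultimately have bij: "bij_betw y {1..n} C" using C(1) by (simp add: Un_absorb1)
  have "A.span C = V" using C V_sub A.span_subspace by blast
  then have "basis_of V n y"
    unfolding basis_of_def using bij C by (auto simp: bij_betw_def)
  moreover have "y ` {1..r} = B" using h1 unfolding y_def bij_betw_def by auto
  then have "A.span (y ` {1..r}) = U" using A.span_subspace[OF B(1,3) U(1)] by simp
  ultimately show ?thesis using that rn by blast
qed

text \<open>\<open>T\<close> divides the monomials by \<open>y i\<close>; unlike \<open>\<partial>/\<partial>y i\<close> it needs no product rule.\<close>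

lemma shift_operator:
  assumes y: "basis_of V n y" and i: "i \<in> {1..n}"
  shows "\<exists>T :: ('g \<Rightarrow>\<^sub>0 'k) \<Rightarrow> ('g \<Rightarrow>\<^sub>0 'k).
    Vector_Spaces.linear (kscale (*)) (kscale (*)) T \<and>
    (\<forall>j a. j \<in> {1..n} \<longrightarrow> j \<noteq> i \<longrightarrow> T (y j * a) = y j * T a) \<and>
    (\<forall>b\<in>expos. aug (T (mon n y b)) = (if \<forall>j\<in>{1..n}. b j = (if j = i then 1 else 0) then 1 else 0))"
proof -
  define G :: "(nat \<Rightarrow> nat) \<Rightarrow> ('g \<Rightarrow>\<^sub>0 'k)" where "G b = (if b i = 0 then 0 else mon n y (b(i := b i - 1)))" for b
  obtain T where T: "Vector_Spaces.linear (kscale (*)) (kscale (*)) T" "\<And>b. b \<in> expos \<Longrightarrow> T (mon n y b) = G b"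
    using linear_on_monomials[OF y] by metis
  interpret L: Vector_Spaces.linear "kscale (*)" "kscale (*)" T by (rule T(1))
  \<comment> \<open>The bound on b i is essential: for b i = p the monomial is 0, while its formal
    quotient by y i need not be. Other exponents may be large, since then both sides vanish.\<close>
  have Tb: "T (mon n y b) = G b" if "b i < p" for b
  proof (cases "\<exists>j\<in>{1..n}. b j \<ge> p")
    case True
    then obtain j where j: "j \<in> {1..n}" "b j \<ge> p" by blast
    then have "mon n y b = 0" using mon_eq_0 basis_of_aug[OF y] by blast
    moreover have "mon n y (b(i := b i - 1)) = 0"
      by (rule mon_eq_0[of j]) (use j basis_of_aug[OF y j(1)] that in auto)
    ultimately show ?thesis by (simp add: L.zero G_def)
  next
    case False
    then have *: "restrict b {1..n} \<in> expos" "mon n y b = mon n y (restrict b {1..n})"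
      using mon_expos[OF y, of b] by auto
    have "mon n y ((restrict b {1..n})(i := b i - 1)) = mon n y (b(i := b i - 1))"
      by (rule mon_cong) simp
    then show ?thesis using T(2)[OF *(1)] *(2) i by (simp add: G_def)
  qed
  have com: "T (y j * a) = y j * T a" if j: "j \<in> {1..n}" "j \<noteq> i" for j a
  proof (induction a rule: A_induct_mon[OF y])
    case 1
    then show ?case by (simp add: L.zero)
  next
    case (2 b c a)
    have bi: "b i < p" using 2 i unfolding expos_def by auto
    let ?e = "\<lambda>l. if l = j then 1 else (0::nat)"
    have m: "y j * mon n y b' = mon n y (\<lambda>l. ?e l + b' l)" for b'
      using mon_unit[OF j(1), of y] mon_mult[of n y ?e b'] by simp
    have "(\<lambda>l. ?e l + b l)(i := b i - 1) = (\<lambda>l. ?e l + (b(i := b i - 1)) l)" using j by auto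
    then have "T (y j * mon n y b) = y j * T (mon n y b)"
      using Tb[of b] Tb[of "\<lambda>l. ?e l + b l"] bi j by (simp add: m G_def)
    moreover have "y j * (kscale (*) c (mon n y b) + a) = kscale (*) c (y j * mon n y b) + y j * a"
      by (simp add: kscale_def distrib_left mult.left_commute)
    ultimately show ?case using 2
      by (simp add: L.add L.scale) (simp add: kscale_def distrib_left mult.left_commute)
  qed
  have "aug (T (mon n y b)) = (if \<forall>j\<in>{1..n}. b j = (if j = i then 1 else 0) then 1 else 0)" if "b \<in> expos" for b
  proof -
    have "(\<forall>j\<in>{1..n}. (b(i := b i - 1)) j = 0) \<longleftrightarrow> (\<forall>j\<in>{1..n}. b j = (if j = i then 1 else 0))" if "b i \<noteq> 0"
      using that i by (auto split: if_splits)
    moreover have "\<not> (\<forall>j\<in>{1..n}. b j = (if j = i then 1 else 0))" if "b i = 0" using that i by force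
    ultimately show ?thesis using T(2)[OF that] by (simp add: G_def aug_mon[OF y])
  qed
  then show ?thesis using T(1) com by (intro exI[of _ T]) simp
qed

end

section \<open>Products of one-dimensional classes\<close>

abbreviation cobd :: "('g::plus list \<Rightarrow> 'k::field) \<Rightarrow> 'g list \<Rightarrow> 'k" where
  "cobd \<equiv> bar_diff (\<lambda>_ a. a)"

text \<open>\<open>act'\<close> is arbitrary: its term cancels the leading term of the inner
  \<open>bar_diff\<close>, leaving only merged symbols and the last face.\<close>

lemma bar_diff_Cons:
  assumes "gs \<noteq> []"
  shows "bar_diff act \<phi> (g # gs) = act g (\<phi> gs) - \<phi> ((g + hd gs) # tl gs)
    + act' (hd gs) (\<phi> (g # tl gs)) - bar_diff act' (\<lambda>l. \<phi> (g # l)) gs"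
proof -
  have l: "length (g # gs) - 1 = Suc (length gs - 1)" using assms by (cases gs) auto
  have m0: "merge_at 0 (g # gs) = (g + hd gs) # tl gs" using assms by (cases gs) (auto simp: merge_at_def)
  have mS: "merge_at (Suc i) (g # gs) = g # merge_at i gs" for i by (simp add: merge_at_def)
  have "(\<Sum>i<length (g # gs) - 1. if even i then - \<phi> (merge_at i (g # gs)) else \<phi> (merge_at i (g # gs)))
      = - \<phi> ((g + hd gs) # tl gs) + (\<Sum>i<length gs - 1. if even (Suc i) then - \<phi> (g # merge_at i gs) else \<phi> (g # merge_at i gs))"
    unfolding l by (subst sum.lessThan_Suc_shift) (simp add: m0 mS cong: if_cong)
  also have "(\<Sum>i<length gs - 1. if even (Suc i) then - \<phi> (g # merge_at i gs) else \<phi> (g # merge_at i gs))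
      = - (\<Sum>i<length gs - 1. if even i then - \<phi> (g # merge_at i gs) else \<phi> (g # merge_at i gs))"
    unfolding sum_negf[symmetric] by (intro sum.cong) auto
  finally show ?thesis using assms by (simp add: bar_diff_def)
qed

text \<open>Leibniz rule for a cup product with \<open>c\<close> on the right; the second term is
  absent because an additive \<open>c\<close> is a cocycle.\<close>

lemma bar_diff_snoc:
  assumes "gs \<noteq> []" and c: "\<And>g h. c (g + h) = c g + c h"
  shows "cobd (\<lambda>l. e (butlast l) * c (last l)) (gs @ [h]) = cobd e gs * (c h :: 'k::field)"
proof -
  let ?f = "\<lambda>l. e (butlast l) * c (last l)"
  have l: "length (gs @ [h]) - 1 = Suc (length gs - 1)" using assms by (cases gs) auto
  have m: "merge_at i (gs @ [h]) = merge_at i gs @ [h]" if "i < length gs - 1" for i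
    using that by (auto simp: merge_at_def nth_append)
  have mL: "merge_at (length gs - 1) (gs @ [h]) = butlast gs @ [last gs + h]"
    using assms(1) by (auto simp: merge_at_def nth_append last_conv_nth butlast_conv_take)
  have "(\<Sum>i<length (gs @ [h]) - 1. if even i then - ?f (merge_at i (gs @ [h])) else ?f (merge_at i (gs @ [h])))
     = (\<Sum>i<length gs - 1. if even i then - (e (merge_at i gs) * c h) else e (merge_at i gs) * c h)
       + (if even (length gs - 1) then - (e (butlast gs) * c (last gs + h)) else e (butlast gs) * c (last gs + h))"
    unfolding l sum.lessThan_Suc by (intro arg_cong2[where f = "(+)"] sum.cong) (use m mL in \<open>auto split: if_splits\<close>)
  also have "(\<Sum>i<length gs - 1. if even i then - (e (merge_at i gs) * c h) else e (merge_at i gs) * c h)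
     = (\<Sum>i<length gs - 1. if even i then - e (merge_at i gs) else e (merge_at i gs)) * c h"
    unfolding sum_distrib_right by (intro sum.cong) auto
  finally have sum: "(\<Sum>i<length (gs @ [h]) - 1. if even i then - ?f (merge_at i (gs @ [h])) else ?f (merge_at i (gs @ [h])))
    = (\<Sum>i<length gs - 1. if even i then - e (merge_at i gs) else e (merge_at i gs)) * c h
      + (if even (length gs - 1) then - (e (butlast gs) * c (last gs + h)) else e (butlast gs) * c (last gs + h))" .
  have tl: "?f (tl (gs @ [h])) = e (tl gs) * c h" "?f (butlast (gs @ [h])) = e (butlast gs) * c (last gs)"
    using assms(1) by (cases gs; simp)+
  have par: "even (length gs - 1) \<longleftrightarrow> odd (length gs)" "even (length (gs @ [h])) \<longleftrightarrow> odd (length gs)"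
    using assms(1) by (cases gs; simp)+
  show ?thesis
    unfolding bar_diff_def[of _ ?f] sum tl par unfolding bar_diff_def
    by (cases "even (length gs)") (simp_all add: c algebra_simps)
qed

lemma bar_diff_add: "cobd (\<lambda>l. e l + f l) gs = cobd e gs + cobd f gs"
proof -
  have "(\<Sum>i<length gs - 1. if even i then - (e (merge_at i gs) + f (merge_at i gs)) else e (merge_at i gs) + f (merge_at i gs))
    = (\<Sum>i<length gs - 1. (if even i then - e (merge_at i gs) else e (merge_at i gs)) + (if even i then - f (merge_at i gs) else f (merge_at i gs)))"
    by (intro sum.cong) auto
  then show ?thesis by (auto simp: bar_diff_def sum.distrib)
qed

lemma bar_diff_mult: "cobd (\<lambda>l. c * e l) gs = c * cobd e gs"
proof -
  have "(\<Sum>i<length gs - 1. if even i then - (c * e (merge_at i gs)) else c * e (merge_at i gs))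
    = c * (\<Sum>i<length gs - 1. if even i then - e (merge_at i gs) else e (merge_at i gs))"
    unfolding sum_distrib_left by (intro sum.cong) auto
  then show ?thesis by (auto simp: bar_diff_def algebra_simps)
qed

text \<open>Leibniz rule for a 1-cochain \<open>q\<close> on the left. Arbitrary \<open>q\<close>
  are allowed because the homotopy for commutativity is a product c d, in general not
  additive.\<close>

lemma cobd_prod:
  assumes "gs \<noteq> []"
  shows "cobd (\<lambda>l. q (hd l) * r (tl l)) (g # gs) = (q (hd gs) - q (g + hd gs) + q g) * r (tl gs) - q g * cobd r gs"
  by (subst bar_diff_Cons[OF assms, of _ _ _ "\<lambda>_ a. a"]) (simp add: bar_diff_mult algebra_simps)

text \<open>In degree \<open>0\<close> there are no coboundaries, but \<open>bar_diff\<close> takes a junk value at the empty list.\<close>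

definition coh :: "nat \<Rightarrow> ('g::plus list \<Rightarrow> 'k::field) \<Rightarrow> ('g list \<Rightarrow> 'k) \<Rightarrow> bool"
  where "coh m a b \<longleftrightarrow> (\<exists>e. \<forall>gs. length gs = m \<longrightarrow> a gs = b gs + (if m = 0 then 0 else cobd e gs))"

lemma cobd_0: "cobd (\<lambda>_. 0) gs = 0"
  using bar_diff_mult[of 0 "\<lambda>_. 0" gs] by simp

lemma coh_eq: "(\<And>gs. length gs = m \<Longrightarrow> a gs = b gs) \<Longrightarrow> coh m a b"
  unfolding coh_def by (intro exI[of _ "\<lambda>_. 0"]) (simp add: cobd_0)

lemma coh_add:
  assumes "coh m a b" "coh m a' b'" shows "coh m (\<lambda>l. a l + a' l) (\<lambda>l. b l + b' l)"
proof -
  obtain e e' where "\<forall>gs. length gs = m \<longrightarrow> a gs = b gs + (if m = 0 then 0 else cobd e gs)"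
    "\<forall>gs. length gs = m \<longrightarrow> a' gs = b' gs + (if m = 0 then 0 else cobd e' gs)"
    using assms unfolding coh_def by blast
  then show ?thesis unfolding coh_def by (intro exI[of _ "\<lambda>l. e l + e' l"]) (simp add: bar_diff_add)
qed

lemma coh_mult:
  assumes "coh m a b" shows "coh m (\<lambda>l. c * a l) (\<lambda>l. c * b l)"
proof -
  obtain e where "\<forall>gs. length gs = m \<longrightarrow> a gs = b gs + (if m = 0 then 0 else cobd e gs)"
    using assms unfolding coh_def by blast
  then show ?thesis unfolding coh_def
    by (intro exI[of _ "\<lambda>l. c * e l"]) (simp add: bar_diff_mult algebra_simps)
qed

lemma coh_trans:
  assumes "coh m a b" "coh m b c" shows "coh m a c"
proof -
  obtain e e' where "\<forall>gs. length gs = m \<longrightarrow> a gs = b gs + (if m = 0 then 0 else cobd e gs)"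
    "\<forall>gs. length gs = m \<longrightarrow> b gs = c gs + (if m = 0 then 0 else cobd e' gs)"
    using assms unfolding coh_def by blast
  then show ?thesis unfolding coh_def by (intro exI[of _ "\<lambda>l. e l + e' l"]) (simp add: bar_diff_add)
qed

lemma coh_sym: "coh m a b \<Longrightarrow> coh m b a"
proof -
  assume "coh m a b"
  then obtain e where "\<forall>gs. length gs = m \<longrightarrow> a gs = b gs + (if m = 0 then 0 else cobd e gs)"
    unfolding coh_def by blast
  then show ?thesis unfolding coh_def
    by (intro exI[of _ "\<lambda>l. - 1 * e l"]) (subst bar_diff_mult, simp)
qed

lemma coh_sum:
  assumes "\<And>i. i \<in> S \<Longrightarrow> coh m (a i) (\<lambda>_. 0)" "finite S"
  shows "coh m (\<lambda>l. \<Sum>i\<in>S. k i * a i l) (\<lambda>_. 0)"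
  using assms(2,1)
proof (induction S rule: finite_induct)
  case (insert i S)
  have "coh m (\<lambda>l. k i * a i l) (\<lambda>_. k i * 0)" by (intro coh_mult insert) simp
  moreover have "coh m (\<lambda>l. \<Sum>i\<in>S. k i * a i l) (\<lambda>_. 0)" by (intro insert) simp
  ultimately show ?case using insert(1,2) coh_add by fastforce
qed (simp add: coh_eq)

section \<open>Cup products of homomorphisms from E to k\<close>

definition additive_map :: "('g::plus \<Rightarrow> 'k::field) \<Rightarrow> bool"
  where "additive_map c \<longleftrightarrow> (\<forall>g h. c (g + h) = c g + c h)"

text \<open>An explicit cochain for the cup product. Its values on lists of other lengths are junk,
  which \<open>coh\<close> ignores.\<close>

fun cprod :: "('g \<Rightarrow> 'k::field) list \<Rightarrow> 'g list \<Rightarrow> 'k" where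
  "cprod [] gs = 1"
| "cprod (c # cs) gs = c (hd gs) * cprod cs (tl gs)"

lemma cprod_Cons: "cprod (c # cs) = (\<lambda>l. c (hd l) * cprod cs (tl l))"
  by (rule HOL.ext) simp

lemma cobd_cprod:
  assumes "\<And>c. c \<in> set cs \<Longrightarrow> additive_map c" "length gs = Suc (length cs)"
  shows "cobd (cprod cs) gs = 0"
  using assms
proof (induction cs arbitrary: gs)
  case Nil
  then obtain g where "gs = [g]" by (cases gs) auto
  then show ?case by (simp add: bar_diff_def)
next
  case (Cons c cs)
  then obtain g hs where gs: "gs = g # hs" "length hs = Suc (length cs)" by (cases gs) auto
  have hs: "hs \<noteq> []" using gs by auto
  have "cobd (cprod (c # cs)) gs = (c (hd hs) - c (g + hd hs) + c g) * cprod cs (tl hs) - c g * cobd (cprod cs) hs"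
    unfolding gs using cobd_prod[OF hs, of c "cprod cs" g] by (simp add: cprod_Cons)
  moreover have "c (g + hd hs) = c g + c (hd hs)" using Cons.prems(1)[of c] by (simp add: additive_map_def)
  moreover have "cobd (cprod cs) hs = 0" using Cons.prems(1) by (intro Cons.IH[OF _ gs(2)]) simp
  ultimately show ?case by (simp del: cprod.simps)
qed

lemma coh_Cons:
  assumes "additive_map c" "coh m a b"
  shows "coh (Suc m) (\<lambda>l. c (hd l) * a (tl l)) (\<lambda>l. c (hd l) * b (tl l))"
proof (cases "m = 0")
  case True
  then have "a [] = b []" using assms(2) by (auto simp: coh_def)
  then show ?thesis using True by (intro coh_eq) (metis length_0_conv length_tl diff_Suc_1)
next
  case False
  obtain e where e: "\<And>gs. length gs = m \<Longrightarrow> a gs = b gs + cobd e gs"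
    using assms(2) False unfolding coh_def by auto
  have "c (hd gs) * a (tl gs) = c (hd gs) * b (tl gs) + cobd (\<lambda>l. - 1 * (c (hd l) * e (tl l))) gs"
    if l: "length gs = Suc m" for gs
  proof -
    obtain g hs where gs: "gs = g # hs" "length hs = m" using l by (cases gs) auto
    then have "hs \<noteq> []" using False by auto
    from cobd_prod[OF this, of c e g] show ?thesis
      using e[OF gs(2)] assms(1) unfolding gs(1) by (subst bar_diff_mult) (simp add: additive_map_def algebra_simps)
  qed
  then show ?thesis unfolding coh_def by auto
qed

text \<open>The 1-cochain sending g to c(g) d(g) has coboundary -(c(g) d(h) + d(g) c(h)) at (g, h).
  Cupped with the cocycle \<open>r\<close> it witnesses anticommutativity.\<close>

lemma coh_swap:
  assumes c: "additive_map c" "additive_map d" and r: "\<And>gs. length gs = Suc m \<Longrightarrow> cobd r gs = 0"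
  shows "coh (Suc (Suc m)) (\<lambda>l. c (hd l) * (d (hd (tl l)) * r (tl (tl l))))
    (\<lambda>l. (- d (hd l)) * (c (hd (tl l)) * r (tl (tl l))))"
proof -
  have "c (hd gs) * (d (hd (tl gs)) * r (tl (tl gs))) = - d (hd gs) * (c (hd (tl gs)) * r (tl (tl gs)))
      + cobd (\<lambda>l. - 1 * ((c (hd l) * d (hd l)) * r (tl l))) gs" if l: "length gs = Suc (Suc m)" for gs
  proof -
    obtain g hs where gs: "gs = g # hs" "length hs = Suc m" using l by (cases gs) auto
    then have "hs \<noteq> []" by auto
    note cobd_prod[OF this, of "\<lambda>g. c g * d g" r g]
    then have "cobd (\<lambda>l. (c (hd l) * d (hd l)) * r (tl l)) (g # hs)
        = (c (hd hs) * d (hd hs) - c (g + hd hs) * d (g + hd hs) + c g * d g) * r (tl hs)"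
      using r[OF gs(2)] by simp
    also have "c (hd hs) * d (hd hs) - c (g + hd hs) * d (g + hd hs) + c g * d g = - (c g * d (hd hs) + d g * c (hd hs))"
      using c by (simp add: additive_map_def algebra_simps)
    finally have *: "cobd (\<lambda>l. (c (hd l) * d (hd l)) * r (tl l)) (g # hs) = - (c g * d (hd hs) + d g * c (hd hs)) * r (tl hs)" .
    show ?thesis unfolding gs(1) bar_diff_mult * by (simp add: algebra_simps)
  qed
  then show ?thesis unfolding coh_def by auto
qed

lemma cprod_swap:
  assumes "\<And>e. e \<in> set (c # d # cs) \<Longrightarrow> additive_map e"
  shows "coh (length (c # d # cs)) (cprod (c # d # cs)) (cprod ((\<lambda>g. - d g) # c # cs))"
  using coh_swap[of c d "length cs" "cprod cs"] assms cobd_cprod[of cs]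
  by (simp add: cprod_Cons)

text \<open>For adjacent equal factors the swap gives c c = - c c up to a coboundary, and p > 2
  enters through \<open>two\<close>. Otherwise \<open>c\<close> is moved to the right until it meets
  its copy.\<close>

lemma cprod_repeat:
  assumes two: "(2::'k::field) \<noteq> 0"
    and "\<And>e. e \<in> set cs \<Longrightarrow> additive_map e" "(c :: 'g::ab_semigroup_add \<Rightarrow> 'k) \<in> set cs"
  shows "coh (Suc (length cs)) (cprod (c # cs)) (\<lambda>_. 0)"
  using assms(2,3)
proof (induction cs)
  case (Cons d cs)
  show ?case
  proof (cases "c = d")
    case True
    let ?a = "cprod (c # c # cs)"
    have "coh (length (c # c # cs)) ?a (cprod ((\<lambda>g. - c g) # c # cs))"
      by (rule cprod_swap) (use Cons True in auto)
    then obtain e where e: "\<And>gs. length gs = Suc (Suc (length cs)) \<Longrightarrow> ?a gs = - ?a gs + cobd e gs"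
      unfolding coh_def by auto
    have "?a gs = cobd (\<lambda>l. 1 / 2 * e l) gs" if "length gs = Suc (Suc (length cs))" for gs
    proof -
      have "x = - x + y \<Longrightarrow> 2 * x = y" for x y :: 'k by (metis add_minus_cancel mult_2)
      from this[OF e[OF that]] show ?thesis using two by (subst bar_diff_mult) (simp add: field_simps)
    qed
    then have "coh (Suc (Suc (length cs))) ?a (\<lambda>_. 0)" unfolding coh_def by (intro exI[of _ "\<lambda>l. 1 / 2 * e l"]) auto
    then show ?thesis using True by (simp add: cprod_Cons)
  next
    case False
    have "coh (length (c # d # cs)) (cprod (c # d # cs)) (cprod ((\<lambda>g. - d g) # c # cs))"
      by (rule cprod_swap) (use Cons in auto)
    moreover have "additive_map (\<lambda>g. - d g)" using Cons.prems(1)[of d] by (simp add: additive_map_def)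
    then have "coh (Suc (Suc (length cs))) (\<lambda>l. (\<lambda>g. - d g) (hd l) * cprod (c # cs) (tl l)) (\<lambda>l. (\<lambda>g. - d g) (hd l) * 0)"
      by (intro coh_Cons Cons.IH) (use Cons.prems False in auto)
    ultimately show ?thesis using coh_trans by (simp add: cprod_Cons) blast
  qed
qed simp

lemma lin_sum_fun: "lin (\<lambda>g. \<Sum>i\<in>S. k i * c i g) a = (\<Sum>i\<in>S. k i * lin (c i) a)"
proof -
  have "lin (\<lambda>g. \<Sum>i\<in>S. k i * c i g) a = (\<Sum>g\<in>UNIV. \<Sum>i\<in>S. k i * (Poly_Mapping.lookup a g * c i g))"
    by (simp add: lin_def sum_distrib_left algebra_simps)
  also have "\<dots> = (\<Sum>i\<in>S. \<Sum>g\<in>UNIV. k i * (Poly_Mapping.lookup a g * c i g))" by (rule sum.swap)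
  finally show ?thesis by (simp add: lin_def sum_distrib_left)
qed

text \<open>The first factor whose coefficient is nonzero is replaced by the combination that
  vanishes on \<open>U\<close>; this leaves the class unchanged up to scaling the relation, and the
  new factor is then moved to the front.\<close>

lemma cprod_dependent:
  fixes c :: "nat \<Rightarrow> 'g::{finite, ab_group_add} \<Rightarrow> 'k::field"
  assumes two: "(2::'k) \<noteq> 0" and "distinct is" "\<And>i. i \<in> set is \<Longrightarrow> additive_map (c i)"
    and "\<exists>i\<in>set is. \<alpha> i \<noteq> 0" "\<And>u. u \<in> U \<Longrightarrow> (\<Sum>i\<in>set is. \<alpha> i * lin (c i) u) = 0"
  shows "\<exists>c' cs. additive_map c' \<and> (\<forall>e\<in>set cs. additive_map e) \<and> length is = Suc (length cs) \<and>
    (\<forall>u\<in>U. lin c' u = 0) \<and> coh (length is) (cprod (map c is)) (cprod (c' # cs))"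
  using assms(2-)
proof (induction "is")
  case (Cons i "is")
  show ?case
  proof (cases "\<alpha> i = 0")
    case True
    have "\<exists>c' cs. additive_map c' \<and> (\<forall>e\<in>set cs. additive_map e) \<and> length is = Suc (length cs) \<and>
      (\<forall>u\<in>U. lin c' u = 0) \<and> coh (length is) (cprod (map c is)) (cprod (c' # cs))"
      by (rule Cons.IH) (use Cons.prems True in auto)
    then obtain c' cs where IH: "additive_map c'" "\<forall>e\<in>set cs. additive_map e" "length is = Suc (length cs)"
      "\<forall>u\<in>U. lin c' u = 0" "coh (length is) (cprod (map c is)) (cprod (c' # cs))" by blast
    have "coh (length (i # is)) (cprod (map c (i # is))) (cprod (c i # c' # cs))"
      using coh_Cons[OF _ IH(5), of "c i"] Cons.prems by (simp add: cprod_Cons)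
    \<comment> \<open>The sign from moving c' to the front is absorbed into c' itself.\<close>
    moreover have "coh (length (i # is)) (cprod (c i # c' # cs)) (cprod ((\<lambda>g. - c' g) # c i # cs))"
      using cprod_swap[of "c i" c' cs] Cons.prems IH by auto
    ultimately have "coh (length (i # is)) (cprod (map c (i # is))) (cprod ((\<lambda>g. - c' g) # c i # cs))"
      by (rule coh_trans)
    moreover have "lin (\<lambda>g. - c' g) u = - lin c' u" for u by (simp add: lin_def sum_negf)
    moreover have "additive_map (\<lambda>g. - c' g)" "additive_map (c i)" using IH(1) Cons.prems by (auto simp: additive_map_def)
    ultimately show ?thesis using IH
      by (intro exI[of _ "\<lambda>g. - c' g"] exI[of _ "c i # cs"]) (simp del: cprod.simps)
  next
    case False
    let ?r = "map c is"
    define c' where "c' g = (\<Sum>j\<in>set (i # is). \<alpha> j / \<alpha> i * c j g)" for g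
    have ad: "\<And>j. j \<in> set (i # is) \<Longrightarrow> additive_map (c j)" using Cons.prems by blast
    have c'ad: "additive_map c'"
      unfolding additive_map_def c'_def
    proof (intro allI)
      fix g h
      have "(\<Sum>j\<in>set (i # is). \<alpha> j / \<alpha> i * c j (g + h)) = (\<Sum>j\<in>set (i # is). \<alpha> j / \<alpha> i * c j g + \<alpha> j / \<alpha> i * c j h)"
        using ad unfolding additive_map_def by (intro sum.cong) (simp_all add: distrib_left)
      then show "(\<Sum>j\<in>set (i # is). \<alpha> j / \<alpha> i * c j (g + h)) =
        (\<Sum>j\<in>set (i # is). \<alpha> j / \<alpha> i * c j g) + (\<Sum>j\<in>set (i # is). \<alpha> j / \<alpha> i * c j h)"
        by (simp only: sum.distrib)
    qed
    have l0: "lin c' u = 0" if "u \<in> U" for u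
    proof -
      have "lin c' u = (\<Sum>j\<in>set (i # is). \<alpha> j / \<alpha> i * lin (c j) u)" unfolding c'_def by (rule lin_sum_fun)
      also have "\<dots> = (\<Sum>j\<in>set (i # is). \<alpha> j * lin (c j) u) / \<alpha> i" unfolding sum_divide_distrib by (intro sum.cong) auto
      finally show ?thesis using Cons.prems(4)[OF that] by simp
    qed
    have c'eq: "c' g = c i g + (\<Sum>j\<in>set is. \<alpha> j / \<alpha> i * c j g)" for g
      unfolding c'_def using Cons.prems(1) False by simp
    \<comment> \<open>Each further summand of c' contributes a product with a repeated factor, hence
      a coboundary.\<close>
    have "coh (Suc (length is)) (\<lambda>l. \<Sum>j\<in>set is. \<alpha> j / \<alpha> i * cprod (c j # ?r) l) (\<lambda>_. 0)"
    proof (rule coh_sum)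
      fix j assume "j \<in> set is"
      then show "coh (Suc (length is)) (cprod (c j # ?r)) (\<lambda>_. 0)"
        using cprod_repeat[OF two, of ?r "c j"] ad by auto
    qed simp
    from coh_add[OF coh_eq[of _ "cprod (c i # ?r)" "cprod (c i # ?r)"] this]
    have sum: "coh (Suc (length is)) (\<lambda>l. cprod (c i # ?r) l + (\<Sum>j\<in>set is. \<alpha> j / \<alpha> i * cprod (c j # ?r) l)) (cprod (c i # ?r))"
      by (simp add: cprod_Cons)
    have "(\<lambda>l. cprod (c i # ?r) l + (\<Sum>j\<in>set is. \<alpha> j / \<alpha> i * cprod (c j # ?r) l)) = cprod (c' # ?r)"
      by (rule HOL.ext) (simp add: c'eq distrib_right sum_distrib_right mult.assoc)
    from coh_sym[OF sum[unfolded this]]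
    have "coh (length (i # is)) (cprod (map c (i # is))) (cprod (c' # ?r))" by simp
    moreover have "\<forall>e\<in>set ?r. additive_map e" using ad by auto
    ultimately show ?thesis using c'ad l0 by (intro exI[of _ c'] exI[of _ ?r]) (simp del: cprod.simps)
  qed
qed simp

section \<open>The class \<open>\<eta>\<^sub>1 \<cdots> \<eta>\<^sub>s\<close>\<close>

lemma coboundaries_1: "z \<in> coboundaries 1 \<Longrightarrow> z gs = 0"
  by (auto simp: coboundaries_def bar_diff_def length_Suc_conv)

text \<open>With trivial coefficients all 1-coboundaries vanish, so a class of degree one has
  exactly one representative and the cocycle condition says that it is additive.\<close>

lemma cohomology_1:
  assumes "A \<in> cohomology 1"
  shows "\<exists>c. additive_map c \<and> (\<exists>z. z \<in> A) \<and> (\<forall>z\<in>A. \<forall>g. z [g] = c g)"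
proof -
  obtain c where c: "A = coh_class 1 c" "c \<in> cocycles 1" using assms by (auto simp: cohomology_def)
  have "bar_diff (\<lambda>_ a. a) c [g, h] = 0" for g h using c(2) by (auto simp: cocycles_def)
  then have "c [g + h] = c [g] + c [h]" for g h
    by (simp add: bar_diff_def merge_at_def algebra_simps eq_diff_eq)
  then have "additive_map (\<lambda>g. c [g])" by (simp add: additive_map_def)
  moreover have "z [g] = c [g]" if "z \<in> A" for z g
    using that coboundaries_1[of _ "[g]"] unfolding c coh_class_def by fastforce
  moreover have "c \<in> A" unfolding c(1) coh_class_def
    by (rule CollectI, rule exI[of _ "\<lambda>_. 0"]) (simp add: coboundaries_def)
  ultimately show ?thesis by blast
qed

lemma cprod_snoc: "length gs = length cs \<Longrightarrow> cprod (cs @ [c]) (gs @ [g]) = cprod cs gs * c g"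
  by (induction cs arbitrary: gs) (auto simp: length_Suc_conv)

lemma coh_class_coh: "z \<in> coh_class m a \<Longrightarrow> coh m z a"
proof -
  assume "z \<in> coh_class m a"
  then obtain b where b: "z = (\<lambda>gs. a gs + b gs)" "b \<in> coboundaries m" unfolding coh_class_def by blast
  show ?thesis
  proof (cases "b = (\<lambda>_. 0)")
    case True
    then show ?thesis using b by (intro coh_eq) auto
  next
    case False
    then obtain e l where "b = (\<lambda>gs. if length gs = m then cobd e gs else 0)" "m = Suc l"
      using b(2) unfolding coboundaries_def by auto
    then show ?thesis unfolding coh_def b(1) by (intro exI[of _ e]) auto
  qed
qed

text \<open>\<open>cup_prod\<close> appends factors on the right while \<open>cprod\<close> peels
  them off on the left. The induction therefore adds a last factor, with
  \<open>bar_diff_snoc\<close> transporting coboundaries.\<close>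

lemma cup_prod_coh:
  assumes "\<And>i. i \<in> {1..s} \<Longrightarrow> additive_map (c i)" "\<And>i z g. i \<in> {1..s} \<Longrightarrow> z \<in> \<eta> i \<Longrightarrow> z [g] = c i g"
    and "z \<in> cup_prod \<eta> s"
  shows "coh s z (cprod (map c [1..<Suc s]))"
  using assms
proof (induction s arbitrary: z)
  case 0
  then show ?case using coh_trans[OF coh_class_coh[of z 0] coh_eq] by auto
next
  case (Suc s)
  obtain a b where ab: "a \<in> cup_prod \<eta> s" "b \<in> \<eta> (Suc s)" "z \<in> coh_class (s + 1) (cup_cochain s 1 a b)"
    using Suc.prems(3) by (auto simp: cup_def)
  let ?c = "c (Suc s)" and ?r = "cprod (map c [1..<Suc s])"
  have IH: "coh s a ?r" by (rule Suc.IH) (use Suc.prems ab in auto)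
  have snoc: "coh (Suc s) (\<lambda>l. a (butlast l) * ?c (last l)) (\<lambda>l. ?r (butlast l) * ?c (last l))"
  proof (cases "s = 0")
    case True
    then have "a [] = ?r []" using IH by (auto simp: coh_def)
    then show ?thesis using True by (intro coh_eq) (auto simp: length_Suc_conv)
  next
    case False
    obtain e where e: "\<And>gs. length gs = s \<Longrightarrow> a gs = ?r gs + cobd e gs"
      using IH False unfolding coh_def by auto
    have "a (butlast gs) * ?c (last gs) = ?r (butlast gs) * ?c (last gs) + cobd (\<lambda>l. e (butlast l) * ?c (last l)) gs"
      if l: "length gs = Suc s" for gs
    proof -
      obtain hs h where gs: "gs = hs @ [h]" "length hs = s" using l by (cases gs rule: rev_cases) auto
      have "hs \<noteq> []" using gs False by auto
      from bar_diff_snoc[OF this, of ?c e h] show ?thesis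
        using e[OF gs(2)] Suc.prems(1)[of "Suc s"] unfolding gs(1) by (simp add: additive_map_def distrib_right)
    qed
    then show ?thesis unfolding coh_def by auto
  qed
  have "coh (Suc s) z (cup_cochain s 1 a b)" using coh_class_coh[OF ab(3)] by simp
  moreover have "coh (Suc s) (cup_cochain s 1 a b) (\<lambda>l. a (butlast l) * ?c (last l))"
  proof (rule coh_eq)
    fix gs assume l: "length (gs :: 'a list) = Suc s"
    then obtain hs h where gs: "gs = hs @ [h]" "length hs = s" by (cases gs rule: rev_cases) auto
    then show "cup_cochain s 1 a b gs = a (butlast gs) * ?c (last gs)"
      using Suc.prems(2)[of "Suc s" b h] ab(2) by (simp add: cup_cochain_def)
  qed
  moreover have "coh (Suc s) (\<lambda>l. ?r (butlast l) * ?c (last l)) (cprod (map c [1..<Suc (Suc s)]))"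
  proof (rule coh_eq)
    fix gs assume l: "length (gs :: 'a list) = Suc s"
    then obtain hs h where gs: "gs = hs @ [h]" "length hs = s" by (cases gs rule: rev_cases) auto
    then show "?r (butlast gs) * ?c (last gs) = cprod (map c [1..<Suc (Suc s)]) gs"
      using cprod_snoc[of hs "map c [1..<Suc s]" ?c h] by simp
  qed
  ultimately show ?case using snoc coh_trans by blast
qed

section \<open>The bar resolution\<close>

text \<open>\<open>S\<close> need not respect the action, which enters the leading term only; that
  term is split off and the rest is written with the trivial action.\<close>

lemma bar_diff_additive_map:
  assumes "\<And>a b. S (a + b) = S a + S b"
  shows "S (bar_diff act \<phi> gs) = S (act (hd gs) (\<phi> (tl gs))) + (bar_diff (\<lambda>_ a. a) (\<lambda>l. S (\<phi> l)) gs - S (\<phi> (tl gs)))"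
proof -
  have S0: "S 0 = 0" using assms[of 0 0] by simp
  have Sm: "S (- a) = - S a" for a using assms[of a "- a"] S0 by (simp add: eq_neg_iff_add_eq_0 add.commute)
  have Ss: "S (sum f A) = (\<Sum>i\<in>A. S (f i))" for f and A :: "nat set"
    by (induction A rule: infinite_finite_induct) (auto simp: S0 assms)
  have "S (\<Sum>i<length gs - 1. if even i then - \<phi> (merge_at i gs) else \<phi> (merge_at i gs))
      = (\<Sum>i<length gs - 1. if even i then - S (\<phi> (merge_at i gs)) else S (\<phi> (merge_at i gs)))"
    unfolding Ss by (intro sum.cong) (auto simp: Sm)
  then show ?thesis unfolding bar_diff_def by (simp add: assms Sm)
qed

lemma bar_diff_hom:
  assumes T: "hom_on s1 s2 M T" and m: "module s1" "module.subspace s1 M"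
    and \<phi>: "\<And>l. Suc (length l) = length gs \<Longrightarrow> \<phi> l \<in> M" and gs: "gs \<noteq> []"
  shows "T (bar_diff (\<lambda>g. s1 (Poly_Mapping.single g 1)) \<phi> gs) = bar_diff (\<lambda>g. s2 (Poly_Mapping.single g 1)) (\<lambda>l. T (\<phi> l)) gs"
proof -
  interpret s: module s1 by fact
  have mg: "\<phi> (merge_at i gs) \<in> M" if "i < length gs - 1" for i
    using that by (intro \<phi>) (auto simp: merge_at_def)
  have tl: "\<phi> (tl gs) \<in> M" "\<phi> (butlast gs) \<in> M" using gs by (auto intro!: \<phi>)
  have S: "(\<Sum>i<length gs - 1. if even i then - \<phi> (merge_at i gs) else \<phi> (merge_at i gs)) \<in> M"
    using mg m(2) by (intro s.subspace_sum) (auto simp: s.subspace_neg)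
  have "T (\<Sum>i<length gs - 1. if even i then - \<phi> (merge_at i gs) else \<phi> (merge_at i gs))
      = (\<Sum>i<length gs - 1. if even i then - T (\<phi> (merge_at i gs)) else T (\<phi> (merge_at i gs)))"
    using mg m(2) by (subst hom_on_sum[OF T m]) (auto simp: s.subspace_neg hom_on_minus[OF T m] intro!: sum.cong)
  then show ?thesis
    unfolding bar_diff_def using tl S m(2) hom_on_minus[OF T m, of "\<phi> (butlast gs)"]
    by (simp add: hom_on_add[OF T] hom_on_scale[OF T] s.subspace_add s.subspace_scale s.subspace_neg)
qed

text \<open>All degrees sit in one free module on lists, graded by length, so that a single
  \<open>bar_d\<close> is every differential.\<close>

definition Bar :: "nat \<Rightarrow> ('g list \<Rightarrow>\<^sub>0 'r::zero) set"
  where "Bar m = {F. \<forall>l. Poly_Mapping.lookup F l \<noteq> 0 \<longrightarrow> length l = m}"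

definition bar_sym :: "'g::{finite, ab_group_add} list \<Rightarrow> 'g list \<Rightarrow>\<^sub>0 ('g \<Rightarrow>\<^sub>0 'k::field)"
  where "bar_sym l = bar_diff (\<lambda>g. free_scale (Poly_Mapping.single g 1)) (\<lambda>l. Poly_Mapping.single l 1) l"

definition bar_d :: "('g::{finite, ab_group_add} list \<Rightarrow>\<^sub>0 ('g \<Rightarrow>\<^sub>0 'k::field)) \<Rightarrow> 'g list \<Rightarrow>\<^sub>0 ('g \<Rightarrow>\<^sub>0 'k)"
  where "bar_d = ext free_scale bar_sym"

lemma hom_on_bar_d: "hom_on free_scale free_scale UNIV bar_d"
  unfolding bar_d_def by (rule hom_on_ext[OF module_free_scale])

lemma bar_d_single: "bar_d (Poly_Mapping.single l a) = free_scale a (bar_sym l)"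
  unfolding bar_d_def by (rule ext_single[OF module_free_scale])

lemma bar_d_0: "bar_d 0 = 0"
  by (simp add: bar_d_def ext_def)

lemma bar_d_add: "bar_d (F + G) = bar_d F + bar_d G"
  by (rule hom_on_add[OF hom_on_bar_d]) simp_all

lemma subspace_Bar: "module.subspace free_scale (Bar m :: ('g list \<Rightarrow>\<^sub>0 'r::comm_ring_1) set)"
proof (rule module.subspaceI[OF module_free_scale])
  show "F + G \<in> Bar m" if "F \<in> Bar m" "G \<in> Bar m" for F G :: "'g list \<Rightarrow>\<^sub>0 'r"
    using that unfolding Bar_def by (auto simp: lookup_add) (metis add_0)
next
  show "free_scale c F \<in> Bar m" if "F \<in> Bar m" for c and F :: "'g list \<Rightarrow>\<^sub>0 'r"
    using that unfolding Bar_def by (auto simp: lookup_free_scale) (metis mult_zero_right)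
qed (simp add: Bar_def)

lemma single_Bar: "length l = m \<Longrightarrow> Poly_Mapping.single l a \<in> Bar m"
  by (auto simp: Bar_def lookup_single when_def)

lemma bar_sym_Bar: "length l = Suc m \<Longrightarrow> bar_sym l \<in> Bar m"
proof -
  assume l: "length l = Suc m"
  interpret module "free_scale :: _ \<Rightarrow> ('a list \<Rightarrow>\<^sub>0 ('a \<Rightarrow>\<^sub>0 'b)) \<Rightarrow> _" by (rule module_free_scale)
  have "length (merge_at i l) = m" if "i < m" for i using that l by (auto simp: merge_at_def)
  then show ?thesis unfolding bar_sym_def bar_diff_def using l
    by (intro subspace_add[OF subspace_Bar] subspace_sum[OF subspace_Bar] subspace_scale[OF subspace_Bar])
      (auto intro!: subspace_neg[OF subspace_Bar] single_Bar)
qed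

lemma bar_d_Bar: "F \<in> Bar (Suc m) \<Longrightarrow> bar_d F \<in> Bar m"
  unfolding bar_d_def ext_def
  by (intro module.subspace_sum[OF module_free_scale subspace_Bar] module.subspace_scale[OF module_free_scale subspace_Bar] bar_sym_Bar)
    (auto simp: Bar_def in_keys_iff)

text \<open>The standard contraction of the bar resolution, moving a group element from the
  coefficient into the symbol. It is k-linear but not kE-linear, hence the expansion of the
  coefficient over E.\<close>

definition contr1 :: "'g::{finite, ab_group_add} list \<Rightarrow> ('g \<Rightarrow>\<^sub>0 'k::field) \<Rightarrow> 'g list \<Rightarrow>\<^sub>0 ('g \<Rightarrow>\<^sub>0 'k)"
  where "contr1 l a = (\<Sum>g\<in>UNIV. Poly_Mapping.single (g # l) (Poly_Mapping.single 0 (Poly_Mapping.lookup a g)))"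

definition contr :: "('g::{finite, ab_group_add} list \<Rightarrow>\<^sub>0 ('g \<Rightarrow>\<^sub>0 'k::field)) \<Rightarrow> 'g list \<Rightarrow>\<^sub>0 ('g \<Rightarrow>\<^sub>0 'k)"
  where "contr F = (\<Sum>l\<in>Poly_Mapping.keys F. contr1 l (Poly_Mapping.lookup F l))"

lemma contr1_add: "contr1 l (a + b) = contr1 l a + contr1 l b"
  by (simp add: contr1_def lookup_add single_add sum.distrib)

lemma contr1_0: "contr1 l 0 = 0"
  by (simp add: contr1_def)

lemma contr1_single: "contr1 l (Poly_Mapping.single g c) = Poly_Mapping.single (g # l) (Poly_Mapping.single 0 c)"
proof -
  have "contr1 l (Poly_Mapping.single g c) = (\<Sum>h\<in>UNIV. if h = g then Poly_Mapping.single (g # l) (Poly_Mapping.single 0 c) else 0)"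
    unfolding contr1_def by (intro sum.cong) (auto simp: lookup_single when_def)
  then show ?thesis by simp
qed

lemma contr_0: "contr 0 = 0"
  by (simp add: contr_def)

lemma contr_superset:
  assumes "finite K" "Poly_Mapping.keys F \<subseteq> K"
  shows "contr F = (\<Sum>l\<in>K. contr1 l (Poly_Mapping.lookup F l))"
  unfolding contr_def using assms by (intro sum.mono_neutral_left) (auto simp: in_keys_iff contr1_0)

lemma contr_add: "contr (F + G) = contr F + contr G"
  using Poly_Mapping.keys_add[of F G]
  by (subst (1 2 3) contr_superset[of "Poly_Mapping.keys F \<union> Poly_Mapping.keys G"])
    (auto simp: lookup_add contr1_add sum.distrib)

lemma contr_single: "contr (Poly_Mapping.single l (Poly_Mapping.single g c)) = Poly_Mapping.single (g # l) (Poly_Mapping.single 0 c)"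
  by (subst contr_superset[of "{l}"]) (auto simp: contr1_single split: if_splits)

lemma contr_Bar: "F \<in> Bar m \<Longrightarrow> contr F \<in> Bar (Suc m)"
  unfolding contr_def contr1_def
  by (intro module.subspace_sum[OF module_free_scale subspace_Bar] single_Bar) (auto simp: Bar_def in_keys_iff)

lemma bar_induct [consumes 1, case_names zero single add]:
  assumes "F \<in> Bar m" and "Q 0"
    and "\<And>l g c. length l = m \<Longrightarrow> Q (Poly_Mapping.single l (Poly_Mapping.single (g::'g::finite) (c::'k::comm_monoid_add)))"
    and add: "\<And>F G. Q F \<Longrightarrow> Q G \<Longrightarrow> Q (F + G)"
  shows "Q F"
proof -
  have sum: "Q (sum f A)" if "\<And>i. i \<in> A \<Longrightarrow> Q (f i)" for A and f :: "'x \<Rightarrow> 'a list \<Rightarrow>\<^sub>0 ('g \<Rightarrow>\<^sub>0 'k)"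
    using that by (induction A rule: infinite_finite_induct) (auto simp: assms(2) intro: add)
  have single_sum: "Poly_Mapping.single l (\<Sum>g\<in>(UNIV::'g set). f g) = (\<Sum>g\<in>UNIV. Poly_Mapping.single l (f g))"
    for l :: "'a list" and f :: "'g \<Rightarrow> 'g \<Rightarrow>\<^sub>0 'k"
    by (intro poly_mapping_eqI) (auto simp: lookup_single when_def lookup_sum)
  have "Q (Poly_Mapping.single l a)" if "length l = m" for l a
    by (subst sum_singles[of a], subst single_sum) (intro sum assms(3) that)
  then have "Q (\<Sum>l\<in>Poly_Mapping.keys F. Poly_Mapping.single l (Poly_Mapping.lookup F l))"
    using assms(1) by (intro sum) (auto simp: Bar_def in_keys_iff)
  then show ?thesis by (simp flip: poly_mapping_sum_singles)
qed

text \<open>By \<open>bar_diff_Cons\<close> the boundary of the symbol [g|l] is g times l minus the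
  contraction of g times the boundary of l, which is the identity for a contracting
  homotopy.\<close>

lemma contraction_Suc: "F \<in> Bar (Suc m) \<Longrightarrow> bar_d (contr F) + contr (bar_d F) = F"
proof (induction rule: bar_induct)
  case zero
  show ?case by (simp add: contr_0 bar_d_0)
next
  case (single l g c)
  let ?s = "\<lambda>l. Poly_Mapping.single l (1 :: 'a \<Rightarrow>\<^sub>0 'b)"
  let ?\<psi> = "\<lambda>x. Poly_Mapping.single (g # x) (Poly_Mapping.single 0 c)"
  let ?id = "\<lambda>_ a. a"
  interpret M: module "free_scale :: _ \<Rightarrow> ('a list \<Rightarrow>\<^sub>0 ('a \<Rightarrow>\<^sub>0 'b)) \<Rightarrow> _" by (rule module_free_scale)
  have l: "l \<noteq> []" using single by auto
  have "bar_d (contr (Poly_Mapping.single l (Poly_Mapping.single g c)))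
      = free_scale (Poly_Mapping.single 0 c) (bar_sym (g # l))"
    by (simp add: contr_single bar_d_single)
  also have "bar_sym (g # l) = free_scale (Poly_Mapping.single g 1) (?s l) - ?s ((g + hd l) # tl l)
      + ?s (g # tl l) - bar_diff ?id (\<lambda>x. ?s (g # x)) l"
    unfolding bar_sym_def by (rule bar_diff_Cons[OF l])
  also have "free_scale (Poly_Mapping.single 0 c) \<dots> = Poly_Mapping.single l (Poly_Mapping.single g c)
      - Poly_Mapping.single ((g + hd l) # tl l) (Poly_Mapping.single 0 c) + ?\<psi> (tl l) - bar_diff ?id ?\<psi> l"
    by (simp add: M.scale_right_distrib M.scale_right_diff_distrib free_scale_single mult_single
        bar_diff_additive_map[of "free_scale (Poly_Mapping.single 0 c)"])
  finally have 1: "bar_d (contr (Poly_Mapping.single l (Poly_Mapping.single g c))) = \<dots>" .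
  have "contr (bar_d (Poly_Mapping.single l (Poly_Mapping.single g c)))
      = contr (free_scale (Poly_Mapping.single g c) (bar_sym l))" by (simp add: bar_d_single)
  also have "\<dots> = Poly_Mapping.single ((g + hd l) # tl l) (Poly_Mapping.single 0 c) + (bar_diff ?id ?\<psi> l - ?\<psi> (tl l))"
    unfolding bar_sym_def
    by (subst bar_diff_additive_map[of "\<lambda>F. contr (free_scale (Poly_Mapping.single g c) F)"])
      (simp_all add: M.scale_right_distrib contr_add free_scale_single mult_single contr_single)
  finally show ?case unfolding 1 by simp
next
  case (add F G)
  have "bar_d (contr (F + G)) + contr (bar_d (F + G)) = (bar_d (contr F) + contr (bar_d F)) + (bar_d (contr G) + contr (bar_d G))"
    by (simp add: contr_add bar_d_add)
  then show ?case using add by simp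
qed

lemma contraction_0: "F \<in> Bar 0 \<Longrightarrow> bar_d (contr F) = F - Poly_Mapping.single [] (Poly_Mapping.single 0 (aug (Poly_Mapping.lookup F [])))"
proof (induction rule: bar_induct)
  case zero
  show ?case by (simp add: contr_0 bar_d_0)
next
  case (single l g c)
  interpret M: module "free_scale :: _ \<Rightarrow> ('a list \<Rightarrow>\<^sub>0 ('a \<Rightarrow>\<^sub>0 'b)) \<Rightarrow> _" by (rule module_free_scale)
  have l: "l = []" using single by simp
  have "bar_sym [g] = Poly_Mapping.single [] (Poly_Mapping.single g 1) - Poly_Mapping.single [] (1 :: 'a \<Rightarrow>\<^sub>0 'b)"
    by (simp add: bar_sym_def bar_diff_def free_scale_single)
  then show ?case unfolding l
    by (simp add: contr_single bar_d_single M.scale_right_diff_distrib free_scale_single mult_single)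
next
  case (add F G)
  then show ?case by (simp add: contr_add bar_d_add lookup_add aug_add single_add)
qed

lemma acyclic_bar:
  "acyclic_complex free_scale triv_scale (Bar :: nat \<Rightarrow> ('g::{finite, ab_group_add} list \<Rightarrow>\<^sub>0 ('g \<Rightarrow>\<^sub>0 'k::field)) set)
     (\<lambda>_. bar_d) (\<lambda>F. aug (Poly_Mapping.lookup F []))"
  unfolding acyclic_complex_def
proof (intro conjI allI)
  show "hom_on free_scale free_scale (Bar (Suc i)) bar_d" for i
    by (rule hom_on_subset[OF hom_on_bar_d]) simp
  show "bar_d ` Bar (Suc i) \<subseteq> (Bar i :: ('g list \<Rightarrow>\<^sub>0 ('g \<Rightarrow>\<^sub>0 'k)) set)" for i using bar_d_Bar by blast
  show "hom_on free_scale triv_scale (Bar 0 :: ('g list \<Rightarrow>\<^sub>0 ('g \<Rightarrow>\<^sub>0 'k)) set) (\<lambda>F. aug (Poly_Mapping.lookup F []))"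
    by (auto intro!: hom_onI simp: lookup_add aug_add lookup_free_scale triv_scale_def)
  show "(\<lambda>F. aug (Poly_Mapping.lookup F [])) ` (Bar 0 :: ('g list \<Rightarrow>\<^sub>0 ('g \<Rightarrow>\<^sub>0 'k)) set) = UNIV"
  proof (intro set_eqI iffI UNIV_I)
    fix c :: 'k
    show "c \<in> (\<lambda>F. aug (Poly_Mapping.lookup F [])) ` (Bar 0 :: ('g list \<Rightarrow>\<^sub>0 ('g \<Rightarrow>\<^sub>0 'k)) set)"
      by (rule image_eqI[of _ _ "Poly_Mapping.single [] (Poly_Mapping.single 0 c)"]) (auto intro: single_Bar)
  qed
  show "{F \<in> (Bar 0 :: ('g list \<Rightarrow>\<^sub>0 ('g \<Rightarrow>\<^sub>0 'k)) set). aug (Poly_Mapping.lookup F []) = 0} \<subseteq> bar_d ` Bar (Suc 0)"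
  proof
    fix F :: "'g list \<Rightarrow>\<^sub>0 ('g \<Rightarrow>\<^sub>0 'k)"
    assume "F \<in> {F \<in> Bar 0. aug (Poly_Mapping.lookup F []) = 0}"
    then have "F = bar_d (contr F)" "contr F \<in> Bar (Suc 0)" using contraction_0[of F] contr_Bar[of F 0] by auto
    then show "F \<in> bar_d ` Bar (Suc 0)" by blast
  qed
  show "{F \<in> Bar (Suc i). bar_d F = (0 :: 'g list \<Rightarrow>\<^sub>0 ('g \<Rightarrow>\<^sub>0 'k))} \<subseteq> bar_d ` Bar (Suc (Suc i))" for i
  proof
    fix F :: "'g list \<Rightarrow>\<^sub>0 ('g \<Rightarrow>\<^sub>0 'k)"
    assume "F \<in> {F \<in> Bar (Suc i). bar_d F = 0}"
    then have "F = bar_d (contr F)" "contr F \<in> Bar (Suc (Suc i))"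
      using contraction_Suc[of F i] contr_Bar[of F "Suc i"] by (auto simp: contr_0)
    then show "F \<in> bar_d ` Bar (Suc (Suc i))" by blast
  qed
qed (rule subspace_Bar)

lemma Bar_finite_dim:
  "\<exists>W. finite W \<and> (Bar m :: ('g::{finite, ab_group_add} list \<Rightarrow>\<^sub>0 ('g \<Rightarrow>\<^sub>0 'k::field)) set) \<subseteq> module.span (kscale free_scale) W"
proof -
  interpret k: vector_space "kscale free_scale :: 'k \<Rightarrow> ('g list \<Rightarrow>\<^sub>0 ('g \<Rightarrow>\<^sub>0 'k)) \<Rightarrow> _"
    by (rule kscale_vector_space[OF module_free_scale])
  let ?f = "\<lambda>(l, g). Poly_Mapping.single l (Poly_Mapping.single g (1::'k))"
  let ?W = "?f ` ({l :: 'g list. set l \<subseteq> UNIV \<and> length l = m} \<times> (UNIV :: 'g set))"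
  have "finite ?W" by (intro finite_imageI finite_cartesian_product finite_lists_length_eq) auto
  moreover have "F \<in> k.span ?W" if "F \<in> Bar m" for F :: "'g list \<Rightarrow>\<^sub>0 ('g \<Rightarrow>\<^sub>0 'k)"
    using that
  proof (induction rule: bar_induct)
    case (single l g c)
    have "Poly_Mapping.single l (Poly_Mapping.single g c) = kscale free_scale c (?f (l, g))"
      by (simp add: kscale_def free_scale_single mult_single)
    also have "\<dots> \<in> k.span ?W" by (intro k.span_scale k.span_base imageI) (use single in auto)
    finally show ?case .
  qed (auto intro: k.span_add k.span_zero)
  ultimately show ?thesis by blast
qed

lemma ext_bar_d:
  assumes "module s" "F \<in> Bar (Suc m)"
  shows "ext s y (bar_d F) = ext s (bar_diff (\<lambda>g. s (Poly_Mapping.single g 1)) y) F"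
proof (rule hom_free_eqI)
  show "hom_on free_scale s UNIV (\<lambda>F. ext s y (bar_d F))"
    by (rule hom_on_comp[OF hom_on_bar_d hom_on_ext[OF assms(1)]]) simp
  show "hom_on free_scale s UNIV (ext s (bar_diff (\<lambda>g. s (Poly_Mapping.single g 1)) y))"
    by (rule hom_on_ext[OF assms(1)])
  fix l assume "l \<in> Poly_Mapping.keys F"
  then have "l \<noteq> []" using assms(2) unfolding Bar_def by (force simp: in_keys_iff)
  then have "ext s y (bar_sym l) = bar_diff (\<lambda>g. s (Poly_Mapping.single g 1)) (\<lambda>l. ext s y (Poly_Mapping.single l 1)) l"
    unfolding bar_sym_def
    by (intro bar_diff_hom[OF hom_on_ext[OF assms(1)] module_free_scale]) (simp_all add: module.subspace_UNIV[OF module_free_scale])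
  then show "ext s y (bar_d (Poly_Mapping.single l 1)) = ext s (bar_diff (\<lambda>g. s (Poly_Mapping.single g 1)) y) (Poly_Mapping.single l 1)"
    by (simp add: bar_d_single ext_single[OF assms(1)] module.scale_one[OF assms(1)] module.scale_one[OF module_free_scale])
qed

section \<open>Cohomology classes as homomorphisms on a minimal resolution\<close>

locale ea_res = elem_ab_algebra p n V x + min_res scale P d \<epsilon>
  for p n :: nat and V :: "('g::{finite, ab_group_add} \<Rightarrow>\<^sub>0 'k::field) set" and x :: "nat \<Rightarrow> 'g \<Rightarrow>\<^sub>0 'k"
    and scale :: "('g \<Rightarrow>\<^sub>0 'k) \<Rightarrow> 'm::ab_group_add \<Rightarrow> 'm" and P d \<epsilon> +
  fixes \<phi> :: "'g list \<Rightarrow> 'm"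
  assumes cmp: "bar_comparison scale P d \<epsilon> \<phi>"
begin

lemma \<phi>P: "\<phi> gs \<in> P (length gs)"
  using cmp unfolding bar_comparison_def by blast

lemma \<phi>_Nil: "\<epsilon> (\<phi> []) = 1"
  using cmp unfolding bar_comparison_def by blast

lemma d\<phi>: "gs \<noteq> [] \<Longrightarrow> d (length gs) (\<phi> gs) = bar_diff (\<lambda>g. scale (Poly_Mapping.single g 1)) \<phi> gs"
  using cmp unfolding bar_comparison_def by blast

lemma hom_triv_Rad:
  fixes s :: "('g \<Rightarrow>\<^sub>0 'k) \<Rightarrow> 'b::ab_group_add \<Rightarrow> 'b"
  assumes "module s" "module.subspace s M" "hom_on s triv_scale M f" "y \<in> Rad_pow s Rad 1 M"
  shows "f y = (0::'k)"
  using assms(4,1) subspace_kscale[OF assms(1,2)]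
proof (induction rule: Rad_pow_induct)
  case zero
  then show ?case using hom_on_0[OF assms(3,1,2)] by simp
next
  case (step us m y)
  then obtain u where u: "us = [u]" "aug u = 0" unfolding Rad_eq by (auto simp: length_Suc_conv)
  have "y \<in> M" using step(4) Rad_pow_subset[OF assms(1,2)] by blast
  moreover have "s u m \<in> M" using module.subspace_scale[OF assms(1,2)] step(3) .
  ultimately show ?case using u step hom_on_add[OF assms(3)] hom_on_scale[OF assms(3) step(3)]
    by (simp add: triv_scale_def)
qed

text \<open>By minimality every homomorphism from \<open>P m\<close> to k is a cocycle.\<close>

lemma lam_d: "hom_on scale triv_scale (P m) lam \<Longrightarrow> y \<in> P (Suc m) \<Longrightarrow> lam (d (Suc m) y) = 0"
  using hom_triv_Rad[OF mod Psub] dRad by blast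

section \<open>Chain maps between the minimal and the bar resolution\<close>

definition bar_lift :: "(nat \<Rightarrow> 'm \<Rightarrow> 'g list \<Rightarrow>\<^sub>0 ('g \<Rightarrow>\<^sub>0 'k)) \<Rightarrow> bool"
  where "bar_lift \<Theta> \<longleftrightarrow> (\<forall>i. hom_on scale free_scale (P i) (\<Theta> i)) \<and> (\<forall>i. \<forall>y\<in>P i. \<Theta> i y \<in> Bar i) \<and>
    (\<forall>i. \<forall>y\<in>P (Suc i). bar_d (\<Theta> (Suc i) y) = \<Theta> i (d (Suc i) y)) \<and>
    chain_endo (\<lambda>i y. ext scale \<phi> (\<Theta> i y)) \<and> (\<forall>y\<in>P 0. \<epsilon> (ext scale \<phi> (\<Theta> 0 y)) = \<epsilon> y)"

lemma bar_liftD: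
  assumes "bar_lift \<Theta>"
  shows "hom_on scale free_scale (P i) (\<Theta> i)" "y \<in> P i \<Longrightarrow> \<Theta> i y \<in> Bar i"
    "y \<in> P (Suc i) \<Longrightarrow> bar_d (\<Theta> (Suc i) y) = \<Theta> i (d (Suc i) y)"
    "chain_endo (\<lambda>i y. ext scale \<phi> (\<Theta> i y))" "y \<in> P 0 \<Longrightarrow> \<epsilon> (ext scale \<phi> (\<Theta> 0 y)) = \<epsilon> y"
  using assms unfolding bar_lift_def by auto

lemma bar_lift_exists: "\<exists>\<Theta>. bar_lift \<Theta>"
proof -
  obtain \<Theta> where "comparison_map free_scale Bar (\<lambda>_. bar_d) (\<lambda>F. aug (Poly_Mapping.lookup F [])) \<Theta>"
    using comparison[OF module_free_scale acyclic_bar] ..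
  note \<Theta> = comparison_mapD[OF this]
  have eP: "ext scale \<phi> F \<in> P i" if "F \<in> Bar i" for F i
    unfolding ext_def using that \<phi>P by (intro P_closed) (force simp: Bar_def in_keys_iff)
  have "chain_endo (\<lambda>i y. ext scale \<phi> (\<Theta> i y))"
    unfolding chain_endo_def
  proof (intro allI conjI ballI)
    fix i
    show "hom_on scale scale (P i) (\<lambda>y. ext scale \<phi> (\<Theta> i y))"
      by (rule hom_on_comp[OF \<Theta>(1) hom_on_ext[OF mod]]) simp
    show "(\<lambda>y. ext scale \<phi> (\<Theta> i y)) ` P i \<subseteq> P i" using eP \<Theta>(2) by blast
    fix y assume y: "y \<in> P (Suc i)"
    define F where "F = \<Theta> (Suc i) y"
    have F: "F \<in> Bar (Suc i)" unfolding F_def using \<Theta>(2) y .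
    have keys: "length l = Suc i" "\<phi> l \<in> P (Suc i)" if "l \<in> Poly_Mapping.keys F" for l
      using F that \<phi>P[of l] by (auto simp: Bar_def in_keys_iff)
    have "d (Suc i) (ext scale \<phi> F) = (\<Sum>l\<in>Poly_Mapping.keys F. scale (Poly_Mapping.lookup F l) (d (Suc i) (\<phi> l)))"
      unfolding ext_def using keys
      by (subst hom_on_sum[OF dhom mod Psub]) (auto intro!: P_closed sum.cong simp: hom_on_scale[OF dhom])
    also have "\<dots> = ext scale (bar_diff (\<lambda>g. scale (Poly_Mapping.single g 1)) \<phi>) F"
      unfolding ext_def
    proof (intro sum.cong refl)
      fix l assume l: "l \<in> Poly_Mapping.keys F"
      then have "l \<noteq> []" using keys(1) by force
      then show "scale (Poly_Mapping.lookup F l) (d (Suc i) (\<phi> l)) =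
          scale (Poly_Mapping.lookup F l) (bar_diff (\<lambda>g. scale (Poly_Mapping.single g 1)) \<phi> l)"
        using d\<phi>[of l] keys(1)[OF l] by simp
    qed
    also have "\<dots> = ext scale \<phi> (bar_d F)" by (rule ext_bar_d[OF mod F, symmetric])
    also have "bar_d F = \<Theta> i (d (Suc i) y)" unfolding F_def using \<Theta>(4) y .
    finally show "d (Suc i) (ext scale \<phi> (\<Theta> (Suc i) y)) = ext scale \<phi> (\<Theta> i (d (Suc i) y))" unfolding F_def .
  qed
  moreover have "\<epsilon> (ext scale \<phi> (\<Theta> 0 y)) = \<epsilon> y" if y: "y \<in> P 0" for y
  proof -
    have "Poly_Mapping.keys (\<Theta> 0 y) \<subseteq> {[]}" using \<Theta>(2)[OF y] by (auto simp: Bar_def in_keys_iff)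
    then have "ext scale \<phi> (\<Theta> 0 y) = scale (Poly_Mapping.lookup (\<Theta> 0 y) []) (\<phi> [])"
      by (subst ext_superset[OF mod, of "{[]}"]) auto
    then show ?thesis using \<Theta>(3)[OF y] \<phi>P[of "[]"] \<phi>_Nil by (simp add: hom_on_scale[OF \<epsilon>hom] triv_scale_def)
  qed
  ultimately have "bar_lift \<Theta>" unfolding bar_lift_def using \<Theta> by simp
  then show ?thesis by blast
qed

text \<open>The composite of \<open>P i\<close> into \<open>Bar i\<close> and back lifts the
  identity of k, so it is injective by minimality, and \<open>P i\<close> embeds in a
  finite-dimensional space.\<close>

lemma P_finite_dim: "\<exists>W. finite W \<and> P i \<subseteq> k.span W"
proof -
  obtain N where N: "\<And>i. Rad_pow scale Rad N (P i) = {0}"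
    using Rad_pow_nilpotent[where ?'m = 'm] mod by blast
  obtain \<Theta> where "bar_lift \<Theta>" using bar_lift_exists ..
  note \<Theta> = bar_liftD[OF this]
  have inj: "y = 0" if y: "y \<in> P i" "\<Theta> i y = 0" for y
    by (rule chain_endo_inj[OF N \<Theta>(4,5) y(1)]) (simp_all add: y(2) ext_def)
  obtain W :: "('g list \<Rightarrow>\<^sub>0 ('g \<Rightarrow>\<^sub>0 'k)) set" where
    "finite W \<and> Bar i \<subseteq> module.span (kscale free_scale) W"
    using Bar_finite_dim by (rule exE)
  then have W: "finite W" "Bar i \<subseteq> module.span (kscale free_scale) W" by simp_all
  have im: "\<Theta> i ` P i \<subseteq> Bar i" using \<Theta>(2) by blast
  show ?thesis
    using dim_le_of_inj[OF kscale_vector_space[OF mod] kscale_vector_space[OF module_free_scale]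
          subspace_kscale[OF mod Psub] hom_on_kscale[OF \<Theta>(1)] inj im W(2,1)] by (rule conjunct1)
qed

text \<open>Modulo the radical, y is the image of the bar chain \<open>\<Theta> m y\<close>, so lam
  y is the value of the cochain on that chain. If the cochain is the coboundary of e, the value is
  that of e on \<open>\<Theta>\<close> of d y, and a homomorphism to k kills d y because it lies in
  the radical.\<close>

lemma lam_unique_0:
  assumes lam: "hom_on scale triv_scale (P m) lam" and c: "coh m (\<lambda>l. lam (\<phi> l)) (\<lambda>_. 0)" and y: "y \<in> P m"
  shows "lam y = 0"
proof -
  obtain \<Theta> where "bar_lift \<Theta>" using bar_lift_exists ..
  note \<Theta> = bar_liftD[OF this]
  define F where "F = \<Theta> m y"
  have F: "F \<in> Bar m" unfolding F_def using \<Theta>(2) y .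
  have keys: "length l = m" "\<phi> l \<in> P m" if "l \<in> Poly_Mapping.keys F" for l
    using F that \<phi>P[of l] by (auto simp: Bar_def in_keys_iff)
  have eP: "ext scale \<phi> F \<in> P m" unfolding ext_def using keys by (intro P_closed) auto
  have "lam (ext scale \<phi> F - y) = 0"
    using chain_endo_id_mod_Rad[OF \<Theta>(4,5) y] by (intro hom_triv_Rad[OF mod Psub lam]) (simp add: F_def)
  then have "lam y = lam (ext scale \<phi> F)" using hom_on_diff[OF lam mod Psub eP y] by simp
  also have "\<dots> = (\<Sum>l\<in>Poly_Mapping.keys F. aug (Poly_Mapping.lookup F l) * lam (\<phi> l))"
    unfolding ext_def using keys
    by (subst hom_on_sum[OF lam mod Psub]) (auto intro!: P_closed sum.cong simp: hom_on_scale[OF lam] triv_scale_def)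
  also have "\<dots> = 0"
  proof (cases m)
    case 0
    then show ?thesis using c keys(1) by (intro sum.neutral) (auto simp: coh_def)
  next
    case (Suc m')
    obtain e where e: "\<And>gs. length gs = m \<Longrightarrow> lam (\<phi> gs) = cobd e gs" using c Suc unfolding coh_def by auto
    have tr: "(\<lambda>g::'g. triv_scale (Poly_Mapping.single g (1::'k))) = (\<lambda>_ a. a)"
      by (intro HOL.ext) (simp add: triv_scale_def)
    have "(\<Sum>l\<in>Poly_Mapping.keys F. aug (Poly_Mapping.lookup F l) * lam (\<phi> l)) = ext triv_scale (cobd e) F"
      unfolding ext_def using e keys(1) by (intro sum.cong) (auto simp: triv_scale_def)
    also have "\<dots> = ext triv_scale e (bar_d F)"
      using ext_bar_d[OF module_triv_scale, of F m' e] F Suc by (simp add: tr)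
    also have "bar_d F = \<Theta> m' (d m y)" unfolding F_def using \<Theta>(3)[of y m'] y Suc by simp
    also have "ext triv_scale e (\<Theta> m' (d m y)) = 0"
    proof (rule hom_triv_Rad[OF mod Psub])
      show "hom_on scale triv_scale (P m') (\<lambda>z. ext triv_scale e (\<Theta> m' z))"
        by (rule hom_on_comp[OF \<Theta>(1) hom_on_ext[OF module_triv_scale]]) simp
      show "d m y \<in> Rad_pow scale Rad 1 (P m')" using dRad[of y m'] y Suc by simp
    qed
    finally show ?thesis .
  qed
  finally show ?thesis .
qed

section \<open>Homomorphisms representing products of classes\<close>

definition represents_on :: "nat \<Rightarrow> ('m \<Rightarrow> 'k) \<Rightarrow> ('g list \<Rightarrow> 'k) \<Rightarrow> bool"
  where "represents_on m lam a \<longleftrightarrow> hom_on scale triv_scale (P m) lam \<and> coh m (\<lambda>l. lam (\<phi> l)) a"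

lemma represents_on_unique:
  assumes "represents_on m lam a" "represents_on m mu a" "y \<in> P m"
  shows "lam y = mu y"
proof -
  have "hom_on scale triv_scale (P m) (\<lambda>y. lam y - mu y)"
    using assms unfolding represents_on_def by (intro hom_on_minus_fun module_triv_scale) auto
  moreover have "coh m (\<lambda>l. lam (\<phi> l) + - 1 * mu (\<phi> l)) (\<lambda>l. a l + - 1 * a l)"
    using assms unfolding represents_on_def by (intro coh_add coh_mult) auto
  ultimately have "lam y - mu y = 0" using assms(3) by (intro lam_unique_0[of m "\<lambda>y. lam y - mu y"]) auto
  then show ?thesis by simp
qed

text \<open>
  The class of \<open>c \<union> a\<close> is obtained from that of \<open>a\<close> by lifting \<open>lam\<close> to \<open>P m \<rightarrow> kE\<close>, restricting to
  the syzygy and applying the derivation \<open>c : Rad(kE) \<rightarrow> k\<close>.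
\<close>

lemma represents_on_Cons:
  assumes lam: "represents_on m lam a" and c: "additive_map c"
    and lt: "hom_on scale (*) (P m) lt" "\<And>y. y \<in> P m \<Longrightarrow> aug (lt y) = lam y"
  shows "represents_on (Suc m) (\<lambda>y. lin c (lt (d (Suc m) y))) (\<lambda>l. c (hd l) * a (tl l))"
proof -
  have c': "\<And>g h. c (g + h) = c g + c h" using c by (simp add: additive_map_def)
  have lh: "hom_on scale triv_scale (P m) lam" and la: "coh m (\<lambda>l. lam (\<phi> l)) a"
    using lam unfolding represents_on_def by auto
  have "hom_on scale triv_scale (P (Suc m)) (\<lambda>y. lin c (lt (d (Suc m) y)))"
  proof (rule hom_onI)
    fix y z assume "y \<in> P (Suc m)" "z \<in> P (Suc m)"
    then show "lin c (lt (d (Suc m) (y + z))) = lin c (lt (d (Suc m) y)) + lin c (lt (d (Suc m) z))"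
      by (simp add: hom_on_add[OF dhom] hom_on_add[OF lt(1)] dP lin_add)
  next
    fix r y assume y: "y \<in> P (Suc m)"
    \<comment> \<open>Boundaries are killed by lam, so \<open>lt\<close> carries them into the
      augmentation ideal, on which the derivation \<open>lin c\<close> is a homomorphism to the
      trivial module.\<close>
    have "aug (lt (d (Suc m) y)) = 0" using lt(2) dP[OF y] lam_d[OF lh y] by simp
    then show "lin c (lt (d (Suc m) (scale r y))) = triv_scale r (lin c (lt (d (Suc m) y)))"
      using y by (simp add: hom_on_scale[OF dhom] hom_on_scale[OF lt(1)] dP lin_mult[OF c'] triv_scale_def)
  qed
  moreover have "coh (Suc m) (\<lambda>l. lin c (lt (d (Suc m) (\<phi> l)))) (\<lambda>l. c (hd l) * lam (\<phi> (tl l)))"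
  proof -
    \<comment> \<open>The two cochains differ by the coboundary of \<open>lin c\<close> applied to
      \<open>lt\<close> after \<open>\<phi>\<close>. The product c(g) lam is the correction that the
      derivation rule yields for the leading face.\<close>
    have "lin c (lt (d (Suc m) (\<phi> gs))) = c (hd gs) * lam (\<phi> (tl gs)) + cobd (\<lambda>l. lin c (lt (\<phi> l))) gs"
      if l: "length gs = Suc m" for gs
    proof -
      have gs: "gs \<noteq> []" using l by auto
      have P': "\<phi> l \<in> P m" if "Suc (length l) = length gs" for l using that l \<phi>P[of l] by simp
      have "lt (d (Suc m) (\<phi> gs)) = bar_diff (\<lambda>g. (*) (Poly_Mapping.single g 1)) (\<lambda>l. lt (\<phi> l)) gs"
        using d\<phi>[OF gs] bar_diff_hom[OF lt(1) mod Psub P' gs] l by simp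
      also have "lin c \<dots> = lin c (Poly_Mapping.single (hd gs) 1 * lt (\<phi> (tl gs))) +
          (cobd (\<lambda>l. lin c (lt (\<phi> l))) gs - lin c (lt (\<phi> (tl gs))))"
        by (rule bar_diff_additive_map) (rule lin_add)
      also have "lin c (Poly_Mapping.single (hd gs) 1 * lt (\<phi> (tl gs))) = c (hd gs) * lam (\<phi> (tl gs)) + lin c (lt (\<phi> (tl gs)))"
        using lt(2)[OF P', of "tl gs"] l by (simp add: lin_mult[OF c'])
      finally show ?thesis by simp
    qed
    then show ?thesis unfolding coh_def by auto
  qed
  ultimately show ?thesis
    unfolding represents_on_def using coh_trans[OF _ coh_Cons[OF c la]] by blast
qed

lemma lift_to_algebra:
  assumes "hom_on scale triv_scale (P m) lam"
  obtains lt where "hom_on scale (*) (P m) lt" "\<And>y. y \<in> P m \<Longrightarrow> aug (lt y) = lam y"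
proof -
  have "c \<in> range (aug :: ('g \<Rightarrow>\<^sub>0 'k) \<Rightarrow> 'k)" for c using aug_single[of 0 c] by (metis rangeI)
  then have "lam ` P m \<subseteq> (aug :: ('g \<Rightarrow>\<^sub>0 'k) \<Rightarrow> 'k) ` UNIV" by blast
  from projective_lift[OF proj module_mult module.subspace_UNIV[OF module_mult] hom_on_aug assms this]
  show ?thesis using that by blast
qed

lemma represents_on_cprod:
  assumes "\<And>c. c \<in> set cs \<Longrightarrow> additive_map c"
  shows "\<exists>lam. represents_on (length cs) lam (cprod cs)"
  using assms
proof (induction cs)
  case Nil
  then show ?case using \<epsilon>hom \<phi>_Nil unfolding represents_on_def by (intro exI[of _ \<epsilon>]) (simp add: coh_def)
next
  case (Cons c cs)
  then obtain lam where lam: "represents_on (length cs) lam (cprod cs)" by auto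
  then obtain lt where "hom_on scale (*) (P (length cs)) lt" "\<And>y. y \<in> P (length cs) \<Longrightarrow> aug (lt y) = lam y"
    using lift_to_algebra unfolding represents_on_def by metis
  from represents_on_Cons[OF lam _ this, of c] show ?case using Cons.prems by (auto simp: cprod_Cons)
qed

lemma represents_on_coh: "represents_on m lam a \<Longrightarrow> coh m a b \<Longrightarrow> represents_on m lam b"
  unfolding represents_on_def using coh_trans by blast

definition derivation_lift where
  "derivation_lift m c lam0 lam lt \<longleftrightarrow> hom_on scale (*) (P m) lt \<and> (\<forall>y\<in>P m. aug (lt y) = lam0 y) \<and>
    (\<forall>y\<in>P (Suc m). lam y = lin c (lt (d (Suc m) y)))"

lemma derivation_liftD:
  assumes "derivation_lift m c lam0 lam lt"
  shows "hom_on scale (*) (P m) lt" "y \<in> P m \<Longrightarrow> aug (lt y) = lam0 y"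
    "y \<in> P (Suc m) \<Longrightarrow> lam y = lin c (lt (d (Suc m) y))"
  using assms unfolding derivation_lift_def by auto

text \<open>Uniqueness turns the construction around: a homomorphism already known to represent the
  product equals the constructed one pointwise.\<close>

lemma represents_on_Cons_lift:
  assumes "represents_on (Suc m) lam (\<lambda>l. c (hd l) * a (tl l))" "represents_on m lam0 a" "additive_map c"
  shows "\<exists>lt. derivation_lift m c lam0 lam lt"
proof -
  obtain lt where lt: "hom_on scale (*) (P m) lt" "\<And>y. y \<in> P m \<Longrightarrow> aug (lt y) = lam0 y"
    using lift_to_algebra assms(2) unfolding represents_on_def by metis
  have "lam y = lin c (lt (d (Suc m) y))" if "y \<in> P (Suc m)" for y
    using represents_on_unique[OF assms(1) represents_on_Cons[OF assms(2,3) lt] that] by simp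
  then show ?thesis using lt unfolding derivation_lift_def by blast
qed

end

section \<open>Radical ranks of \<open>L\<^sub>\<zeta>\<close>\<close>

lemma homogeneous_system:
  fixes M :: "'i \<Rightarrow> 'j \<Rightarrow> 'k::field"
  assumes "finite J" "finite I" "card J < card I"
  shows "\<exists>\<alpha>. (\<exists>i\<in>I. \<alpha> i \<noteq> 0) \<and> (\<forall>j\<in>J. (\<Sum>i\<in>I. \<alpha> i * M i j) = 0)"
  using assms
proof (induction J arbitrary: I M rule: finite_induct)
  case empty
  then have "I \<noteq> {}" by auto
  then show ?case by (intro exI[of _ "\<lambda>_. 1"]) auto
next
  case (insert j J)
  show ?case
  proof (cases "\<forall>i\<in>I. M i j = 0")
    case True
    then show ?thesis using insert.IH[of I M] insert by auto
  next
    case False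
    then obtain i0 where i0: "i0 \<in> I" "M i0 j \<noteq> 0" by blast
    define I' where "I' = I - {i0}"
    have I': "finite I'" "I = insert i0 I'" "i0 \<notin> I'" using insert i0 unfolding I'_def by auto
    have "card J < card I'" using insert I' by simp
    then obtain \<alpha> where a: "\<exists>i\<in>I'. \<alpha> i \<noteq> 0" "\<forall>k\<in>J. (\<Sum>i\<in>I'. \<alpha> i * (M i k - M i j / M i0 j * M i0 k)) = 0"
      using insert.IH[of I' "\<lambda>i k. M i k - M i j / M i0 j * M i0 k"] I' by blast
    \<comment> \<open>The coefficient of the pivot row is chosen to solve equation \<open>j\<close>;
      the eliminated rows take care of the other equations.\<close>
    define b where "b = - (\<Sum>i\<in>I'. \<alpha> i * M i j) / M i0 j"
    define \<beta> where "\<beta> i = (if i = i0 then b else \<alpha> i)" for i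
    have s: "(\<Sum>i\<in>I. \<beta> i * M i k) = b * M i0 k + (\<Sum>i\<in>I'. \<alpha> i * M i k)" for k
    proof -
      have "(\<Sum>i\<in>I'. \<beta> i * M i k) = (\<Sum>i\<in>I'. \<alpha> i * M i k)"
        using I'(3) by (intro sum.cong) (auto simp: \<beta>_def)
      then show ?thesis using I' by (simp add: \<beta>_def)
    qed
    have "(\<Sum>i\<in>I. \<beta> i * M i j) = 0" unfolding s b_def using i0 by simp
    moreover have "(\<Sum>i\<in>I. \<beta> i * M i k) = 0" if "k \<in> J" for k
    proof -
      have "b * M i0 k = - (\<Sum>i\<in>I'. \<alpha> i * (M i j / M i0 j * M i0 k))"
        unfolding b_def by (simp add: sum_distrib_right sum_divide_distrib mult.assoc)
      then have "(\<Sum>i\<in>I. \<beta> i * M i k) = (\<Sum>i\<in>I'. \<alpha> i * (M i k - M i j / M i0 j * M i0 k))"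
        unfolding s by (simp add: right_diff_distrib sum_subtractf)
      then show ?thesis using a(2) that by simp
    qed
    moreover have "\<exists>i\<in>I. \<beta> i \<noteq> 0"
    proof -
      obtain i where "i \<in> I'" "\<alpha> i \<noteq> 0" using a(1) by blast
      then show ?thesis using I' by (intro bexI[of _ i]) (auto simp: \<beta>_def)
    qed
    ultimately show ?thesis by blast
  qed
qed

context elem_ab_algebra
begin

lemma Rad_sub: "module.subspace ((*) :: ('g \<Rightarrow>\<^sub>0 'k) \<Rightarrow> _) Rad"
  unfolding Rad_eq by (rule module.subspaceI[OF module_mult]) (auto simp: aug_add)

lemma lin_mon:
  assumes y: "basis_of V n y" and c: "additive_map c" and i: "i \<in> {1..n}" "b i \<noteq> 0"
  shows "lin c (mon n y b) = (if \<forall>j\<in>{1..n}. b j = (if j = i then 1 else 0) then lin c (y i) else 0)"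
proof -
  let ?e = "\<lambda>j. if j = i then 1 else (0::nat)" and ?b = "b(i := b i - 1)"
  have "mon n y b = mon n y (\<lambda>j. ?e j + ?b j)" by (rule mon_cong) (use i in auto)
  then have "mon n y b = y i * mon n y ?b" using mon_unit[OF i(1), of y] mon_mult[of n y ?e ?b] by simp
  moreover have "(\<forall>j\<in>{1..n}. ?b j = 0) \<longleftrightarrow> (\<forall>j\<in>{1..n}. b j = (if j = i then 1 else 0))"
    using i by (auto split: if_splits)
  ultimately show ?thesis
    using c basis_of_aug[OF y i(1)] by (simp add: lin_mult additive_map_def aug_mon[OF y])
qed

text \<open>
  A \<open>k[U]\<close>-linear operator on \<open>kE\<close> through which the derivation \<open>c\<close> factors, where \<open>c\<close> vanishes on \<open>U\<close>.
\<close>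

lemma U_linear_operator:
  assumes y: "basis_of V n y" and r: "r \<le> n" and c: "additive_map c" "\<And>u. u \<in> A.span (y ` {1..r}) \<Longrightarrow> lin c u = 0"
  obtains D :: "('g \<Rightarrow>\<^sub>0 'k) \<Rightarrow> ('g \<Rightarrow>\<^sub>0 'k)" where
    "\<And>a b. D (a + b) = D a + D b" "\<And>k a. D (kscale (*) k a) = kscale (*) k (D a)"
    "\<And>u a. u \<in> A.span (y ` {1..r}) \<Longrightarrow> D (u * a) = u * D a"
    "\<And>a. aug (D a) = lin c a"
proof -
  have "\<forall>i\<in>{1..n}. \<exists>T :: ('g \<Rightarrow>\<^sub>0 'k) \<Rightarrow> ('g \<Rightarrow>\<^sub>0 'k).
    Vector_Spaces.linear (kscale (*)) (kscale (*)) T \<and>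
    (\<forall>j a. j \<in> {1..n} \<longrightarrow> j \<noteq> i \<longrightarrow> T (y j * a) = y j * T a) \<and>
    (\<forall>b\<in>expos. aug (T (mon n y b)) = (if \<forall>j\<in>{1..n}. b j = (if j = i then 1 else 0) then 1 else 0))"
    using shift_operator[OF y] by (rule ballI)
  then obtain T :: "nat \<Rightarrow> ('g \<Rightarrow>\<^sub>0 'k) \<Rightarrow> ('g \<Rightarrow>\<^sub>0 'k)" where T:
    "\<And>i. i \<in> {1..n} \<Longrightarrow> Vector_Spaces.linear (kscale (*)) (kscale (*)) (T i)"
    "\<And>i j a. i \<in> {1..n} \<Longrightarrow> j \<in> {1..n} \<Longrightarrow> j \<noteq> i \<Longrightarrow> T i (y j * a) = y j * T i a"
    "\<And>i b. i \<in> {1..n} \<Longrightarrow> b \<in> expos \<Longrightarrow>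
      aug (T i (mon n y b)) = (if \<forall>j\<in>{1..n}. b j = (if j = i then 1 else 0) then 1 else 0)"
    by (subst (asm) bchoice_iff) blast
  let ?I = "{Suc r..n}"
  have I: "i \<in> {1..n}" if "i \<in> ?I" for i using that by auto
  \<comment> \<open>Only shifts in directions beyond \<open>r\<close> occur, so \<open>D\<close>
    commutes with y_1, ..., y_r. Its coefficients reproduce \<open>c\<close> on the linear
    monomials.\<close>
  define D where "D a = (\<Sum>i\<in>?I. kscale (*) (lin c (y i)) (T i a))" for a
  have T_add: "T i (a + b) = T i a + T i b" if "i \<in> ?I" for i a b
    using T(1)[OF I[OF that]] by (simp add: Vector_Spaces.linear_iff)
  have T_scale: "T i (kscale (*) k a) = kscale (*) k (T i a)" if "i \<in> ?I" for i a k
    using T(1)[OF I[OF that]] by (simp add: Vector_Spaces.linear_iff)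
  have D_add: "D (a + b) = D a + D b" for a b
  proof -
    have "D (a + b) = (\<Sum>i\<in>?I. kscale (*) (lin c (y i)) (T i a) + kscale (*) (lin c (y i)) (T i b))"
      unfolding D_def by (intro sum.cong refl) (simp add: T_add A.scale_right_distrib)
    then show ?thesis unfolding D_def by (simp only: sum.distrib)
  qed
  have D_0: "D 0 = 0" using D_add[of 0 0] by simp
  have D_scale: "D (kscale (*) k a) = kscale (*) k (D a)" for a k
    unfolding D_def A.scale_sum_right by (intro sum.cong refl) (simp add: T_scale mult.commute)
  have "D (u * a) = u * D a" if "u \<in> A.span (y ` {1..r})" for u a
    using that
  proof (induction rule: A.span_induct_alt)
    case base
    then show ?case by (simp add: D_0)
  next
    case (step k z w)
    then obtain j where j: "j \<in> {1..r}" "z = y j" by blast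
    have "D (y j * a) = (\<Sum>i\<in>?I. y j * kscale (*) (lin c (y i)) (T i a))"
      unfolding D_def using j r I by (intro sum.cong refl) (auto simp: T(2) kscale_def mult.left_commute)
    then have "D (z * a) = z * D a" unfolding D_def j(2) by (simp add: sum_distrib_left)
    moreover have "(kscale (*) k z + w) * a = kscale (*) k (z * a) + w * a"
      by (simp add: kscale_def distrib_right mult.assoc)
    ultimately show ?case using step by (simp add: D_add D_scale) (simp add: kscale_def distrib_right mult.assoc)
  qed
  moreover have "aug (D a) = lin c a" for a
  proof (induction a rule: A_induct_mon[OF y])
    case 1
    then show ?case by (simp add: D_0)
  next
    case (2 b k a)
    let ?E = "\<lambda>i. \<forall>j\<in>{1..n}. b j = (if j = i then 1 else 0)"
    have D: "aug (D (mon n y b)) = (\<Sum>i\<in>?I. if ?E i then lin c (y i) else 0)"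
      unfolding D_def aug_sum using T(3) I 2(1) by (intro sum.cong) (auto simp: aug_kscale)
    \<comment> \<open>Both sides see only the linear monomials. Those of index at most
      \<open>r\<close> are absent from \<open>D\<close>, and \<open>c\<close> vanishes on
      them.\<close>
    have "aug (D (mon n y b)) = lin c (mon n y b)"
    proof (cases "\<exists>i\<in>{1..n}. b i \<noteq> 0")
      case False
      then have "mon n y b = 1" by (simp add: mon_def)
      moreover have "c 0 = 0" using c(1) unfolding additive_map_def by (metis add_0 add_cancel_right_right)
      then have "lin c 1 = 0" using lin_single[of c 0 1] by simp
      moreover have "\<not> ?E i" if "i \<in> ?I" for i using False I[OF that] by auto
      moreover have "(\<Sum>i\<in>?I. if ?E i then lin c (y i) else 0) = 0"
        using \<open>\<And>i. i \<in> ?I \<Longrightarrow> \<not> ?E i\<close> by (intro sum.neutral ballI if_not_P)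
      ultimately show ?thesis unfolding D by simp
    next
      case True
      then obtain i where i: "i \<in> {1..n}" "b i \<noteq> 0" by blast
      have Ei: "j = i" if "?E j" for j
        using bspec[OF that i(1)] i(2) by (simp split: if_splits)
      then have "(\<Sum>j\<in>?I. if ?E j then lin c (y j) else 0) = (\<Sum>j\<in>?I. if j = i then (if ?E i then lin c (y i) else 0) else 0)"
      proof (intro sum.cong refl)
        fix j
        show "(if ?E j then lin c (y j) else 0) = (if j = i then (if ?E i then lin c (y i) else 0) else 0)"
        proof (cases "j = i")
          case True
          then show ?thesis by (simp only: simp_thms if_True)
        next
          case False
          then have "\<not> ?E j" using Ei by blast
          then show ?thesis using False by (simp only: if_False)
        qed
      qed
      also have "\<dots> = (if ?E i then lin c (y i) else 0)"
      proof (cases "i \<le> r")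
        case True
        then have "lin c (y i) = 0" using i by (intro c(2) A.span_base) auto
        then show ?thesis by simp
      next
        case False
        then show ?thesis using i by simp
      qed
      also have "\<dots> = lin c (mon n y b)" using lin_mon[where b = b and i = i, OF y c(1) i] by simp
      finally show ?thesis unfolding D .
    qed
    then show ?case using 2 by (simp add: D_add D_scale aug_add aug_kscale lin_add lin_kscale)
  qed
  ultimately show ?thesis using that[of D] D_add D_scale by blast
qed

section \<open>Changing the subspace, and relations among classes on it\<close>

lemma change_of_basis_inverse:
  assumes y: "basis_of V n y"
    and \<sigma>: "Vector_Spaces.linear (kscale (*)) (kscale (*)) \<sigma>" "\<And>b. \<sigma> (mon n y b) = (mon n y' b :: 'g \<Rightarrow>\<^sub>0 'k)"
    and \<tau>: "Vector_Spaces.linear (kscale (*)) (kscale (*)) \<tau>" "\<And>b. \<tau> (mon n y' b) = (mon n y b :: 'g \<Rightarrow>\<^sub>0 'k)"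
  shows "\<tau> (\<sigma> a) = a"
proof (induction a rule: A_induct_mon[OF y])
  case 1
  then show ?case using \<sigma>(1) \<tau>(1) by (metis A.scale_zero_left Vector_Spaces.linear_iff)
next
  case (2 b c a)
  then show ?case using \<sigma> \<tau> by (simp add: Vector_Spaces.linear_iff)
qed

lemma image_span_le:
  assumes \<sigma>: "Vector_Spaces.linear (kscale (*)) (kscale (*)) \<sigma>" "\<And>i. i \<in> {1..n} \<Longrightarrow> \<sigma> (y i) = (y' i :: 'g \<Rightarrow>\<^sub>0 'k)"
    and r: "r \<le> n" and u: "u \<in> A.span (y ` {1..r})"
  shows "\<sigma> u \<in> A.span (y' ` {1..r})"
  using u
proof (induction rule: A.span_induct_alt)
  case base
  have "\<sigma> 0 = 0" using \<sigma>(1) by (metis A.scale_zero_left Vector_Spaces.linear_iff)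
  then show ?case by (simp add: A.span_zero)
next
  case (step k z w)
  then obtain i where i: "i \<in> {1..r}" "z = y i" by blast
  have "\<sigma> z = y' i" unfolding i(2) by (rule \<sigma>(2)) (use i(1) r in auto)
  then have "\<sigma> z \<in> A.span (y' ` {1..r})" using i by (auto intro: A.span_base)
  then show ?case using step \<sigma>(1) by (simp add: Vector_Spaces.linear_iff A.span_add A.span_scale)
qed

text \<open>The automorphism of kE carrying one basis to the other preserves both choices of
  \<open>M\<close>. Exchanging the bases gives the reverse inequality.\<close>

lemma dim_Rad_pow_algebra_le:
  assumes y: "basis_of V n y" "basis_of V n y'" and r: "r \<le> n"
    and M: "M = (UNIV :: ('g \<Rightarrow>\<^sub>0 'k) set) \<or> M = Rad"
  shows "A.dim (Rad_pow (*) (A.span (y ` {1..r})) j M) \<le> A.dim (Rad_pow (*) (A.span (y' ` {1..r})) j M)"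
proof -
  obtain \<sigma> where "basis_change y y' \<sigma>" using basis_change_exists[OF y] by blast
  note \<sigma> = basis_changeD[OF this]
  obtain \<tau> where "basis_change y' y \<tau>" using basis_change_exists[OF y(2,1)] by blast
  note \<tau> = basis_changeD[OF this]
  have \<tau>0: "\<tau> 0 = 0" using \<tau>(1) by (metis A.scale_zero_left Vector_Spaces.linear_iff)
  have sM: "module.subspace ((*) :: ('g \<Rightarrow>\<^sub>0 'k) \<Rightarrow> _) M"
    using M Rad_sub module.subspace_UNIV[OF module_mult] by auto
  have im: "\<sigma> ` M \<subseteq> M" using M \<sigma>(4) unfolding Rad_eq by auto
  have hom: "hom_on (kscale (*)) (kscale (*)) S \<sigma>" for S
    using \<sigma>(1) by (auto simp: hom_on_def Vector_Spaces.linear_iff)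
  let ?U = "A.span (y ` {1..r})" and ?U' = "A.span (y' ` {1..r})"
  have img: "\<sigma> ` Rad_pow (*) ?U j M \<subseteq> Rad_pow (*) ?U' j M"
  proof
    fix z assume "z \<in> \<sigma> ` Rad_pow (*) ?U j M"
    then obtain a where a: "z = \<sigma> a" "a \<in> Rad_pow (*) ?U j M" by blast
    show "z \<in> Rad_pow (*) ?U' j M" unfolding a(1)
      by (rule Rad_pow_map[OF module_mult module_mult sM _ _ _ im a(2), of \<sigma>])
        (use \<sigma> image_span_le[OF \<sigma>(1,6) r] in \<open>auto simp: Vector_Spaces.linear_iff\<close>)
  qed
  have "a = 0" if "\<sigma> a = 0" for a
    using change_of_basis_inverse[OF y(1) \<sigma>(1,5) \<tau>(1,5), of a] that \<tau>0 by simp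
  then show ?thesis
    using dim_le_of_inj[OF A.vector_space_axioms A.vector_space_axioms subspace_Rad_pow_k[OF module_mult] hom _ img,
        of "range (\<lambda>g. Poly_Mapping.single g 1)"] A.span_Basis by auto
qed

lemma two_neq_0: "(2::'k) \<noteq> 0"
proof
  assume "(2::'k) = 0"
  then have "of_nat 2 = (0::'k)" by simp
  then have "p dvd 2" using char of_nat_eq_0_iff_char_dvd[of 2, where ?'a = 'k] by simp
  then show False using p2 by (auto dest: dvd_imp_le)
qed

lemma lin_span_zero:
  assumes "\<And>i. i \<in> {1..r} \<Longrightarrow> lin e (y i) = (0::'k)" "u \<in> A.span (y ` {1..r})"
  shows "lin e (u :: 'g \<Rightarrow>\<^sub>0 'k) = 0"
  using assms(2) by (induction rule: A.span_induct_alt) (auto simp: lin_add lin_kscale assms(1))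

text \<open>Evaluating more than \<open>r\<close> classes at \<open>r\<close> vectors gives a
  homogeneous system with a nontrivial solution, that is, a dependency of the classes on the
  span.\<close>

lemma cprod_vanishing:
  fixes y :: "nat \<Rightarrow> 'g \<Rightarrow>\<^sub>0 'k" and c :: "nat \<Rightarrow> 'g \<Rightarrow> 'k"
  assumes "r < length is" "distinct is" "\<And>i. i \<in> set is \<Longrightarrow> additive_map (c i)"
  shows "\<exists>c' cs. additive_map c' \<and> (\<forall>e\<in>set cs. additive_map e) \<and> length is = Suc (length cs) \<and>
    (\<forall>u\<in>A.span (y ` {1..r}). lin c' u = 0) \<and> coh (length is) (cprod (map c is)) (cprod (c' # cs))"
proof -
  obtain \<alpha> where a: "\<exists>i\<in>set is. \<alpha> i \<noteq> 0" "\<forall>j\<in>{1..r}. (\<Sum>i\<in>set is. \<alpha> i * lin (c i) (y j)) = 0"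
    using homogeneous_system[of "{1..r}" "set is" "\<lambda>i j. lin (c i) (y j)"] assms(1)
    by (auto simp: distinct_card[OF assms(2)])
  have "(\<Sum>i\<in>set is. \<alpha> i * lin (c i) u) = 0" if "u \<in> A.span (y ` {1..r})" for u
  proof -
    have "lin (\<lambda>g. \<Sum>i\<in>set is. \<alpha> i * c i g) u = 0"
      by (rule lin_span_zero[OF _ that]) (subst lin_sum_fun, use a(2) in blast)
    then show ?thesis unfolding lin_sum_fun .
  qed
  then show ?thesis by (intro cprod_dependent[OF two_neq_0 assms(2) _ a(1)] assms(3))
qed

text \<open>Since kE is k plus its radical, only the scalar part of the last factor survives modulo
  Rad_U^j(Rad).\<close>

lemma Rad_pow_algebra_decomp:
  assumes "a \<in> Rad_pow (*) U j UNIV"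
  shows "\<exists>a1 a2. a = a1 + a2 \<and> a1 \<in> A.span {prod_list us |us. length us = j \<and> set us \<subseteq> U} \<and> (a2 :: 'g \<Rightarrow>\<^sub>0 'k) \<in> Rad_pow (*) U j Rad"
  using assms module_mult A.subspace_UNIV
proof (induction rule: Rad_pow_induct)
  case zero
  then show ?case using A.span_zero Rad_pow_0[OF module_mult] by (intro exI[of _ 0]) auto
next
  case (step us m z)
  let ?S = "A.span {prod_list us |us. length us = j \<and> set us \<subseteq> U}"
  obtain b1 b2 where b: "z = b1 + b2" "b1 \<in> ?S" "b2 \<in> Rad_pow (*) U j Rad" using step by blast
  let ?m = "Poly_Mapping.single 0 (aug m)"
  have "m - ?m \<in> Rad" unfolding Rad_eq by (simp add: aug_diff)
  then have "prod_list us * (m - ?m) \<in> Rad_pow (*) U j Rad"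
    using Rad_pow_gen[OF module_mult step(1,2)] by blast
  then have "prod_list us * (m - ?m) + b2 \<in> Rad_pow (*) U j Rad" using b by (intro Rad_pow_add[OF module_mult])
  moreover have "kscale (*) (aug m) (prod_list us) + b1 \<in> ?S"
    by (rule A.span_add[OF A.span_scale[OF A.span_base] b(2)]) (use step(1,2) in blast)
  moreover have "prod_list us * m + z = (kscale (*) (aug m) (prod_list us) + b1) + (prod_list us * (m - ?m) + b2)"
    unfolding b(1) by (simp add: kscale_def algebra_simps)
  ultimately show ?case by blast
qed

end

context ea_res
begin

lemma Omega_P: "w \<in> Omega P d (Suc m) \<Longrightarrow> w \<in> P m"
  unfolding Omega_def using dP by auto

lemma Omega_sub: "subspace (Omega P d (Suc m))"
  unfolding Omega_def by (rule subspace_image[OF dhom mod Psub mod])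

text \<open>Restricting scalars along an automorphism keeps \<open>P\<close> acyclic, so
  \<open>comparison\<close> yields a semilinear \<open>\<alpha>\<close> from \<open>P\<close> to
  itself. With \<open>\<beta>\<close> for the inverse automorphism, the composite is a kE-linear
  lift of the identity, injective by minimality; hence \<open>\<alpha>\<close> is injective.\<close>

lemma dim_Rad_pow_Omega_le:
  assumes y: "basis_of V n y" "basis_of V n y'" and r: "r \<le> n"
  shows "k.dim (Rad_pow scale (A.span (y ` {1..r})) j (Omega P d (Suc m)))
    \<le> k.dim (Rad_pow scale (A.span (y' ` {1..r})) j (Omega P d (Suc m)))"
proof -
  obtain \<sigma> where "basis_change y y' \<sigma>" using basis_change_exists[OF y] by blast
  note \<sigma> = basis_changeD[OF this]
  obtain \<tau> where "basis_change y' y \<tau>" using basis_change_exists[OF y(2,1)] by blast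
  note \<tau> = basis_changeD[OF this]
  have \<tau>\<sigma>: "\<tau> (\<sigma> a) = a" for a by (rule change_of_basis_inverse[OF y(1) \<sigma>(1,5) \<tau>(1,5)])
  have twist: "\<exists>\<alpha>. comparison_map (\<lambda>a. scale (\<rho> a)) P d \<epsilon> \<alpha>"
    if \<rho>: "Vector_Spaces.linear (kscale (*)) (kscale (*)) \<rho>" "\<And>a b. \<rho> (a * b) = \<rho> a * \<rho> b" "\<rho> 1 = 1"
      "\<And>a. aug (\<rho> a) = aug a" for \<rho> :: "('g \<Rightarrow>\<^sub>0 'k) \<Rightarrow> ('g \<Rightarrow>\<^sub>0 'k)"
  proof (rule comparison)
    have add: "\<rho> (a + b) = \<rho> a + \<rho> b" for a b using \<rho>(1) by (simp add: Vector_Spaces.linear_iff)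
    show m2: "module (\<lambda>a. scale (\<rho> a))"
      by unfold_locales (simp_all add: scale_right_distrib scale_left_distrib add \<rho>)
    show "acyclic_complex (\<lambda>a. scale (\<rho> a)) triv_scale P d \<epsilon>"
      unfolding acyclic_complex_def
    proof (intro conjI allI)
      fix i
      show "module.subspace (\<lambda>a. scale (\<rho> a)) (P i)"
        by (rule module.subspaceI[OF m2]) (auto intro: P_closed)
      show "hom_on (\<lambda>a. scale (\<rho> a)) (\<lambda>a. scale (\<rho> a)) (P (Suc i)) (d (Suc i))"
        using dhom[of i] by (auto simp: hom_on_def)
      show "hom_on (\<lambda>a. scale (\<rho> a)) triv_scale (P 0) \<epsilon>"
        using \<epsilon>hom \<rho>(4) by (auto simp: hom_on_def triv_scale_def)
      show "d (Suc i) ` P (Suc i) \<subseteq> P i" using dP by blast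
      show "\<epsilon> ` P 0 = UNIV" by (rule \<epsilon>surj)
      show "{z \<in> P 0. \<epsilon> z = 0} \<subseteq> d (Suc 0) ` P (Suc 0)" by (simp add: ex0)
      show "{z \<in> P (Suc i). d (Suc i) z = 0} \<subseteq> d (Suc (Suc i)) ` P (Suc (Suc i))" by (simp add: exS)
    qed
  qed
  obtain \<alpha> where "comparison_map (\<lambda>a. scale (\<sigma> a)) P d \<epsilon> \<alpha>" using twist[OF \<sigma>(1-4)] by (rule exE)
  note \<alpha> = comparison_mapD[OF this]
  obtain \<beta> where "comparison_map (\<lambda>a. scale (\<tau> a)) P d \<epsilon> \<beta>" using twist[OF \<tau>(1-4)] by (rule exE)
  note \<beta> = comparison_mapD[OF this]
  have T: "chain_endo (\<lambda>i z. \<beta> i (\<alpha> i z))"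
    unfolding chain_endo_def
  proof (intro allI conjI ballI)
    fix i
    show "hom_on scale scale (P i) (\<lambda>z. \<beta> i (\<alpha> i z))"
      by (rule hom_onI)
        (simp_all add: hom_on_add[OF \<alpha>(1)] hom_on_add[OF \<beta>(1)] hom_on_scale[OF \<alpha>(1)] hom_on_scale[OF \<beta>(1)] \<alpha>(2) \<tau>\<sigma>)
    show "(\<lambda>z. \<beta> i (\<alpha> i z)) ` P i \<subseteq> P i" using \<alpha>(2) \<beta>(2) by blast
    show "d (Suc i) (\<beta> (Suc i) (\<alpha> (Suc i) z)) = \<beta> i (\<alpha> i (d (Suc i) z))" if "z \<in> P (Suc i)" for z
      using that \<alpha> \<beta> by simp
  qed
  obtain N where N: "\<And>i. Rad_pow scale Rad N (P i) = {0}"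
    using Rad_pow_nilpotent[where ?'m = 'm] mod by blast
  have \<beta>0: "\<beta> i 0 = 0" for i
    using hom_on_add[OF \<beta>(1) P_closed(1) P_closed(1)] by simp
  have inj: "z = 0" if "z \<in> P m" "\<alpha> m z = 0" for z
    by (rule chain_endo_inj[OF N T _ that(1)]) (simp_all add: \<alpha> \<beta> \<beta>0 that)
  let ?\<Omega> = "Omega P d (Suc m)"
  let ?R = "Rad_pow scale (A.span (y ` {1..r})) j ?\<Omega>" and ?R' = "Rad_pow scale (A.span (y' ` {1..r})) j ?\<Omega>"
  have im: "\<alpha> m ` ?\<Omega> \<subseteq> ?\<Omega>"
    unfolding Omega_def
  proof (rule image_subsetI)
    fix w assume "w \<in> d (Suc m) ` P (Suc m)"
    then obtain z where "w = d (Suc m) z" "z \<in> P (Suc m)" by blast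
    then have "\<alpha> m w = d (Suc m) (\<alpha> (Suc m) z)" "\<alpha> (Suc m) z \<in> P (Suc m)" using \<alpha> by auto
    then show "\<alpha> m w \<in> d (Suc m) ` P (Suc m)" by blast
  qed
  have RO: "?R \<subseteq> ?\<Omega>" "?R' \<subseteq> ?\<Omega>" by (rule Rad_pow_subset[OF mod Omega_sub])+
  have img: "\<alpha> m ` ?R \<subseteq> ?R'"
  proof
    fix w assume "w \<in> \<alpha> m ` ?R"
    then obtain z where z: "w = \<alpha> m z" "z \<in> ?R" by blast
    show "w \<in> ?R'" unfolding z(1)
      by (rule Rad_pow_map[OF mod mod Omega_sub _ _ _ im z(2), of \<sigma>])
        (use image_span_le[OF \<sigma>(1,6) r] Omega_P in \<open>auto simp: hom_on_add[OF \<alpha>(1)] hom_on_scale[OF \<alpha>(1)]\<close>)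
  qed
  \<comment> \<open>The automorphism fixes scalars, so the semilinear map is k-linear and can be
    used to compare dimensions.\<close>
  have \<sigma>k: "\<sigma> (Poly_Mapping.single 0 c) = Poly_Mapping.single 0 c" for c
  proof -
    have "Poly_Mapping.single 0 c = kscale (*) c (1 :: 'g \<Rightarrow>\<^sub>0 'k)" by (simp add: kscale_def)
    then show ?thesis using \<sigma>(1,3) by (simp add: Vector_Spaces.linear_iff)
  qed
  have hom: "hom_on (kscale scale) (kscale scale) ?R (\<alpha> m)"
    by (rule hom_onI) (use RO Omega_P in \<open>auto simp: hom_on_add[OF \<alpha>(1)] hom_on_scale[OF \<alpha>(1)] kscale_def \<sigma>k subset_iff\<close>)
  obtain W where W: "finite W" "P m \<subseteq> k.span W" using P_finite_dim by blast
  have RW: "?R' \<subseteq> k.span W" using RO(2) Omega_P W(2) by blast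
  have inj': "z = 0" if "z \<in> ?R" "\<alpha> m z = 0" for z using that RO Omega_P inj by blast
  show ?thesis
    using dim_le_of_inj[OF k.vector_space_axioms k.vector_space_axioms subspace_Rad_pow_k[OF mod] hom inj' img RW W(1)]
    by (rule conjunct2)
qed

end

section \<open>The kernel that decides constancy of ranks\<close>

locale L_data = ea_res p n V x scale P d \<epsilon> \<phi>
  for p n :: nat and V :: "('g::{finite, ab_group_add} \<Rightarrow>\<^sub>0 'k::field) set" and x :: "nat \<Rightarrow> 'g \<Rightarrow>\<^sub>0 'k"
    and scale :: "('g \<Rightarrow>\<^sub>0 'k) \<Rightarrow> 'm::ab_group_add \<Rightarrow> 'm" and P d \<epsilon> \<phi> +
  fixes c :: "nat \<Rightarrow> 'g \<Rightarrow> 'k" and m :: nat and f :: "'m \<Rightarrow> 'k"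
  assumes c_add: "\<And>i. i \<in> {1..n} \<Longrightarrow> additive_map (c i)"
    and c_dual: "\<And>i j. i \<in> {1..n} \<Longrightarrow> j \<in> {1..n} \<Longrightarrow> lin (c i) (x j) = (if i = j then 1 else 0)"
    and mn: "Suc m < n"
    and fhom: "hom_on scale triv_scale (Omega P d (Suc m)) f"
    and frep: "coh (Suc m) (\<lambda>gs. f (d (Suc m) (\<phi> gs))) (cprod (map c [1..<Suc (Suc m)]))"
begin

text \<open>The degree s is written \<open>Suc m\<close> because the Heller shift of that degree is
  a submodule of \<open>P m\<close>.\<close>

abbreviation Om :: "'m set" where "Om \<equiv> Omega P d (Suc m)"

definition L :: "'m set" where "L = {w \<in> Om. f w = 0}"

definition lam :: "'m \<Rightarrow> 'k" where "lam y = f (d (Suc m) y)"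

lemma lam_rep: "represents_on (Suc m) lam (cprod (map c [1..<Suc (Suc m)]))"
  unfolding represents_on_def lam_def
  using frep hom_on_comp[OF dhom fhom, of m] unfolding Omega_def by auto

lemma L_sub: "subspace L"
  unfolding L_def by (rule subspace_kernel[OF fhom mod Omega_sub module_triv_scale])

lemma L_Om: "L \<subseteq> Om"
  unfolding L_def by blast

text \<open>The kernel of the map from Rad_U^j(kE) to Rad_U^j(Omega) / Rad_U^j(L) that sends a to a
  w.\<close>

definition Kset :: "'m \<Rightarrow> ('g \<Rightarrow>\<^sub>0 'k) set \<Rightarrow> nat \<Rightarrow> ('g \<Rightarrow>\<^sub>0 'k) set"
  where "Kset w U j = {a \<in> Rad_pow (*) U j UNIV. scale a w \<in> Rad_pow scale U j L}"

text \<open>Injectivity of the induced map on Rad_U^j(kE) / Rad_U^j(Rad); the reverse inclusion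
  holds for every w in \<open>Om\<close>.\<close>

definition full :: "'m \<Rightarrow> ('g \<Rightarrow>\<^sub>0 'k) set \<Rightarrow> nat \<Rightarrow> bool"
  where "full w U j \<longleftrightarrow> Kset w U j \<subseteq> Rad_pow (*) U j Rad"

lemma f_scale: "w \<in> Om \<Longrightarrow> f (scale a w) = aug a * f w"
  by (simp add: hom_on_scale[OF fhom] triv_scale_def)

lemma scale_w_Rad:
  assumes w: "w \<in> Om" and a: "a \<in> Rad_pow (*) U j Rad"
  shows "scale a w \<in> Rad_pow scale U j L"
proof (rule Rad_pow_hom[OF module_mult mod Rad_sub _ _ a])
  show "hom_on (*) scale Rad (\<lambda>a. scale a w)" by (rule hom_onI) (simp_all add: scale_left_distrib)
  show "(\<lambda>a. scale a w) ` Rad \<subseteq> L"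
    unfolding L_def Rad_eq using w subspace_scale[OF Omega_sub w] by (auto simp: f_scale)
qed

lemma Rad_sub_Kset: "w \<in> Om \<Longrightarrow> Rad_pow (*) U j Rad \<subseteq> Kset w U j"
  unfolding Kset_def using scale_w_Rad Rad_pow_mono[OF module_mult, of U U Rad UNIV j] by auto

text \<open>\<open>Om\<close> is \<open>L\<close> plus the line through w, so Rad_U^j(Om) is
  Rad_U^j(kE) w plus Rad_U^j(L), and \<open>dim_sum_preimage\<close> counts dimensions.\<close>

lemma dim_Kset:
  assumes w: "w \<in> Om" "f w = 1"
  shows "k.dim (Rad_pow scale U j Om) + A.dim (Kset w U j)
    = A.dim (Rad_pow (*) U j UNIV) + k.dim (Rad_pow scale U j L)"
proof -
  obtain W where W: "finite W" "P m \<subseteq> k.span W" using P_finite_dim by blast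
  have lin: "Vector_Spaces.linear (kscale (*)) (kscale scale) (\<lambda>a. scale a w)"
    by (auto simp: Vector_Spaces.linear_iff scale_left_distrib kscale_def A.vector_space_axioms k.vector_space_axioms)
  have RW: "Rad_pow scale U j L \<subseteq> k.span W"
    using Rad_pow_subset[OF mod L_sub] L_Om Omega_P W(2) by blast
  let ?X = "Rad_pow (*) U j UNIV" and ?Y = "Rad_pow scale U j L"
  have "{scale a w + z |a z. a \<in> ?X \<and> z \<in> ?Y} = Rad_pow scale U j Om" (is "?Z = ?R")
  proof
    show "?Z \<subseteq> ?R"
    proof
      fix v assume "v \<in> ?Z"
      then obtain a z where v: "v = scale a w + z" "a \<in> ?X" "z \<in> ?Y" by blast
      have "scale a w \<in> ?R"
        by (rule Rad_pow_hom[OF module_mult mod module.subspace_UNIV[OF module_mult] _ _ v(2)])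
          (auto intro!: hom_onI simp: scale_left_distrib subspace_scale[OF Omega_sub w(1)])
      moreover have "z \<in> ?R" using v(3) Rad_pow_mono[OF mod subset_refl L_Om] by blast
      ultimately show "v \<in> ?R" unfolding v(1) by (rule Rad_pow_add[OF mod])
    qed
    show "?R \<subseteq> ?Z"
    proof
      fix v assume "v \<in> ?R"
      then show "v \<in> ?Z" using mod subspace_kscale[OF mod Omega_sub]
      proof (induction rule: Rad_pow_induct)
        case zero
        have "0 = scale 0 w + 0 \<and> 0 \<in> ?X \<and> 0 \<in> ?Y" using Rad_pow_0[OF mod] Rad_pow_0[OF module_mult] by simp
        then show ?case by blast
      next
        case (step us v z)
        then obtain a b where ab: "z = scale a w + b" "a \<in> ?X" "b \<in> ?Y" by blast
        let ?c = "Poly_Mapping.single 0 (f v) :: 'g \<Rightarrow>\<^sub>0 'k"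
        define l where "l = v - scale ?c w"
        have cw: "scale ?c w \<in> Om" using subspace_scale[OF Omega_sub w(1)] .
        have "l \<in> L" unfolding L_def l_def
          using step(3) cw subspace_diff[OF Omega_sub step(3) cw] hom_on_diff[OF fhom mod Omega_sub step(3) cw] w
          by (simp add: f_scale)
        then have "scale (prod_list us) l \<in> ?Y" by (intro Rad_pow_gen[OF mod step(1,2)])
        then have "scale (prod_list us) l + b \<in> ?Y" by (rule Rad_pow_add[OF mod _ ab(3)])
        moreover have "prod_list us * ?c + a \<in> ?X"
          by (rule Rad_pow_add[OF module_mult Rad_pow_gen[OF module_mult step(1,2)] ab(2)]) simp
        moreover have "scale (prod_list us) v + z = scale (prod_list us * ?c + a) w + (scale (prod_list us) l + b)"
          unfolding ab(1) l_def by (simp add: scale_left_distrib scale_right_diff_distrib)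
        ultimately show ?case by blast
      qed
    qed
  qed
  moreover have XW: "?X \<subseteq> A.span (range (\<lambda>g::'g. Poly_Mapping.single g (1::'k)))" "finite (range (\<lambda>g::'g. Poly_Mapping.single g (1::'k)))"
    by (simp_all add: A.span_Basis)
  ultimately show ?thesis
    using dim_sum_preimage[OF A.vector_space_axioms k.vector_space_axioms lin subspace_Rad_pow_k[OF module_mult] XW
        subspace_Rad_pow_k[OF mod] RW W(1)]
    unfolding Kset_def by simp
qed

text \<open>By \<open>dim_Kset\<close> the dimensions for \<open>L\<close> and for
  \<open>Kset\<close> differ by a number depending on r and j only. The same holds for the dimension
  of Rad_U^j(Rad), which \<open>Kset\<close> always contains, so equal ranks mean that the second
  containment is an equality as well.\<close>

lemma dim_L_compare:
  assumes y: "basis_of V n y" "basis_of V n y'" and r: "r \<le> n" and U: "U = A.span (y ` {1..r})" "U' = A.span (y' ` {1..r})"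
    and w: "w \<in> Om" "f w = 1" "w' \<in> Om" "f w' = 1" and full: "full w U j"
  shows "k.dim (Rad_pow scale U j L) = k.dim (Rad_pow scale U' j L) \<longleftrightarrow> full w' U' j"
proof -
  have 1: "k.dim (Rad_pow scale U j Om) = k.dim (Rad_pow scale U' j Om)"
    unfolding U by (intro antisym dim_Rad_pow_Omega_le y r)
  have 2: "A.dim (Rad_pow (*) U j M) = A.dim (Rad_pow (*) U' j M)"
    if "M = (UNIV :: ('g \<Rightarrow>\<^sub>0 'k) set) \<or> M = Rad" for M
    unfolding U by (intro antisym dim_Rad_pow_algebra_le y r that)
  have K: "Kset w U j = Rad_pow (*) U j Rad" using full Rad_sub_Kset[OF w(1)] unfolding full_def by blast
  note e = dim_Kset[OF w(1,2), of U j] dim_Kset[OF w(3,4), of U' j]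
  show ?thesis
  proof (cases "full w' U' j")
    case True
    then have "Kset w' U' j = Rad_pow (*) U' j Rad" using Rad_sub_Kset[OF w(3)] unfolding full_def by blast
    then show ?thesis using e K 1 2[of UNIV] 2[of Rad] True by simp
  next
    case False
    then have "Rad_pow (*) U' j Rad \<subset> Kset w' U' j" using Rad_sub_Kset[OF w(3)] unfolding full_def by blast
    then have "A.dim (Rad_pow (*) U' j Rad) < A.dim (Kset w' U' j)"
      by (rule dim_psubset_fin[OF A.vector_space_axioms _ subspace_Rad_pow_k[OF module_mult], of _ _ _ _ "range (\<lambda>g. Poly_Mapping.single g 1)"])
        (simp_all add: A.span_Basis)
    then show ?thesis using e K 1 2[of UNIV] 2[of Rad] False by simp
  qed
qed

text \<open>The k[U]-linear map is \<open>D\<close> after \<open>lt\<close>. On Omega its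
  augmentation is f, since an element d y has f (d y) = lam y = lin c' (lt (d y)).\<close>

lemma full_of_vanishing:
  assumes y: "basis_of V n y" and r: "r \<le> n" and U: "U = A.span (y ` {1..r})"
    and c': "additive_map c'" "\<And>u. u \<in> U \<Longrightarrow> lin c' u = 0"
    and lt: "hom_on scale (*) (P m) lt" "\<And>y. y \<in> P (Suc m) \<Longrightarrow> lam y = lin c' (lt (d (Suc m) y))"
    and w: "w \<in> Om" "f w = 1"
  shows "full w U j"
  unfolding full_def
proof
  obtain D :: "('g \<Rightarrow>\<^sub>0 'k) \<Rightarrow> ('g \<Rightarrow>\<^sub>0 'k)" where D: "\<And>a b. D (a + b) = D a + D b" "\<And>k a. D (kscale (*) k a) = kscale (*) k (D a)"
    "\<And>u a. u \<in> U \<Longrightarrow> D (u * a) = u * D a" "\<And>a. aug (D a) = lin c' a"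
    by (rule U_linear_operator[OF y r c'(1)]) (use c'(2) U in auto)
  define g where "g z = D (lt z)" for z
  have g_add: "g (z + z') = g z + g z'" if "z \<in> P m" "z' \<in> P m" for z z'
    unfolding g_def using that by (simp add: hom_on_add[OF lt(1)] D)
  have g_U: "g (scale u z) = u * g z" if "u \<in> U" "z \<in> P m" for u z
    unfolding g_def using that by (simp add: hom_on_scale[OF lt(1)] D)
  have g0: "g 0 = 0" using g_add[OF P_closed(1) P_closed(1)] by simp
  have g_aug: "aug (g z) = f z" if z: "z \<in> Om" for z
  proof -
    obtain y where y: "y \<in> P (Suc m)" "z = d (Suc m) y" using z unfolding Omega_def by blast
    then show ?thesis using lt(2)[OF y(1)] by (simp add: g_def D lam_def)
  qed
  fix a assume "a \<in> Kset w U j"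
  then have a: "a \<in> Rad_pow (*) U j UNIV" "scale a w \<in> Rad_pow scale U j L" unfolding Kset_def by auto
  \<comment> \<open>Multiplication by \<open>a1\<close>, a combination of products from
    \<open>U\<close>, passes through \<open>g\<close>; multiplication by a general \<open>a\<close>
    need not.\<close>
  obtain a1 a2 where a12: "a = a1 + a2" "a1 \<in> A.span {prod_list us |us. length us = j \<and> set us \<subseteq> U}"
    "a2 \<in> Rad_pow (*) U j Rad" using Rad_pow_algebra_decomp[OF a(1)] by blast
  have g_prod: "g (scale (prod_list us) z) = prod_list us * g z" if "set us \<subseteq> U" "z \<in> P m" for us z
    using that
  proof (induction us)
    case (Cons u us)
    have "g (scale (prod_list (u # us)) z) = g (scale u (scale (prod_list us) z))" by simp
    also have "\<dots> = u * g (scale (prod_list us) z)" using Cons P_closed(3) by (intro g_U) auto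
    finally show ?case using Cons by (simp add: mult.assoc)
  qed simp
  have g_a1: "g (scale a1 z) = a1 * g z" if z: "z \<in> P m" for z
    using a12(2)
  proof (induction rule: A.span_induct_alt)
    case base
    then show ?case by (simp add: g0)
  next
    case (step k q b)
    then obtain us where us: "q = prod_list us" "set us \<subseteq> U" by blast
    have "scale (kscale (*) k q + b) z = scale q (scale (Poly_Mapping.single 0 k) z) + scale b z"
      by (simp add: kscale_def scale_left_distrib mult.commute)
    moreover have kz: "scale (Poly_Mapping.single 0 k) z \<in> P m" using z P_closed(3) by blast
    moreover have "g (scale q (scale (Poly_Mapping.single 0 k) z)) = kscale (*) k q * g z"
    proof -
      have "scale q (scale (Poly_Mapping.single 0 k) z) = scale (prod_list us) (scale (Poly_Mapping.single 0 k) z)" using us by simp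
      also have "g \<dots> = q * g (scale (Poly_Mapping.single 0 k) z)" using g_prod[OF us(2) kz] us(1) by simp
      also have "g (scale (Poly_Mapping.single 0 k) z) = kscale (*) k (g z)"
        unfolding g_def D(2)[symmetric] using z by (simp add: hom_on_scale[OF lt(1)] kscale_def)
      finally show ?thesis by (simp add: kscale_def mult.assoc mult.left_commute)
    qed
    ultimately show ?case using step P_closed(3) z by (simp add: g_add distrib_right)
  qed
  have Lg: "g ` L \<subseteq> Rad" unfolding Rad_eq L_def using g_aug by auto
  have LP: "z \<in> P m" if "z \<in> L" for z using that L_Om Omega_P by blast
  have "scale a1 w = scale a w - scale a2 w" unfolding a12(1) by (simp add: scale_left_distrib)
  then have "scale a1 w \<in> Rad_pow scale U j L"
    using Rad_pow_diff[OF mod a(2) scale_w_Rad[OF w(1) a12(3)]] by simp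
  then have "g (scale a1 w) \<in> Rad_pow (*) U j Rad"
    by (rule Rad_pow_map[OF mod module_mult L_sub _ _ _ Lg, of U "\<lambda>u. u", rotated -1])
      (use LP g_add g_U in auto)
  then have "a1 * g w \<in> Rad_pow (*) U j Rad" using g_a1[OF Omega_P[OF w(1)]] by simp
  moreover obtain b where "g w * b = 1" using unit[of "g w"] g_aug[OF w(1)] w(2) by auto
  then have "a1 = b * (a1 * g w)" by (metis mult.commute mult.left_commute mult.right_neutral)
  ultimately have "a1 \<in> Rad_pow (*) U j Rad" using Rad_pow_scale[OF module_mult Rad_sub] by metis
  then show "a \<in> Rad_pow (*) U j Rad" unfolding a12(1) using a12(3) by (intro Rad_pow_add[OF module_mult])
qed

lemma s_pos: "{1..Suc m} \<subseteq> {1..n}"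
  using mn by auto

lemma c_cprod: "e \<in> set (map c [1..<Suc (Suc m)]) \<Longrightarrow> additive_map e"
  using c_add mn by auto

lemma full_of_dependent:
  assumes y: "basis_of V n y" and r: "r \<le> n" and U: "U = A.span (y ` {1..r})"
    and c': "additive_map c'" "\<And>u. u \<in> U \<Longrightarrow> lin c' u = 0" and cs: "\<forall>e\<in>set cs. additive_map e" "length cs = m"
    and coh: "coh (Suc m) (cprod (map c [1..<Suc (Suc m)])) (cprod (c' # cs))"
    and w: "w \<in> Om" "f w = 1"
  shows "full w U j"
proof -
  obtain lam0 where lam0: "represents_on m lam0 (cprod cs)"
    using represents_on_cprod[of cs] cs by auto
  have "represents_on (Suc m) lam (\<lambda>l. c' (hd l) * cprod cs (tl l))"
    using represents_on_coh[OF lam_rep coh] by (simp add: cprod_Cons)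
  then obtain lt where "derivation_lift m c' lam0 lam lt"
    using represents_on_Cons_lift[OF _ lam0 c'(1)] by blast
  from derivation_liftD(1,3)[OF this]
  show ?thesis using full_of_vanishing[OF y r U c' _ _ w] by blast
qed

lemma full_small:
  assumes y: "basis_of V n y" and r: "r < Suc m" and w: "w \<in> Om" "f w = 1"
  shows "full w (A.span (y ` {1..r})) j"
proof -
  let ?is = "[1..<Suc (Suc m)]"
  obtain c' cs where "additive_map c'" "\<forall>e\<in>set cs. additive_map e" "length ?is = Suc (length cs)"
    "\<forall>u\<in>A.span (y ` {1..r}). lin c' u = 0" "coh (length ?is) (cprod (map c ?is)) (cprod (c' # cs))"
    using cprod_vanishing[of r ?is c y] r c_add mn by (auto simp del: upt_Suc)
  then show ?thesis
    using r mn by (intro full_of_dependent[OF y _ refl _ _ _ _ _ w, of r c' cs]) (auto simp del: upt_Suc cprod.simps)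
qed

lemma lin_prod_Rad:
  assumes "additive_map e" "aug u = 0"
  shows "lin e (u * b) = lin e u * aug b"
  using assms by (simp add: lin_mult additive_map_def)

lemma V_eq_0:
  assumes v: "v \<in> V" "\<And>i. i \<in> {1..n} \<Longrightarrow> lin (c i) v = 0"
  shows "v = 0"
proof -
  have "v \<in> A.span (x ` {1..n})" using v(1) bas unfolding basis_of_def by simp
  then obtain k where k: "v = (\<Sum>b\<in>x ` {1..n}. kscale (*) (k b) b)" using A.span_finite[of "x ` {1..n}"] by auto
  have inj: "inj_on x {1..n}" using bas unfolding basis_of_def by simp
  have v': "v = (\<Sum>j\<in>{1..n}. kscale (*) (k (x j)) (x j))" unfolding k by (simp add: sum.reindex[OF inj] del: One_nat_def)
  have "k (x i) = 0" if i: "i \<in> {1..n}" for i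
  proof -
    have "lin (c i) v = (\<Sum>j\<in>{1..n}. if j = i then k (x i) else 0)"
      unfolding v' lin_sum by (intro sum.cong refl) (use i c_dual in \<open>auto simp: lin_kscale\<close>)
    then show ?thesis using v(2)[OF i] i by simp
  qed
  then show ?thesis unfolding v' by simp
qed

lemma Rad_pow_1:
  assumes U: "A.subspace U" and s: "s = 1"
  shows "A.span {prod_list us |us :: ('g \<Rightarrow>\<^sub>0 'k) list. length us = s \<and> set us \<subseteq> U} \<subseteq> U"
  using U unfolding s by (intro A.span_minimal) (auto simp: length_Suc_conv)

text \<open>
  For \<open>u \<in> U\<close> with \<open>u w \<in> Rad\<^sub>U(L)\<close> and any one-dimensional class \<open>e\<close>, evaluating the product of \<open>e\<close> and
  \<open>\<eta>\<^sub>1 \<cdots> \<eta>\<^sub>s\<close> on the resulting relation gives \<open>e(u)\<close>; but this product of \<open>s + 1\<close> classes vanishes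
  on the \<open>s\<close>-dimensional space \<open>U\<close>.
\<close>

lemma full_rank_one:
  assumes y: "basis_of V n y" and w: "w \<in> Om" "f w = 1"
  shows "full w (A.span (y ` {1..Suc m})) 1"
  unfolding full_def
proof
  let ?U = "A.span (y ` {1..Suc m})"
  have UV: "?U \<subseteq> V"
  proof -
    have "?U \<subseteq> A.span (y ` {1..n})" using s_pos by (intro A.span_mono) auto
    then show ?thesis using y unfolding basis_of_def by simp
  qed
  fix a assume "a \<in> Kset w ?U 1"
  then have a: "a \<in> Rad_pow (*) ?U 1 UNIV" "scale a w \<in> Rad_pow scale ?U 1 L" unfolding Kset_def by auto
  obtain u a2 where u: "a = u + a2" "u \<in> A.span {prod_list us |us. length us = 1 \<and> set us \<subseteq> ?U}"
    "a2 \<in> Rad_pow (*) ?U 1 Rad" using Rad_pow_algebra_decomp[OF a(1)] by blast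
  have uU: "u \<in> ?U" using u(2) Rad_pow_1[of ?U 1] by auto
  have uw: "scale u w \<in> Rad_pow scale ?U 1 L"
    using Rad_pow_diff[OF mod a(2) scale_w_Rad[OF w(1) u(3)]] by (simp add: u(1) scale_left_distrib)
  let ?N = "{z \<in> P (Suc m). lam z = 0}"
  have lamhom: "hom_on scale triv_scale (P (Suc m)) lam" using lam_rep unfolding represents_on_def by blast
  have Nsub: "subspace ?N" by (rule subspace_kernel[OF lamhom mod Psub module_triv_scale])
  \<comment> \<open>Since \<open>L\<close> is the image of \<open>?N\<close> under d, membership in
    Rad_U(L) lifts to Rad_U of the kernel of lam.\<close>
  have "\<exists>z. z \<in> Rad_pow scale ?U 1 ?N \<and> d (Suc m) z = v" if "v \<in> Rad_pow scale ?U 1 L" for v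
    using that mod subspace_kscale[OF mod L_sub]
  proof (induction rule: Rad_pow_induct)
    case zero
    then show ?case using Rad_pow_0[OF mod] hom_on_0[OF dhom mod Psub] by blast
  next
    case (step us l v)
    obtain z where z: "z \<in> Rad_pow scale ?U 1 ?N" "d (Suc m) z = v" using step by blast
    obtain q where q: "q \<in> P (Suc m)" "l = d (Suc m) q" "q \<in> ?N"
      using step(3) unfolding L_def Omega_def lam_def by auto
    have zP: "z \<in> P (Suc m)" using z(1) Rad_pow_subset[OF mod Nsub] by blast
    have "scale (prod_list us) q + z \<in> Rad_pow scale ?U 1 ?N"
      by (rule Rad_pow_add[OF mod Rad_pow_gen[OF mod step(1,2) q(3)] z(1)])
    moreover have "d (Suc m) (scale (prod_list us) q + z) = scale (prod_list us) l + v"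
      using q zP z(2) P_closed(3) by (simp add: hom_on_add[OF dhom] hom_on_scale[OF dhom])
    ultimately show ?case by blast
  qed
  then obtain z where z: "z \<in> Rad_pow scale ?U 1 ?N" "d (Suc m) z = scale u w" using uw by blast
  have zP: "z \<in> P (Suc m)" using z(1) Rad_pow_subset[OF mod Nsub] by blast
  obtain q where q: "q \<in> P (Suc m)" "w = d (Suc m) q" using w(1) unfolding Omega_def by blast
  have lq: "lam q = 1" using w(2) q(2) by (simp add: lam_def)
  \<comment> \<open>\<open>W\<close> turns the relation u w = d z into a cycle of degree s. By
    exactness it is the boundary of an element of degree s + 1, on which a product of s + 1 classes
    can be evaluated.\<close>
  define W where "W = scale u q - z"
  have uq: "scale u q \<in> P (Suc m)" using q P_closed(3) by blast
  have "d (Suc m) W = 0" unfolding W_def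
    using hom_on_diff[OF dhom mod Psub uq zP] q z(2) by (simp add: hom_on_scale[OF dhom])
  moreover have WP: "W \<in> P (Suc m)" unfolding W_def using uq zP P_closed(4) by blast
  ultimately have "W \<in> d (Suc (Suc m)) ` P (Suc (Suc m))" unfolding exS by simp
  then obtain Z where Z: "Z \<in> P (Suc (Suc m))" "d (Suc (Suc m)) Z = W" by blast
  have uqR: "scale u q \<in> Rad_pow scale ?U 1 (P (Suc m))"
    using Rad_pow_gen[OF mod, of "[u]" 1 ?U q "P (Suc m)"] uU q by simp
  have zR: "z \<in> Rad_pow scale ?U 1 (P (Suc m))"
    using z(1) Rad_pow_mono[OF mod subset_refl, of ?N "P (Suc m)"] by blast
  have WR: "W \<in> Rad_pow scale ?U 1 (P (Suc m))" unfolding W_def by (rule Rad_pow_diff[OF mod uqR zR])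
  have "lin (c i0) u = 0" if i0: "i0 \<in> {1..n}" for i0
  proof -
    \<comment> \<open>Index 0 is free in the family \<open>c\<close> and receives the additional
      class, giving s + 1 classes on a space spanned by s vectors.\<close>
    define e where "e i = (if i = 0 then c i0 else c i)" for i
    have e_add: "additive_map (e i)" if "i \<in> {0..Suc m}" for i
      using that c_add i0 mn unfolding e_def by auto
    let ?is = "[0..<Suc (Suc m)]"
    have map: "map e ?is = c i0 # map c [1..<Suc (Suc m)]"
    proof -
      have "map e [1..<Suc (Suc m)] = map c [1..<Suc (Suc m)]" unfolding e_def by (intro map_cong) auto
      moreover have "?is = 0 # [1..<Suc (Suc m)]" by (simp add: upt_conv_Cons)
      ultimately show ?thesis by (simp add: e_def)
    qed
    obtain c' cs where c': "additive_map c'" "\<forall>e\<in>set cs. additive_map e" "length ?is = Suc (length cs)"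
      "\<forall>v\<in>?U. lin c' v = 0" "coh (length ?is) (cprod (map e ?is)) (cprod (c' # cs))"
      using cprod_vanishing[of "Suc m" ?is e y] e_add by (auto simp del: upt_Suc)
    have lcs: "length cs = Suc m" using c'(3) by simp
    have "\<exists>mu. represents_on (length (c i0 # map c [1..<Suc (Suc m)])) mu (cprod (c i0 # map c [1..<Suc (Suc m)]))"
      using c_cprod c_add[OF i0] by (intro represents_on_cprod) auto
    then obtain mu where mu: "represents_on (Suc (Suc m)) mu (cprod (c i0 # map c [1..<Suc (Suc m)]))"
      by (auto simp del: upt_Suc cprod.simps)
    have ad0: "additive_map (c i0)" by (rule c_add[OF i0])
    from mu have "represents_on (Suc (Suc m)) mu (\<lambda>l. c i0 (hd l) * cprod (map c [1..<Suc (Suc m)]) (tl l))"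
      by (simp add: cprod_Cons del: upt_Suc)
    from represents_on_Cons_lift[OF this lam_rep ad0]
    obtain lt where "derivation_lift (Suc m) (c i0) lam mu lt" by (rule exE)
    note lt = derivation_liftD[OF this]
    obtain lam1 where lam1: "represents_on (Suc m) lam1 (cprod cs)"
      using represents_on_cprod[of cs] c'(2) lcs by auto
    have "represents_on (Suc (Suc m)) mu (cprod (c' # cs))"
      by (rule represents_on_coh[OF mu]) (use c'(5) map in \<open>simp del: upt_Suc cprod.simps\<close>)
    then have "represents_on (Suc (Suc m)) mu (\<lambda>l. c' (hd l) * cprod cs (tl l))" by (simp add: cprod_Cons)
    from represents_on_Cons_lift[OF this lam1 c'(1)]
    obtain lt' where "derivation_lift (Suc m) c' lam1 mu lt'" by (rule exE)
    note lt' = derivation_liftD(1,3)[OF this]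
    \<comment> \<open>The derivation rule gives e'(u) aug(h q) on each generator u q; the
      alternatives in \<open>or\<close> make one or the other factor vanish.\<close>
    have kill: "lin e' (h v) = 0"
      if h: "hom_on scale (*) (P (Suc m)) h" and e': "additive_map e'" and v: "v \<in> Rad_pow scale ?U 1 M" and M: "subspace M" "M \<subseteq> P (Suc m)"
        and or: "(\<forall>u\<in>?U. lin e' u = 0) \<or> (\<forall>q\<in>M. aug (h q) = 0)" for e' h v M
      using v mod subspace_kscale[OF mod M(1)]
    proof (induction rule: Rad_pow_induct)
      case zero
      then show ?case using hom_on_0[OF h mod Psub] by simp
    next
      case (step us q v)
      obtain u' where u': "us = [u']" "u' \<in> ?U" using step(1,2) by (auto simp: length_Suc_conv)
      have q: "q \<in> P (Suc m)" using step(3) M by blast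
      have v: "v \<in> P (Suc m)" using step(4) Rad_pow_subset[OF mod M(1)] M(2) by blast
      have "lin e' (u' * h q) = lin e' u' * aug (h q)" using UV V_aug u'(2) by (intro lin_prod_Rad[OF e']) blast
      also have "\<dots> = 0" using or u'(2) step(3) by auto
      finally have "lin e' (u' * h q) = 0" .
      moreover have "scale u' q \<in> P (Suc m)" using q P_closed(3) by blast
      ultimately show ?case using step u'(1) q v by (simp add: hom_on_add[OF h] hom_on_scale[OF h] lin_add)
    qed
    \<comment> \<open>mu Z is now computed twice: through c', which vanishes on U, it is 0; through
      c i0 it is lin (c i0) u, since lam is 1 on q and 0 on \<open>?N\<close>.\<close>
    have "mu Z = 0" using lt'(2)[OF Z(1)] kill[OF lt'(1) c'(1) WR Psub subset_refl] c'(4) Z(2) by simp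
    then have "0 = lin (c i0) (lt W)" using lt(3)[OF Z(1)] Z(2) by simp
    also have "lt W = u * lt q - lt z" unfolding W_def
      using hom_on_diff[OF lt(1) mod Psub uq zP] q by (simp add: hom_on_scale[OF lt(1)])
    also have "lin (c i0) \<dots> = lin (c i0) (u * lt q) - lin (c i0) (lt z)" by (rule lin_diff)
    also have "lin (c i0) (lt z) = 0" by (rule kill[OF lt(1) ad0 z(1) Nsub]) (use lt(2) in auto)
    also have "lin (c i0) (u * lt q) = lin (c i0) u"
      using lin_prod_Rad[OF ad0, of u "lt q"] UV V_aug uU lt(2)[OF q(1)] lq by auto
    finally show ?thesis by simp
  qed
  then have "u = 0" using V_eq_0 uU UV by blast
  then show "a \<in> Rad_pow (*) ?U 1 Rad" using u by simp
qed

end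

section \<open>Koszul elements\<close>

context ea_res
begin

definition drop_nth :: "nat \<Rightarrow> 'b list \<Rightarrow> 'b list" where "drop_nth j l = take j l @ drop (Suc j) l"

text \<open>\<open>\<kappa>\<close> on a list plays the role of the image of the exterior product of
  the listed x i. Lists are used instead of sets because \<open>\<kappa>\<close> need not be
  alternating.\<close>

definition koszul :: "(nat list \<Rightarrow> 'm) \<Rightarrow> bool"
  where "koszul \<kappa> \<longleftrightarrow> \<epsilon> (\<kappa> []) = 1 \<and> (\<forall>l. set l \<subseteq> {1..n} \<longrightarrow> \<kappa> l \<in> P (length l)) \<and>
    (\<forall>l. set l \<subseteq> {1..n} \<longrightarrow> l \<noteq> [] \<longrightarrow>
      d (length l) (\<kappa> l) = (\<Sum>j<length l. scale ((-1) ^ j * x (l ! j)) (\<kappa> (drop_nth j l))))"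

lemma koszul_P: "koszul \<kappa> \<Longrightarrow> set l \<subseteq> {1..n} \<Longrightarrow> length l = q \<Longrightarrow> \<kappa> l \<in> P q"
  unfolding koszul_def by auto

lemma koszul_d:
  assumes "koszul \<kappa>" "set l \<subseteq> {1..n}" "length l = Suc q"
  shows "d (Suc q) (\<kappa> l) = (\<Sum>j<Suc q. scale ((-1) ^ j * x (l ! j)) (\<kappa> (drop_nth j l)))"
proof -
  have "l \<noteq> []" using assms(3) by auto
  then show ?thesis using assms unfolding koszul_def by (metis (no_types, lifting))
qed

lemma drop_nth_Cons: "drop_nth (Suc j) (i # l) = i # drop_nth j l" "drop_nth 0 (i # l) = l"
  by (simp_all add: drop_nth_def)

lemma length_drop_nth: "j < length l \<Longrightarrow> length (drop_nth j l) = length l - 1"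
  by (simp add: drop_nth_def)

lemma set_drop_nth: "set (drop_nth j l) \<subseteq> set l"
  unfolding drop_nth_def using set_take_subset[of j l] set_drop_subset[of "Suc j" l] by auto

text \<open>
  \<open>h i\<close> is a null homotopy of the multiplication by \<open>x i\<close>.  The elements \<open>h i\<^sub>1 (\<dots> (h i\<^sub>q y\<^sub>0))\<close> satisfy the
  Koszul relations even though the homotopies need not anticommute.
\<close>

lemma koszul_exists: "\<exists>\<kappa>. koszul \<kappa>"
proof -
  have "\<exists>h. homotopy (\<lambda>_ y. scale (x i) y) h"
    if i: "i \<in> {1..n}" for i
  proof (rule null_homotopy)
    have hom: "hom_on scale scale (P q) (scale (x i))" for q
      by (rule hom_onI) (simp_all add: scale_right_distrib mult.commute)
    show "chain_endo (\<lambda>_ y. scale (x i) y)"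
      unfolding chain_endo_def using hom P_closed(3) by (auto simp: hom_on_scale[OF dhom])
    show "\<epsilon> (scale (x i) y) = 0" if "y \<in> P 0" for y
      using basis_of_aug[OF bas i] that by (simp add: hom_on_scale[OF \<epsilon>hom] triv_scale_def)
  qed
  then have "\<forall>i\<in>{1..n}. \<exists>h. homotopy (\<lambda>_ y. scale (x i) y) h" by (rule ballI)
  then obtain h where "\<forall>i\<in>{1..n}. homotopy (\<lambda>_ y. scale (x i) y) (h i)"
    by (subst (asm) bchoice_iff) (rule exE)
  then have h: "\<And>i q. i \<in> {1..n} \<Longrightarrow> hom_on scale scale (P q) (h i q)"
    "\<And>i q y. i \<in> {1..n} \<Longrightarrow> y \<in> P q \<Longrightarrow> h i q y \<in> P (Suc q)"
    "\<And>i y. i \<in> {1..n} \<Longrightarrow> y \<in> P 0 \<Longrightarrow> d (Suc 0) (h i 0 y) = scale (x i) y"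
    "\<And>i q y. i \<in> {1..n} \<Longrightarrow> y \<in> P (Suc q) \<Longrightarrow> d (Suc (Suc q)) (h i (Suc q) y) = scale (x i) y - h i q (d (Suc q) y)"
    by (simp_all add: homotopy_def image_subset_iff)
  obtain y0 where y0: "y0 \<in> P 0" "\<epsilon> y0 = 1" using \<epsilon>surj by (metis UNIV_I imageE)
  \<comment> \<open>The value at the tail has degree \<open>length l\<close>, which selects the
    component of the homotopy.\<close>
  define \<kappa> where "\<kappa> = rec_list y0 (\<lambda>i l r. h i (length l) r)"
  have \<kappa>: "\<kappa> [] = y0" "\<And>i l. \<kappa> (i # l) = h i (length l) (\<kappa> l)" unfolding \<kappa>_def by simp_all
  have P: "\<kappa> l \<in> P (length l)" if "set l \<subseteq> {1..n}" for l
    using that by (induction l) (simp_all add: \<kappa> y0 h(2))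
  have D: "d (length l) (\<kappa> l) = (\<Sum>j<length l. scale ((-1) ^ j * x (l ! j)) (\<kappa> (drop_nth j l)))"
    if "set l \<subseteq> {1..n}" "l \<noteq> []" for l
    using that
  proof (induction l)
    case (Cons i l)
    have i: "i \<in> {1..n}" and l: "set l \<subseteq> {1..n}" using Cons.prems by auto
    show ?case
    proof (cases l)
      case Nil
      then show ?thesis using h(3)[OF i y0(1)] by (simp add: \<kappa> drop_nth_def)
    next
      case (Cons i' l')
      define q where "q = length l'"
      have lq: "length l = Suc q" using Cons q_def by simp
      have dr: "length (drop_nth j l) = q" "\<kappa> (drop_nth j l) \<in> P q" if "j < Suc q" for j
        using length_drop_nth[of j l] that lq P[of "drop_nth j l"] set_drop_nth[of j l] l by auto
      \<comment> \<open>The relation d h = x - h d produces the summand of index 0 and shifts the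
        remaining signs by one.\<close>
      have "d (length (i # l)) (\<kappa> (i # l)) = scale (x i) (\<kappa> l) - h i q (d (Suc q) (\<kappa> l))"
        using h(4)[OF i, of "\<kappa> l" q] P[OF l] lq by (simp add: \<kappa>)
      also have "d (Suc q) (\<kappa> l) = (\<Sum>j<Suc q. scale ((-1) ^ j * x (l ! j)) (\<kappa> (drop_nth j l)))"
        using Cons.IH l lq Cons by simp
      also have "h i q \<dots> = (\<Sum>j<Suc q. scale ((-1) ^ j * x (l ! j)) (h i q (\<kappa> (drop_nth j l))))"
        using dr(2) P_closed(3)
        by (subst hom_on_sum[OF h(1)[OF i] mod Psub]) (auto simp: hom_on_scale[OF h(1)[OF i]] intro!: sum.cong)
      also have "\<dots> = (\<Sum>j<Suc q. scale ((-1) ^ j * x (l ! j)) (\<kappa> (drop_nth (Suc j) (i # l))))"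
        using dr(1) by (intro sum.cong refl) (simp add: drop_nth_Cons \<kappa>)
      also have "scale (x i) (\<kappa> l) - \<dots> = (\<Sum>j<Suc (Suc q). scale ((-1) ^ j * x ((i # l) ! j)) (\<kappa> (drop_nth j (i # l))))"
        by (subst sum.lessThan_Suc_shift) (simp add: drop_nth_Cons sum_negf)
      finally show ?thesis using lq by simp
    qed
  qed simp
  show ?thesis unfolding koszul_def using P D y0 \<kappa>(1) by (intro exI[of _ \<kappa>]) simp
qed

lemma lin_sign: "lin e ((-1) ^ j * a) = (-1) ^ j * lin e (a :: 'g \<Rightarrow>\<^sub>0 'k)"
  by (cases "even j") (simp_all add: lin_minus)

text \<open>Laplace expansion, along the first row, of the determinant of the values of the classes
  at the x i.\<close>

lemma koszul_value_step:
  assumes \<kappa>: "koszul \<kappa>" and lam: "represents_on (Suc q) lam (cprod (e # es))" and lam0: "represents_on q lam0 (cprod es)"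
    and e: "additive_map e" and l: "set l \<subseteq> {1..n}" "length l = Suc q"
  shows "lam (\<kappa> l) = (\<Sum>j<Suc q. (-1) ^ j * lin e (x (l ! j)) * lam0 (\<kappa> (drop_nth j l)))"
proof -
  have "represents_on (Suc q) lam (\<lambda>l. e (hd l) * cprod es (tl l))" using lam by (simp add: cprod_Cons)
  from represents_on_Cons_lift[OF this lam0 e]
  obtain lt where "derivation_lift q e lam0 lam lt" by (rule exE)
  note lt = derivation_liftD[OF this]
  have lP: "\<kappa> l \<in> P (Suc q)" by (rule koszul_P[OF \<kappa> l])
  have dr: "\<kappa> (drop_nth j l) \<in> P q" if "j < Suc q" for j
  proof -
    have "length (drop_nth j l) = q" "set (drop_nth j l) \<subseteq> {1..n}"
      using length_drop_nth[of j l] set_drop_nth[of j l] that l by auto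
    then show ?thesis by (intro koszul_P[OF \<kappa>])
  qed
  have "d (Suc q) (\<kappa> l) = (\<Sum>j<Suc q. scale ((-1) ^ j * x (l ! j)) (\<kappa> (drop_nth j l)))"
    by (rule koszul_d[OF \<kappa> l])
  then have "lam (\<kappa> l) = lin e (lt (\<Sum>j<Suc q. scale ((-1) ^ j * x (l ! j)) (\<kappa> (drop_nth j l))))"
    using lt(3)[OF lP] by simp
  also have "lt (\<Sum>j<Suc q. scale ((-1) ^ j * x (l ! j)) (\<kappa> (drop_nth j l)))
      = (\<Sum>j<Suc q. ((-1) ^ j * x (l ! j)) * lt (\<kappa> (drop_nth j l)))"
    using dr P_closed(3)
    by (subst hom_on_sum[OF lt(1) mod Psub]) (auto simp: hom_on_scale[OF lt(1)] intro!: sum.cong)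
  also have "lin e \<dots> = (\<Sum>j<Suc q. (-1) ^ j * lin e (x (l ! j)) * lam0 (\<kappa> (drop_nth j l)))"
    unfolding lin_sum
  proof (intro sum.cong refl)
    fix j assume j: "j \<in> {..<Suc q}"
    have "l ! j \<in> set l" using j l by simp
    then have "l ! j \<in> {1..n}" using l(1) by blast
    then have "aug (x (l ! j)) = 0" by (rule basis_of_aug[OF bas])
    then have "lin e (x (l ! j) * lt (\<kappa> (drop_nth j l))) = lin e (x (l ! j)) * lam0 (\<kappa> (drop_nth j l))"
      using e lt(2)[OF dr[of j]] j by (simp add: lin_mult additive_map_def)
    then show "lin e ((-1) ^ j * x (l ! j) * lt (\<kappa> (drop_nth j l))) = (-1) ^ j * lin e (x (l ! j)) * lam0 (\<kappa> (drop_nth j l))"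
      by (simp add: mult.assoc lin_sign)
  qed
  finally show ?thesis .
qed

text \<open>A determinant with a zero row, the one belonging to \<open>e0\<close>.\<close>

lemma koszul_value_0:
  assumes \<kappa>: "koszul \<kappa>" and "represents_on (length es) lam (cprod es)" "\<And>e. e \<in> set es \<Longrightarrow> additive_map e"
    and "set l \<subseteq> {1..n}" "length l = length es" and "e0 \<in> set es" "\<And>i. i \<in> set l \<Longrightarrow> lin e0 (x i) = 0"
  shows "lam (\<kappa> l) = 0"
  using assms(2-)
proof (induction es arbitrary: lam l)
  case (Cons e es)
  obtain lam0 where lam0: "represents_on (length es) lam0 (cprod es)"
    using represents_on_cprod[of es] Cons.prems(2) by auto
  have "lam (\<kappa> l) = (\<Sum>j<Suc (length es). (-1) ^ j * lin e (x (l ! j)) * lam0 (\<kappa> (drop_nth j l)))"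
    by (rule koszul_value_step[OF \<kappa> _ lam0]) (use Cons.prems in \<open>auto simp del: cprod.simps\<close>)
  also have "\<dots> = 0"
  proof (rule sum.neutral, rule ballI)
    fix j assume j: "j \<in> {..<Suc (length es)}"
    show "(-1) ^ j * lin e (x (l ! j)) * lam0 (\<kappa> (drop_nth j l)) = 0"
    proof (cases "e = e0")
      case True
      have "l ! j \<in> set l" using j Cons.prems(4) by simp
      then show ?thesis using Cons.prems(6) True by simp
    next
      case False
      have "lam0 (\<kappa> (drop_nth j l)) = 0"
      proof (rule Cons.IH[OF lam0])
        show "set (drop_nth j l) \<subseteq> {1..n}" using set_drop_nth[of j l] Cons.prems(3) by blast
        show "length (drop_nth j l) = length es" using j Cons.prems(4) length_drop_nth[of j l] by simp
        show "lin e0 (x i) = 0" if "i \<in> set (drop_nth j l)" for i using that set_drop_nth[of j l] Cons.prems(6) by blast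
      qed (use Cons.prems False in auto)
      then show ?thesis by simp
    qed
  qed
  finally show ?case .
qed simp

text \<open>The determinant of an identity matrix: in each expansion only the summand of index 0
  survives.\<close>

lemma koszul_value_1:
  assumes \<kappa>: "koszul \<kappa>" and "represents_on (length l) lam (cprod (map c l))" "\<And>i. i \<in> set l \<Longrightarrow> additive_map (c i)"
    and "set l \<subseteq> {1..n}" "distinct l" "\<And>i j. i \<in> set l \<Longrightarrow> j \<in> set l \<Longrightarrow> lin (c i) (x j) = (if i = j then 1 else 0)"
  shows "lam (\<kappa> l) = 1"
  using assms(2-)
proof (induction l arbitrary: lam)
  case Nil
  then have lam: "represents_on 0 lam (\<lambda>_. 1)" by (simp add: represents_on_def coh_def)
  moreover have "represents_on 0 \<epsilon> (\<lambda>_. 1)" using \<epsilon>hom \<phi>_Nil by (simp add: represents_on_def coh_def)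
  moreover have "\<kappa> [] \<in> P 0" "\<epsilon> (\<kappa> []) = 1" using \<kappa> unfolding koszul_def by (auto dest: spec[of _ "[]"])
  ultimately show ?case using represents_on_unique by metis
next
  case (Cons i l)
  obtain lam0 where lam0: "represents_on (length l) lam0 (cprod (map c l))"
    using represents_on_cprod[of "map c l"] Cons.prems(2) by auto
  have "lam (\<kappa> (i # l)) = (\<Sum>j<Suc (length l). (-1) ^ j * lin (c i) (x ((i # l) ! j)) * lam0 (\<kappa> (drop_nth j (i # l))))"
    by (rule koszul_value_step[OF \<kappa> _ lam0]) (use Cons.prems in \<open>auto simp del: cprod.simps\<close>)
  also have "\<dots> = lam0 (\<kappa> l)"
  proof (subst sum.lessThan_Suc_shift)
    have "lin (c i) (x (l ! j)) = 0" if "j < length l" for j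
      using that nth_mem[of j l] Cons.prems(4,5) by fastforce
    then show "(-1) ^ 0 * lin (c i) (x ((i # l) ! 0)) * lam0 (\<kappa> (drop_nth 0 (i # l))) +
      (\<Sum>j<length l. (-1) ^ Suc j * lin (c i) (x ((i # l) ! Suc j)) * lam0 (\<kappa> (drop_nth (Suc j) (i # l)))) = lam0 (\<kappa> l)"
      using Cons.prems(5)[of i i] by (simp add: drop_nth_Cons)
  qed
  also have "\<dots> = 1" by (rule Cons.IH[OF lam0]) (use Cons.prems in auto)
  finally show ?case .
qed

end

section \<open>Elements of the kernel from Koszul relations\<close>

context L_data
begin

text \<open>This supplies a w with f w = 1.\<close>

lemma koszul_element:
  obtains \<kappa> where "koszul \<kappa>" "d (Suc m) (\<kappa> [1..<Suc (Suc m)]) \<in> Om" "f (d (Suc m) (\<kappa> [1..<Suc (Suc m)])) = 1"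
proof -
  obtain \<kappa> where \<kappa>: "koszul \<kappa>" using koszul_exists ..
  let ?l = "[1..<Suc (Suc m)]"
  have l: "set ?l \<subseteq> {1..n}" "length ?l = Suc m" using mn by auto
  have "\<kappa> ?l \<in> P (Suc m)" by (rule koszul_P[OF \<kappa> l])
  then have "d (Suc m) (\<kappa> ?l) \<in> Om" unfolding Omega_def by blast
  moreover have "lam (\<kappa> ?l) = 1"
    by (rule koszul_value_1[OF \<kappa>, where c = c]) (use lam_rep l c_add c_dual in auto)
  ultimately show ?thesis using that \<kappa> unfolding lam_def by blast
qed

text \<open>The product of all x_i^(p - 1) with i at most s spans the socle of k[U], so it kills w,
  a combination of multiples of x_1, ..., x_s. It is nonzero, hence not in its own product with the
  radical.\<close>

lemma not_full_top:
  "\<exists>w\<in>Om. f w = 1 \<and> \<not> full w (A.span (x ` {1..Suc m})) ((p - 1) * Suc m)"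
proof -
  obtain \<kappa> where \<kappa>: "koszul \<kappa>" "d (Suc m) (\<kappa> [1..<Suc (Suc m)]) \<in> Om" "f (d (Suc m) (\<kappa> [1..<Suc (Suc m)])) = 1"
    by (rule koszul_element)
  let ?l = "[1..<Suc (Suc m)]" and ?U = "A.span (x ` {1..Suc m})" and ?t = "(p - 1) * Suc m"
  let ?w = "d (Suc m) (\<kappa> ?l)"
  have l: "set ?l \<subseteq> {1..n}" "length ?l = Suc m" "?l \<noteq> []" using mn by auto
  have aug: "aug (x i) = 0" if "i \<in> {1..Suc m}" for i using basis_of_aug[OF bas] that mn by auto
  define us where "us = concat (map (\<lambda>i. replicate (p - 1) (x i)) ?l)"
  have set_us: "set us \<subseteq> ?U" unfolding us_def by (auto intro: A.span_base)
  have "length us = sum_list (map (\<lambda>i. p - 1) ?l)" unfolding us_def by (simp add: length_concat comp_def)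
  then have len_us: "length us = ?t" by (simp add: sum_list_triv del: upt_Suc)
  have prod_us: "prod_list us = mon (Suc m) x (\<lambda>_. p - 1)"
  proof -
    have "prod_list (concat (map (\<lambda>i. replicate (p - 1) (x i)) l)) = (\<Prod>i\<leftarrow>l. x i ^ (p - 1))" for l
      by (induction l) simp_all
    then have "prod_list us = (\<Prod>i\<leftarrow>?l. x i ^ (p - 1))" unfolding us_def by blast
    also have "\<dots> = (\<Prod>i\<in>set ?l. x i ^ (p - 1))" by (rule prod.distinct_set_conv_list[symmetric]) simp
    also have "set ?l = {1..Suc m}" by auto
    finally show ?thesis by (simp only: mon_def)
  qed
  let ?N = "prod_list us"
  have w: "?w = (\<Sum>j<length ?l. scale ((-1) ^ j * x (?l ! j)) (\<kappa> (drop_nth j ?l)))"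
    unfolding l(2) by (rule koszul_d[OF \<kappa>(1) l(1,2)])
  have "scale ?N ?w = (\<Sum>j<length ?l. scale (?N * ((-1) ^ j * x (?l ! j))) (\<kappa> (drop_nth j ?l)))"
    by (subst w) (simp only: scale_sum_right scale_scale)
  also have "\<dots> = 0"
  proof (rule sum.neutral, rule ballI)
    fix j assume j: "j \<in> {..<length ?l}"
    then have "?l ! j \<in> {1..Suc m}" using nth_mem[of j ?l] by auto
    then have "set (us @ [x (?l ! j)]) \<subseteq> ?U" using set_us by (auto intro: A.span_base)
    then have "prod_list (us @ [x (?l ! j)]) = 0" by (rule prod_list_eq_0[OF _ aug]) (use len_us in auto)
    then have "?N * x (?l ! j) = 0" by simp
    then have "?N * ((-1) ^ j * x (?l ! j)) = 0" by (metis mult.left_commute mult_zero_right)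
    then show "scale (?N * ((-1) ^ j * x (?l ! j))) (\<kappa> (drop_nth j ?l)) = 0" by simp
  qed
  finally have "scale ?N ?w = 0" .
  then have K: "?N \<in> Kset ?w ?U ?t"
    unfolding Kset_def using Rad_pow_0[OF mod] Rad_pow_gen[OF module_mult len_us set_us, of 1 UNIV] by simp
  \<comment> \<open>In degree (p - 1) s a monomial other than the socle monomial has an exponent at
    least \<open>p\<close> and vanishes.\<close>
  have "\<exists>b\<in>Rad. a = ?N * b" if "a \<in> Rad_pow (*) ?U ?t Rad" for a
    using that module_mult subspace_kscale[OF module_mult Rad_sub]
  proof (induction rule: Rad_pow_induct)
    case zero
    then show ?case by (intro bexI[of _ 0]) (simp_all add: Rad_eq)
  next
    case (step vs v z)
    obtain b where b: "b \<in> Rad" "z = ?N * b" using step by blast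
    have sub: "{mon (Suc m) x e |e. sum e {1..Suc m} = length vs} \<subseteq> {0, ?N}"
    proof
      fix a assume "a \<in> {mon (Suc m) x e |e. sum e {1..Suc m} = length vs}"
      then obtain e where e: "a = mon (Suc m) x e" "sum e {1..Suc m} = ?t" using step(1) by auto
      show "a \<in> {0, ?N}"
      proof (cases "\<exists>i\<in>{1..Suc m}. e i \<ge> p")
        case True
        then show ?thesis using mon_eq_0[of _ "Suc m" x e] aug e(1) by blast
      next
        case False
        have "e i = p - 1" if i: "i \<in> {1..Suc m}" for i
        proof (rule ccontr)
          assume ne: "e i \<noteq> p - 1"
          have le: "e i' \<le> p - 1" if "i' \<in> {1..Suc m}" for i' using False that by force
          then have "sum e {1..Suc m} < (\<Sum>i\<in>{1..Suc m}. p - 1)"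
            using ne i by (intro sum_strict_mono_ex1) (auto intro!: bexI[of _ i] simp: le_neq_implies_less)
          then show False using e(2) by (simp add: mult.commute)
        qed
        then have "a = mon (Suc m) x (\<lambda>_. p - 1)" unfolding e(1) by (rule mon_cong)
        then show ?thesis using prod_us by simp
      qed
    qed
    have "prod_list vs \<in> A.span {0, ?N}" using prod_list_span_mon[OF step(2)] A.span_mono[OF sub] by blast
    then obtain k where "prod_list vs = kscale (*) k ?N" by (auto simp: A.span_insert_0 A.span_singleton)
    then have "prod_list vs * v + z = ?N * (Poly_Mapping.single 0 k * v + b)"
      unfolding b(2) by (simp add: kscale_def algebra_simps)
    moreover have "Poly_Mapping.single 0 k * v + b \<in> Rad" using step(3) b(1) by (simp add: Rad_eq aug_add)
    ultimately show ?case by blast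
  qed
  \<comment> \<open>Otherwise the unit 1 - b would kill the socle monomial.\<close>
  moreover have "?N \<noteq> ?N * b" if "b \<in> Rad" for b
  proof
    assume eq: "?N = ?N * b"
    have "aug (1 - b) \<noteq> 0" using that by (simp add: Rad_eq aug_diff)
    then obtain b' where b': "(1 - b) * b' = 1" using unit by blast
    have "?N * (1 - b) = 0" using eq by (simp add: right_diff_distrib)
    then have "?N * ((1 - b) * b') = 0" by (metis mult.assoc mult_zero_left)
    then have N0: "?N = 0" unfolding b' by simp
    \<comment> \<open>Padding the exponents with zeros to \<open>n\<close> variables makes the socle
      monomial a member of the monomial basis of kE.\<close>
    let ?e = "\<lambda>i\<in>{1..n}. if i \<le> Suc m then p - 1 else 0"
    have "mon n x ?e = (\<Prod>i\<in>{1..n}. if i \<in> {1..Suc m} then x i ^ (p - 1) else 1)"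
      unfolding mon_def by (intro prod.cong refl) auto
    also have "\<dots> = (\<Prod>i\<in>{1..n} \<inter> {1..Suc m}. x i ^ (p - 1))" by (rule prod.inter_restrict[symmetric]) simp
    also have "{1..n} \<inter> {1..Suc m} = {1..Suc m}" using mn by auto
    finally have "mon n x ?e = 0" using N0 prod_us by (simp add: mon_def)
    moreover have "?e \<in> expos" unfolding expos_def using p2 by (auto intro!: restrict_PiE_iff[THEN iffD2])
    ultimately have "0 \<in> mon n x ` expos" using imageI[of ?e expos "mon n x"] by simp
    then have "A.dependent (mon n x ` expos)" by (rule A.dependent_zero)
    then show False using mon_basis(2)[OF bas] by simp
  qed
  ultimately have "\<not> full ?w ?U ?t" using K unfolding full_def by blast
  then show ?thesis using \<kappa> by blast
qed

text \<open>Applying d twice to the Koszul element of x_v, x_1, ..., x_s with v = s + 1 expresses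
  x_v w through x_1, ..., x_s and elements of \<open>L\<close>. Placing v first gives the term of w
  a positive sign.\<close>

lemma not_full_one:
  assumes r: "Suc m < r" "r \<le> n"
  shows "\<exists>w\<in>Om. f w = 1 \<and> \<not> full w (A.span (x ` {1..r})) 1"
proof -
  obtain \<kappa> where \<kappa>: "koszul \<kappa>" "d (Suc m) (\<kappa> [1..<Suc (Suc m)]) \<in> Om" "f (d (Suc m) (\<kappa> [1..<Suc (Suc m)])) = 1"
    by (rule koszul_element)
  let ?l = "[1..<Suc (Suc m)]" and ?U = "A.span (x ` {1..r})" and ?v = "Suc (Suc m)"
  let ?w = "d (Suc m) (\<kappa> ?l)" and ?l' = "?v # ?l"
  have l': "set ?l' \<subseteq> {1..r}" "set ?l' \<subseteq> {1..n}" "length ?l' = Suc (Suc m)" "distinct ?l'" using r by auto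
  have lam1: "length (map c ?l) = Suc m" by simp
  define z where "z j = \<kappa> (drop_nth j ?l')" for j
  have dr: "length (drop_nth j ?l') = Suc m" "set (drop_nth j ?l') \<subseteq> {1..n}" if "j < Suc (Suc m)" for j
    using length_drop_nth[of j ?l'] set_drop_nth[of j ?l'] that l' by auto
  have zP: "z j \<in> P (Suc m)" if "j < Suc (Suc m)" for j
    unfolding z_def by (rule koszul_P[OF \<kappa>(1) dr(2,1)[OF that]])
  have "\<kappa> ?l' \<in> P (Suc (Suc m))" by (rule koszul_P[OF \<kappa>(1) l'(2,3)])
  then have "d (Suc m) (d (Suc (Suc m)) (\<kappa> ?l')) = 0" by (rule dd)
  moreover have "d (Suc (Suc m)) (\<kappa> ?l') = (\<Sum>j<Suc (Suc m). scale ((-1) ^ j * x (?l' ! j)) (z j))"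
    unfolding z_def by (rule koszul_d[OF \<kappa>(1) l'(2,3)])
  ultimately have "0 = d (Suc m) (\<Sum>j<Suc (Suc m). scale ((-1) ^ j * x (?l' ! j)) (z j))" by simp
  also have "\<dots> = (\<Sum>j<Suc (Suc m). scale ((-1) ^ j * x (?l' ! j)) (d (Suc m) (z j)))"
    using zP P_closed(3)
    by (subst hom_on_sum[OF dhom mod Psub]) (auto simp: hom_on_scale[OF dhom] intro!: sum.cong)
  also have "\<dots> = scale (x ?v) ?w + (\<Sum>j<Suc m. scale ((-1) ^ Suc j * x (?l ! j)) (d (Suc m) (z (Suc j))))"
    by (subst sum.lessThan_Suc_shift) (simp add: z_def drop_nth_Cons del: upt_Suc)
  finally have sum: "0 = scale (x ?v) ?w + (\<Sum>j<Suc m. scale ((-1) ^ Suc j * x (?l ! j)) (d (Suc m) (z (Suc j))))" .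
  have "scale (x ?v) ?w = - (\<Sum>j<Suc m. scale ((-1) ^ Suc j * x (?l ! j)) (d (Suc m) (z (Suc j))))"
    by (rule eq_neg_iff_add_eq_0[THEN iffD2, OF sum[symmetric]])
  also have "\<dots> = (\<Sum>j<Suc m. scale (x (?l ! j)) (scale ((-1) ^ j) (d (Suc m) (z (Suc j)))))"
    unfolding sum_negf[symmetric] by (intro sum.cong refl) (simp add: mult.commute del: upt_Suc)
  also have "\<dots> \<in> Rad_pow scale ?U 1 L"
  proof (rule Rad_pow_sum[OF mod])
    fix j assume j: "j \<in> {..<Suc m}"
    then have lj: "?l ! j = Suc j" using nth_upt[of 1 j "Suc (Suc m)"] by (simp del: upt_Suc)
    \<comment> \<open>z (Suc j) omits the index Suc j, so the class c (Suc j) vanishes on all its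
      remaining indices and gives a zero row.\<close>
    have "lam (z (Suc j)) = 0" unfolding z_def
    proof (rule koszul_value_0[OF \<kappa>(1), of "map c ?l" lam _ "c (Suc j)"])
      show "represents_on (length (map c ?l)) lam (cprod (map c ?l))" using lam_rep lam1 by metis
      show "additive_map e" if "e \<in> set (map c ?l)" for e using c_cprod that .
      show "set (drop_nth (Suc j) ?l') \<subseteq> {1..n}" using dr(2)[of "Suc j"] j by simp
      show "length (drop_nth (Suc j) ?l') = length (map c ?l)" using dr(1)[of "Suc j"] j lam1 by simp
      have "Suc j \<in> set ?l" unfolding set_upt using j by simp
      then show "c (Suc j) \<in> set (map c ?l)" unfolding set_map by (rule imageI)
      fix i assume i: "i \<in> set (drop_nth (Suc j) ?l')"
      define A B where "A = take (Suc j) ?l'" and "B = drop (Suc (Suc j)) ?l'"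
      have "?l' = A @ Suc j # B"
        using id_take_nth_drop[of "Suc j" ?l'] j l'(3) lj by (simp add: A_def B_def)
      then have "distinct (A @ Suc j # B)" using l'(4) by simp
      moreover have "drop_nth (Suc j) ?l' = A @ B" by (simp add: drop_nth_def A_def B_def)
      ultimately have "Suc j \<notin> set (drop_nth (Suc j) ?l')" by simp
      then show "lin (c (Suc j)) (x i) = 0"
        using c_dual[of "Suc j" i] i set_drop_nth[of "Suc j" ?l'] l'(2) j mn by auto
    qed
    then have "d (Suc m) (z (Suc j)) \<in> L" unfolding L_def Omega_def lam_def using zP[of "Suc j"] j by auto
    then have "scale ((-1) ^ j) (d (Suc m) (z (Suc j))) \<in> L" using subspace_scale[OF L_sub] by blast
    moreover have "x (?l ! j) \<in> ?U" unfolding lj using j r by (intro A.span_base) auto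
    ultimately show "scale (x (?l ! j)) (scale ((-1) ^ j) (d (Suc m) (z (Suc j)))) \<in> Rad_pow scale ?U 1 L"
      using Rad_pow_gen[OF mod, of "[x (?l ! j)]" 1 ?U] by (simp del: upt_Suc scale_scale)
  qed
  finally have "scale (x ?v) ?w \<in> Rad_pow scale ?U 1 L" .
  moreover have "x ?v \<in> ?U" using r by (intro A.span_base) auto
  then have "x ?v \<in> Rad_pow (*) ?U 1 UNIV" using Rad_pow_gen[OF module_mult, of "[x ?v]" 1 ?U 1 UNIV] by simp
  ultimately have K: "x ?v \<in> Kset ?w ?U 1" unfolding Kset_def by blast
  have vn: "?v \<in> {1..n}" using r by auto
  have UV: "?U \<subseteq> V"
  proof -
    have "?U \<subseteq> A.span (x ` {1..n})" using r by (intro A.span_mono) auto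
    then show ?thesis using bas unfolding basis_of_def by simp
  qed
  \<comment> \<open>As a derivation, c v kills products of an element of U with the radical, whereas
    its value at x_v is 1.\<close>
  have "lin (c ?v) a = 0" if "a \<in> Rad_pow (*) ?U 1 Rad" for a
    using that module_mult subspace_kscale[OF module_mult Rad_sub]
  proof (induction rule: Rad_pow_induct)
    case (step us b a)
    then obtain u where u: "us = [u]" "u \<in> ?U" by (auto simp: length_Suc_conv)
    then have "aug u = 0" using UV V_aug by blast
    moreover have "aug b = 0" using step(3) unfolding Rad_eq by simp
    ultimately have "lin (c ?v) (u * b) = 0" using lin_prod_Rad[OF c_add[OF vn]] by simp
    then show ?case using step u(1) by (simp add: lin_add)
  qed simp
  moreover have "lin (c ?v) (x ?v) = 1" using c_dual[OF vn vn] by simp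
  ultimately have "x ?v \<notin> Rad_pow (*) ?U 1 Rad" by auto
  then have "\<not> full ?w ?U 1" using K unfolding full_def by blast
  then show ?thesis using \<kappa> by blast
qed

section \<open>From the kernel to constant and non-constant ranks\<close>

lemma constant_Rad_rankI:
  assumes "\<And>y w. basis_of V n y \<Longrightarrow> w \<in> Om \<Longrightarrow> f w = 1 \<Longrightarrow> full w (A.span (y ` {1..r})) j"
  shows "constant_Rad_rank V scale L r j"
  unfolding constant_Rad_rank_def
proof (intro allI impI)
  fix U U'
  assume "A.subspace U \<and> U \<subseteq> V \<and> A.dim U = r \<and> A.subspace U' \<and> U' \<subseteq> V \<and> A.dim U' = r"
  then have U: "A.subspace U" "U \<subseteq> V" "A.dim U = r" and U': "A.subspace U'" "U' \<subseteq> V" "A.dim U' = r" by auto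
  obtain y where y: "basis_of V n y" "A.span (y ` {1..r}) = U" "r \<le> n" by (rule adapted_basis[OF U])
  obtain y' where y': "basis_of V n y'" "A.span (y' ` {1..r}) = U'" by (rule adapted_basis[OF U'])
  obtain \<kappa> where \<kappa>: "d (Suc m) (\<kappa> [1..<Suc (Suc m)]) \<in> Om" "f (d (Suc m) (\<kappa> [1..<Suc (Suc m)])) = 1"
    by (rule koszul_element)
  show "k.dim (Rad_pow scale U j L) = k.dim (Rad_pow scale U' j L)"
    using dim_L_compare[OF y(1) y'(1) y(3) y(2)[symmetric] y'(2)[symmetric] \<kappa> \<kappa>] assms[OF y(1) \<kappa>] assms[OF y'(1) \<kappa>] y(2) y'(2)
    by simp
qed

text \<open>The first class vanishes on \<open>\<langle>x\<^sub>2, \<dots>, x\<^sub>r\<^sub>+\<^sub>1\<rangle>\<close>.\<close>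

lemma not_constant_Rad_rankI:
  assumes r: "r < n" and w: "w \<in> Om" "f w = 1" "\<not> full w (A.span (x ` {1..r})) j"
  shows "\<not> constant_Rad_rank V scale L r j"
proof
  assume const: "constant_Rad_rank V scale L r j"
  \<comment> \<open>A cyclic shift of the basis; as r < n, its first \<open>r\<close> members avoid
    x 1.\<close>
  define y where "y i = (if i < n then x (Suc i) else x 1)" for i
  have bx: "inj_on x {1..n}" "A.independent (x ` {1..n})" "A.span (x ` {1..n}) = V" using bas unfolding basis_of_def by auto
  define \<pi> where "\<pi> i = (if i < n then Suc i else 1)" for i
  have \<pi>: "bij_betw \<pi> {1..n} {1..n}"
    by (rule bij_betwI[of _ _ _ "\<lambda>i. if i = 1 then n else i - 1"]) (use r in \<open>auto simp: \<pi>_def\<close>)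
  have y\<pi>: "y = (\<lambda>i. x (\<pi> i))" by (rule HOL.ext) (simp add: y_def \<pi>_def)
  have "y ` {1..n} = x ` {1..n}" using \<pi> unfolding y\<pi> bij_betw_def by (metis image_image)
  moreover have "inj_on y {1..n}"
    using comp_inj_on[of \<pi> "{1..n}" x] \<pi> bx(1) unfolding y\<pi> bij_betw_def by (simp add: comp_def)
  ultimately have by': "basis_of V n y" using bx unfolding basis_of_def by simp
  have dim: "A.subspace (A.span (z ` {1..r})) \<and> A.span (z ` {1..r}) \<subseteq> V \<and> A.dim (A.span (z ` {1..r})) = r"
    if z: "basis_of V n z" for z
  proof -
    have sub: "z ` {1..r} \<subseteq> z ` {1..n}" using r by auto
    have "A.independent (z ` {1..r})" using z A.independent_mono[OF _ sub] unfolding basis_of_def by blast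
    then have "A.dim (A.span (z ` {1..r})) = card (z ` {1..r})" by (rule A.dim_span_eq_card_independent)
    also have "\<dots> = r" using z r unfolding basis_of_def by (subst card_image) (auto intro: inj_on_subset)
    finally show ?thesis using A.span_mono[OF sub] z unfolding basis_of_def by simp
  qed
  have "full w (A.span (y ` {1..r})) j"
  \<comment> \<open>The factor that vanishes on this subspace already stands first in the product,
    so no relation between classes has to be invoked.\<close>
  proof (rule full_of_dependent[OF by' _ refl _ _ _ _ _ w(1,2), of r "c 1" "map c [2..<Suc (Suc m)]"])
    show "r \<le> n" using r by simp
    show "additive_map (c 1)" using c_add[of 1] mn by simp
    show "\<forall>e\<in>set (map c [2..<Suc (Suc m)]). additive_map e"
      using c_add mn by (auto simp del: upt_Suc)
    show "length (map c [2..<Suc (Suc m)]) = m" by (simp del: upt_Suc)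
    have "[1..<Suc (Suc m)] = 1 # [2..<Suc (Suc m)]" by (subst upt_conv_Cons) (simp_all add: numeral_2_eq_2 del: upt_Suc)
    then have "map c [1..<Suc (Suc m)] = c 1 # map c [2..<Suc (Suc m)]" by (simp del: upt_Suc)
    then show "coh (Suc m) (cprod (map c [1..<Suc (Suc m)])) (cprod (c 1 # map c [2..<Suc (Suc m)]))"
      by (metis coh_eq)
    show "lin (c 1) u = 0" if "u \<in> A.span (y ` {1..r})" for u
      by (rule lin_span_zero[OF _ that]) (use r c_dual[of 1] mn in \<open>auto simp: y_def\<close>)
  qed
  then have "k.dim (Rad_pow scale (A.span (y ` {1..r})) j L) \<noteq> k.dim (Rad_pow scale (A.span (x ` {1..r})) j L)"
    using dim_L_compare[OF by' bas _ refl refl w(1,2) w(1,2)] w(3) r by simp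
  then show False using const dim[OF by'] dim[OF bas] unfolding constant_Rad_rank_def by blast
qed

lemma small_radical_type: "r < Suc m \<Longrightarrow> constant_radical_type p V scale L r"
  unfolding constant_radical_type_def by (intro allI impI constant_Rad_rankI full_small)

lemma rank_one: "constant_Rad_rank V scale L (Suc m) 1"
  by (intro constant_Rad_rankI full_rank_one)

lemma not_radical_type: "\<not> constant_radical_type p V scale L (Suc m)"
proof -
  obtain w where "w \<in> Om" "f w = 1" "\<not> full w (A.span (x ` {1..Suc m})) ((p - 1) * Suc m)"
    using not_full_top by blast
  then have "\<not> constant_Rad_rank V scale L (Suc m) ((p - 1) * Suc m)" by (intro not_constant_Rad_rankI mn)
  moreover have "1 \<le> (p - 1) * Suc m" using p2 by simp
  ultimately show ?thesis unfolding constant_radical_type_def by blast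
qed

lemma not_rank_one: "Suc m < r \<Longrightarrow> r < n \<Longrightarrow> \<not> constant_Rad_rank V scale L r 1"
  using not_full_one[of r] not_constant_Rad_rankI by fastforce

end

theorem proposition5p9:
  fixes p n s :: nat
    and V :: "('g::{finite, ab_group_add} \<Rightarrow>\<^sub>0 'k::alg_closed_field) set"
    and x :: "nat \<Rightarrow> 'g \<Rightarrow>\<^sub>0 'k"
    and \<eta> :: "nat \<Rightarrow> ('g list \<Rightarrow> 'k) set"
    and scale :: "('g \<Rightarrow>\<^sub>0 'k) \<Rightarrow> 'm::ab_group_add \<Rightarrow> 'm"
    and L :: "'m set"
  assumes "CHAR('k) = p" and "p > 2"
    and "elementary_abelian TYPE('g) p n"
    and "lifts_rad_quotient V" and "basis_of V n x"
    and "H1_dual_basis n x \<eta>"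
    and "1 < s" and "s < n"
    and "module scale"
    and "is_L_zeta scale s (cup_prod \<eta> s) L"
  shows "(\<forall>r<s. constant_radical_type p V scale L r) \<and>
         (constant_Rad_rank V scale L s 1 \<and> \<not> constant_radical_type p V scale L s) \<and>
         (\<forall>r. s < r \<and> r < n \<longrightarrow> \<not> constant_Rad_rank V scale L r 1)"
proof -
  obtain m where s: "s = Suc m" using assms(7) by (cases s) auto
  obtain P d \<epsilon> f where Pd: "minimal_projective_resolution scale P d \<epsilon>" "represents scale P d \<epsilon> s f (cup_prod \<eta> s)"
    and L: "L = {w \<in> Omega P d s. f w = 0}"
    using assms(10) unfolding is_L_zeta_def by blast
  obtain \<phi> where fh: "hom_on scale triv_scale (Omega P d s) f" and \<phi>: "bar_comparison scale P d \<epsilon> \<phi>"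
    and cls: "coh_class s (\<lambda>gs. if length gs = s then f (d s (\<phi> gs)) else 0) = cup_prod \<eta> s"
    using Pd(2) unfolding represents_def by blast
  have "\<forall>i\<in>{1..n}. \<exists>c. additive_map c \<and> (\<exists>z. z \<in> \<eta> i) \<and> (\<forall>z\<in>\<eta> i. \<forall>g. z [g] = c g)"
    using assms(6) cohomology_1 unfolding H1_dual_basis_def by blast
  then obtain c where c: "\<forall>i\<in>{1..n}. additive_map (c i) \<and> (\<exists>z. z \<in> \<eta> i) \<and> (\<forall>z\<in>\<eta> i. \<forall>g. z [g] = c i g)"
    by (subst (asm) bchoice_iff) (rule exE)
  have dual: "lin (c i) (x j) = (if i = j then 1 else 0)" if ij: "i \<in> {1..n}" "j \<in> {1..n}" for i j
  proof -
    obtain z where z: "z \<in> \<eta> i" using c ij by blast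
    have "H1_pairing z (x j) = (if i = j then 1 else 0)" using assms(6) ij z unfolding H1_dual_basis_def by blast
    moreover have "\<forall>g. z [g] = c i g" using c ij z by blast
    ultimately show ?thesis by (simp add: H1_pairing_def lin_def)
  qed
  let ?z = "\<lambda>gs. if length gs = s then f (d s (\<phi> gs)) else 0"
  \<comment> \<open>The cochain of f lies in its own class, hence in \<open>cup_prod\<close>, whose
    members are all cohomologous to the explicit product.\<close>
  have "?z \<in> coh_class s ?z"
    unfolding coh_class_def by (rule CollectI, rule exI[of _ "\<lambda>_. 0"]) (simp add: coboundaries_def)
  then have zc: "coh s ?z (cprod (map c [1..<Suc s]))"
    unfolding cls using assms(8) c by (intro cup_prod_coh[where \<eta> = \<eta>]) auto
  have rep: "coh s (\<lambda>gs. f (d s (\<phi> gs))) (cprod (map c [1..<Suc s]))"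
    by (rule coh_trans[OF coh_eq zc]) simp
  interpret L_data p n V x scale P d \<epsilon> \<phi> c m f
  proof (intro L_data.intro ea_res.intro elem_ab_algebra.intro min_res.intro ea_res_axioms.intro L_data_axioms.intro)
    show "additive_map (c i)" if "i \<in> {1..n}" for i using c that by blast
    show "Suc m < n" using assms(8) s by simp
    show "hom_on scale triv_scale (Omega P d (Suc m)) f" using fh s by simp
    show "coh (Suc m) (\<lambda>gs. f (d (Suc m) (\<phi> gs))) (cprod (map c [1..<Suc (Suc m)]))" using rep unfolding s .
  qed (fact assms Pd \<phi> dual)+
  have "L = L_data.L P d m f" using L_def L s by simp
  then show ?thesis
    using small_radical_type rank_one not_radical_type not_rank_one unfolding s by simp
qed

end
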